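(* Let $f\in C^2(\mathbb{R})$ be such that $f(0)=0$ and, for some $\varepsilon>0$, $f'(s)\le 0$ for all $s\in(0,\varepsilon)$. Let $u>0$ be a bounded solution to $-\Delta u=f(u)$ in $\mathbb{R}^2$ such that, for suitable constants $C>0$, $M>0$, $\sigma>0$, $$u(x_1,x_2)\le C|x_2|^{-(1+\sigma)}\qquad\text{for }|x_2|>M.$$ Assume furthermore that $\frac{\partial u}{\partial x_1}(x_1,x_2)\to 0$ as $|x_1|\to\infty$, for any $x_2$. Then $u$ is symmetric in $x_2$, that is, there exists $\lambda\in\mathbb{R}$ such that $u(x_1,x_2)$ depends only on $x_1$ and $|x_2-\lambda|$.
   Context: Solutions are classical ($C^2$). *)

theory Defs
  imports "HOL-Analysis.Analysis"
begin

text \<open>Junk value if \<open>u\<close> is not differentiable at \<open>x\<close>; only used for differentiable functions.\<close>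

definition dir_deriv :: "'a::euclidean_space \<Rightarrow> ('a \<Rightarrow> real) \<Rightarrow> 'a \<Rightarrow> real" where
  "dir_deriv v u x = frechet_derivative u (at x) v"

primrec Ck :: "nat \<Rightarrow> ('a::euclidean_space \<Rightarrow> real) \<Rightarrow> bool" where
  "Ck 0 u \<longleftrightarrow> continuous_on UNIV u"
| "Ck (Suc k) u \<longleftrightarrow> (\<forall>x. u differentiable (at x)) \<and> (\<forall>b\<in>Basis. Ck k (dir_deriv b u))"

definition laplacian :: "('a::euclidean_space \<Rightarrow> real) \<Rightarrow> 'a \<Rightarrow> real" where
  "laplacian u x = (\<Sum>b\<in>Basis. dir_deriv b (dir_deriv b u) x)"

lemma dir_deriv_real:
  fixes f :: "real \<Rightarrow> real"
  assumes "f differentiable (at x)"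
  shows "dir_deriv 1 f x = deriv f x"
proof -
  have "(f has_field_derivative deriv f x) (at x)"
    using assms DERIV_deriv_iff_real_differentiable by blast
  then have "frechet_derivative f (at x) = (\<lambda>h. deriv f x * h)"
    using frechet_derivative_at[symmetric] unfolding has_field_derivative_def by blast
  then show ?thesis by (simp add: dir_deriv_def)
qed

lemma Ck_Suc_real:
  fixes f :: "real \<Rightarrow> real"
  shows "Ck (Suc k) f \<longleftrightarrow> (\<forall>x. f differentiable (at x)) \<and> Ck k (deriv f)"
proof (cases "\<forall>x. f differentiable (at x)")
  case True
  then have "dir_deriv 1 f = deriv f" by (auto simp: dir_deriv_real)
  with True show ?thesis by simp
qed auto

lemma laplacian_plane:
  fixes u :: "real \<times> real \<Rightarrow> real"
  shows "laplacian u x =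
    dir_deriv (1, 0) (dir_deriv (1, 0) u) x + dir_deriv (0, 1) (dir_deriv (0, 1) u) x"
  by (simp add: laplacian_def Basis_prod_def sum.union_disjoint)

end

theory Submission
  imports Defs
begin

text \<open>Let \<open>T = (u\<^sub>1\<^sup>2 - u\<^sub>2\<^sup>2) / 2 + F(u)\<close> with \<open>F' = f\<close>. Moving planes from above and from below stop at
  positions \<open>k\<close> and \<open>k'\<close>. At such a position either the plane touches at a finite point, and the strong
  maximum principle or Hopf's lemma yields symmetry, or it touches along a sequence of points whose first
  coordinates tend to infinity while \<open>u\<close> stays away from zero. In the latter case \<open>u\<^sub>1 \<rightarrow> 0\<close> forces
  the profiles to solve an ODE asymptotically, hence to be asymptotically even about \<open>k\<close>, so that \<open>\<integral> (t - k) T(x, t) dt \<rightarrow> 0\<close>,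
  while \<open>\<integral> T(x, t) dt\<close> tends to minus the integral of the squared slope of the profile, which is not zero.
  Both integrals are independent of \<open>x\<close>, and \<open>u\<^sub>1 \<rightarrow> 0\<close> enters once more since it makes
  the flux \<open>\<integral> u\<^sub>1 u\<^sub>2 dt\<close> vanish. Hence \<open>k = k'\<close> is the centre of mass of \<open>T\<close>,
  and the two one-sided comparisons combine to symmetry. The gradient and Hessian bounds that this needs come
  from a maximum principle applied to difference quotients of \<open>u\<close>, so no regularity theory is used.\<close>

text \<open>The obstacle is contact at infinity: it makes \<open>u\<close> symmetric about
  \<open>k\<close> only in the limit along one sequence of vertical lines and says nothing about
  finite points. What is needed is a number that can be read off far out and is the same on every
  vertical line; the first moment of \<open>T\<close> is one. Its density decays like
  \<open>|t|\<close> to the power \<open>- (1 + 2 \<sigma>)\<close>, so \<sigma> > 0 is just what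
  makes it converge. Since \<open>f\<close> is nonincreasing near 0, a reflected comparison that
  fails at all fails at a point where \<open>u\<close> is at least \<open>\<epsilon> / 2\<close>;
  this confines contact points to a horizontal strip and keeps the profiles there nontrivial. Both
  the comparison function and its vertical derivative are followed along the contact sequence: on
  the plane itself the function vanishes identically, so only the derivative carries information
  there, and together they are the Cauchy data at height \<open>y\<close> for the asymptotic ODE.
  Gronwall's inequality propagates their smallness directly, so no limit profile has to be extracted
  by compactness.\<close>

section \<open>Functions with a Laplacian on the plane\<close>

text \<open>Weaker than C^2 on purpose: only pure second partials are asked for. This suffices for
  the second derivative test at a minimum, on which every comparison below rests, and it is stable
  under translations, reflections and difference quotients. Continuity of \<open>v\<close> supplies
  minima on compact sets.\<close>

definition has_lap :: "(real \<times> real \<Rightarrow> real) \<Rightarrow> (real \<times> real \<Rightarrow> real) \<Rightarrow> bool" where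
  "has_lap v l \<longleftrightarrow> continuous_on UNIV v \<and> (\<exists>v1 v2 v11 v22.
     (\<forall>x y. ((\<lambda>s. v (s, y)) has_real_derivative v1 (x, y)) (at x)) \<and>
     (\<forall>x y. ((\<lambda>t. v (x, t)) has_real_derivative v2 (x, y)) (at y)) \<and>
     (\<forall>x y. ((\<lambda>s. v1 (s, y)) has_real_derivative v11 (x, y)) (at x)) \<and>
     (\<forall>x y. ((\<lambda>t. v2 (x, t)) has_real_derivative v22 (x, y)) (at y)) \<and>
     (\<forall>p. l p = v11 p + v22 p))"

lemma has_lapI:
  assumes "continuous_on UNIV v"
    and "\<And>x y. ((\<lambda>s. v (s, y)) has_real_derivative v1 (x, y)) (at x)"
    and "\<And>x y. ((\<lambda>t. v (x, t)) has_real_derivative v2 (x, y)) (at y)"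
    and "\<And>x y. ((\<lambda>s. v1 (s, y)) has_real_derivative v11 (x, y)) (at x)"
    and "\<And>x y. ((\<lambda>t. v2 (x, t)) has_real_derivative v22 (x, y)) (at y)"
    and "\<And>p. l p = v11 p + v22 p"
  shows "has_lap v l"
  unfolding has_lap_def using assms by blast

lemma has_lapE:
  assumes "has_lap v l"
  obtains v1 v2 v11 v22 where "continuous_on UNIV v"
    and "\<And>x y. ((\<lambda>s. v (s, y)) has_real_derivative v1 (x, y)) (at x)"
    and "\<And>x y. ((\<lambda>t. v (x, t)) has_real_derivative v2 (x, y)) (at y)"
    and "\<And>x y. ((\<lambda>s. v1 (s, y)) has_real_derivative v11 (x, y)) (at x)"
    and "\<And>x y. ((\<lambda>t. v2 (x, t)) has_real_derivative v22 (x, y)) (at y)"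
    and "\<And>p. l p = v11 p + v22 p"
  using assms unfolding has_lap_def by blast

lemma has_lap_continuous: "has_lap v l \<Longrightarrow> continuous_on UNIV v"
  by (simp add: has_lap_def)

lemma has_lap_add:
  assumes "has_lap v l" "has_lap w k"
  shows "has_lap (\<lambda>p. v p + w p) (\<lambda>p. l p + k p)"
proof -
  obtain v1 v2 v11 v22 where v: "continuous_on UNIV v"
    "\<And>x y. ((\<lambda>s. v (s, y)) has_real_derivative v1 (x, y)) (at x)"
    "\<And>x y. ((\<lambda>t. v (x, t)) has_real_derivative v2 (x, y)) (at y)"
    "\<And>x y. ((\<lambda>s. v1 (s, y)) has_real_derivative v11 (x, y)) (at x)"
    "\<And>x y. ((\<lambda>t. v2 (x, t)) has_real_derivative v22 (x, y)) (at y)"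
    "\<And>p. l p = v11 p + v22 p"
    by (rule has_lapE[OF assms(1)]) blast
  obtain w1 w2 w11 w22 where w: "continuous_on UNIV w"
    "\<And>x y. ((\<lambda>s. w (s, y)) has_real_derivative w1 (x, y)) (at x)"
    "\<And>x y. ((\<lambda>t. w (x, t)) has_real_derivative w2 (x, y)) (at y)"
    "\<And>x y. ((\<lambda>s. w1 (s, y)) has_real_derivative w11 (x, y)) (at x)"
    "\<And>x y. ((\<lambda>t. w2 (x, t)) has_real_derivative w22 (x, y)) (at y)"
    "\<And>p. k p = w11 p + w22 p"
    by (rule has_lapE[OF assms(2)]) blast
  show ?thesis
    by (rule has_lapI[of _ "\<lambda>p. v1 p + w1 p" "\<lambda>p. v2 p + w2 p"
          "\<lambda>p. v11 p + w11 p" "\<lambda>p. v22 p + w22 p"])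
      (auto intro!: continuous_intros DERIV_add simp: v w)
qed

lemma has_lap_cmult:
  assumes "has_lap v l"
  shows "has_lap (\<lambda>p. c * v p) (\<lambda>p. c * l p)"
proof -
  obtain v1 v2 v11 v22 where v: "continuous_on UNIV v"
    "\<And>x y. ((\<lambda>s. v (s, y)) has_real_derivative v1 (x, y)) (at x)"
    "\<And>x y. ((\<lambda>t. v (x, t)) has_real_derivative v2 (x, y)) (at y)"
    "\<And>x y. ((\<lambda>s. v1 (s, y)) has_real_derivative v11 (x, y)) (at x)"
    "\<And>x y. ((\<lambda>t. v2 (x, t)) has_real_derivative v22 (x, y)) (at y)"
    "\<And>p. l p = v11 p + v22 p"
    by (rule has_lapE[OF assms(1)]) blast
  show ?thesis
    by (rule has_lapI[of _ "\<lambda>p. c * v1 p" "\<lambda>p. c * v2 p"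
          "\<lambda>p. c * v11 p" "\<lambda>p. c * v22 p"])
      (auto intro!: continuous_intros DERIV_cmult simp: v algebra_simps)
qed

lemma has_lap_minus:
  assumes "has_lap v l" shows "has_lap (\<lambda>p. - v p) (\<lambda>p. - l p)"
  using has_lap_cmult[OF assms, of "-1"] by simp

lemma has_lap_diff:
  assumes "has_lap v l" "has_lap w k"
  shows "has_lap (\<lambda>p. v p - w p) (\<lambda>p. l p - k p)"
  using has_lap_add[OF assms(1) has_lap_minus[OF assms(2)]] by simp

text \<open>The signs \<open>s\<close> and \<open>t\<close> enter the Laplacian squared.
  Translations serve the difference quotients; sign changes serve the doubling argument and the
  reflected solution.\<close>

lemma has_lap_affine:
  assumes "has_lap v l" "s^2 = 1" "t^2 = 1"
  shows "has_lap (\<lambda>p. v (a + s * fst p, b + t * snd p)) (\<lambda>p. l (a + s * fst p, b + t * snd p))"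
proof -
  obtain v1 v2 v11 v22 where v: "continuous_on UNIV v"
    "\<And>x y. ((\<lambda>s. v (s, y)) has_real_derivative v1 (x, y)) (at x)"
    "\<And>x y. ((\<lambda>t. v (x, t)) has_real_derivative v2 (x, y)) (at y)"
    "\<And>x y. ((\<lambda>s. v1 (s, y)) has_real_derivative v11 (x, y)) (at x)"
    "\<And>x y. ((\<lambda>t. v2 (x, t)) has_real_derivative v22 (x, y)) (at y)"
    "\<And>p. l p = v11 p + v22 p"
    by (rule has_lapE[OF assms(1)]) blast
  have ch: "((\<lambda>x. g (c + d * x)) has_real_derivative d * g') (at x)"
    if "(g has_real_derivative g') (at (c + d * x))" for g c d g' and x :: real
    by (rule DERIV_cong[OF DERIV_chain2[where f=g and g="\<lambda>x. c + d * x", OF that]])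
      (auto intro!: derivative_eq_intros)
  let ?m = "\<lambda>p. (a + s * fst p, b + t * snd p)"
  show ?thesis
  proof (rule has_lapI[of _ "\<lambda>p. s * v1 (?m p)" "\<lambda>p. t * v2 (?m p)"
          "\<lambda>p. s * (s * v11 (?m p))" "\<lambda>p. t * (t * v22 (?m p))"])
    show "continuous_on UNIV (\<lambda>p. v (?m p))"
      by (rule continuous_on_compose2[OF v(1)]) (auto intro!: continuous_intros)
    show "l (?m p) = s * (s * v11 (?m p)) + t * (t * v22 (?m p))" for p
      using assms(2,3) by (simp add: v(6) power2_eq_square flip: mult.assoc)
  qed (auto intro!: DERIV_cmult ch v(2-5))
qed

lemma has_lap_swap:
  assumes "has_lap v l"
  shows "has_lap (\<lambda>p. v (snd p, fst p)) (\<lambda>p. l (snd p, fst p))"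
proof -
  obtain v1 v2 v11 v22 where v: "continuous_on UNIV v"
    "\<And>x y. ((\<lambda>s. v (s, y)) has_real_derivative v1 (x, y)) (at x)"
    "\<And>x y. ((\<lambda>t. v (x, t)) has_real_derivative v2 (x, y)) (at y)"
    "\<And>x y. ((\<lambda>s. v1 (s, y)) has_real_derivative v11 (x, y)) (at x)"
    "\<And>x y. ((\<lambda>t. v2 (x, t)) has_real_derivative v22 (x, y)) (at y)"
    "\<And>p. l p = v11 p + v22 p"
    by (rule has_lapE[OF assms(1)]) blast
  show ?thesis
    by (rule has_lapI[of _ "\<lambda>p. v2 (snd p, fst p)" "\<lambda>p. v1 (snd p, fst p)"
          "\<lambda>p. v22 (snd p, fst p)" "\<lambda>p. v11 (snd p, fst p)"])
      (auto intro!: continuous_on_compose2[OF v(1)] continuous_intros simp: v)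
qed

lemma has_lap_separable:
  fixes g g1 g2 h h1 h2 :: "real \<Rightarrow> real"
  assumes "\<And>x. (g has_real_derivative g1 x) (at x)" "\<And>x. (g1 has_real_derivative g2 x) (at x)"
    and "\<And>x. (h has_real_derivative h1 x) (at x)" "\<And>x. (h1 has_real_derivative h2 x) (at x)"
  shows "has_lap (\<lambda>p. g (fst p) * h (snd p))
           (\<lambda>p. g2 (fst p) * h (snd p) + g (fst p) * h2 (snd p))"
proof (rule has_lapI[of _ "\<lambda>p. g1 (fst p) * h (snd p)" "\<lambda>p. g (fst p) * h1 (snd p)"
        "\<lambda>p. g2 (fst p) * h (snd p)" "\<lambda>p. g (fst p) * h2 (snd p)"])
  have "continuous_on UNIV g" "continuous_on UNIV h"
    using assms(1,3) by (meson DERIV_isCont continuous_at_imp_continuous_on)+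
  then show "continuous_on UNIV (\<lambda>p::real \<times> real. g (fst p) * h (snd p))"
    by (auto intro!: continuous_intros intro: continuous_on_compose2)
qed (auto intro!: DERIV_cmult DERIV_cmult_right assms)

text \<open>The polynomial barriers below are written with all five coefficients, zeros included, so
  that they match this pattern.\<close>

lemma has_lap_quadratic:
  "has_lap (\<lambda>p. c + d * fst p + e * snd p + a * (fst p)^2 + b * (snd p)^2) (\<lambda>p. 2 * a + 2 * b)"
  by (rule has_lapI[of _ "\<lambda>p. d + 2 * a * fst p" "\<lambda>p. e + 2 * b * snd p" "\<lambda>p. 2 * a" "\<lambda>p. 2 * b"])
    (auto intro!: continuous_intros derivative_eq_intros)

section \<open>Second derivative test and minimum principle\<close>

text \<open>If \<open>D\<close> were negative, \<open>g'\<close> would be negative just to the right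
  of its zero \<open>x\<close>, and the mean value theorem would give a smaller value of
  \<open>g\<close>. This uses the second derivative at \<open>x\<close> alone, in keeping with
  \<open>has_lap\<close>.\<close>

lemma second_derivative_nonneg_at_min:
  fixes g :: "real \<Rightarrow> real"
  assumes r: "r > 0" and mn: "\<And>s. \<bar>s - x\<bar> < r \<Longrightarrow> g x \<le> g s"
    and d: "\<And>s. (g has_real_derivative g' s) (at s)"
    and dd: "(g' has_real_derivative D) (at x)"
  shows "D \<ge> 0"
proof (rule ccontr)
  assume "\<not> D \<ge> 0"
  then have "D < 0" by simp
  have g0: "g' x = 0"
    using DERIV_local_min[OF d r] mn by (metis abs_minus_commute)
  from DERIV_neg_dec_right[OF dd \<open>D < 0\<close>] obtain k where k: "k > 0"
    "\<And>h. h > 0 \<Longrightarrow> h < k \<Longrightarrow> g' (x + h) < g' x" by blast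
  define h where "h = min r k / 2"
  have h: "0 < h" "h < r" "h < k" using r k by (auto simp: h_def)
  obtain z where z: "x < z" "z < x + h" "g (x + h) - g x = (x + h - x) * g' z"
    using MVT2[of x "x + h" g g'] d h(1) by auto
  have "g' z < 0" using k(2)[of "z - x"] z h g0 by auto
  then have "h * g' z < 0" using h(1) by (simp add: mult_pos_neg)
  then have "g (x + h) < g x" using z(3) by simp
  moreover have "g x \<le> g (x + h)" using mn[of "x + h"] h by auto
  ultimately show False by simp
qed

lemma has_lap_nonneg_at_min:
  assumes "has_lap v l" "r > 0" "\<And>p. dist p (a, b) < r \<Longrightarrow> v (a, b) \<le> v p"
  shows "l (a, b) \<ge> 0"
proof -
  obtain v1 v2 v11 v22 where v: "continuous_on UNIV v"
    "\<And>x y. ((\<lambda>s. v (s, y)) has_real_derivative v1 (x, y)) (at x)"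
    "\<And>x y. ((\<lambda>t. v (x, t)) has_real_derivative v2 (x, y)) (at y)"
    "\<And>x y. ((\<lambda>s. v1 (s, y)) has_real_derivative v11 (x, y)) (at x)"
    "\<And>x y. ((\<lambda>t. v2 (x, t)) has_real_derivative v22 (x, y)) (at y)"
    "\<And>p. l p = v11 p + v22 p"
    by (rule has_lapE[OF assms(1)]) blast
  have "v11 (a, b) \<ge> 0"
    by (rule second_derivative_nonneg_at_min[OF assms(2) _ v(2) v(4)])
      (auto intro!: assms(3) simp: dist_Pair_Pair dist_real_def)
  moreover have "v22 (a, b) \<ge> 0"
    by (rule second_derivative_nonneg_at_min[OF assms(2) _ v(3) v(5)])
      (auto intro!: assms(3) simp: dist_Pair_Pair dist_real_def)
  ultimately show ?thesis by (simp add: v(6))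
qed

text \<open>A negative minimum would lie in the interior, where the second derivative test makes
  \<open>l\<close> nonnegative. Strict negativity of \<open>l\<close> spares the usual perturbation,
  and asking for it only where \<open>v\<close> is negative lets zero order terms be absorbed; the
  barriers are chosen accordingly.\<close>

lemma min_principle:
  assumes lap: "has_lap v l" and S: "compact S"
    and bdry: "\<And>p. p \<in> frontier S \<Longrightarrow> v p \<ge> 0"
    and int: "\<And>p. p \<in> interior S \<Longrightarrow> v p < 0 \<Longrightarrow> l p < 0"
    and p: "p \<in> S"
  shows "v p \<ge> 0"
proof -
  have "continuous_on S v"
    using has_lap_continuous[OF lap] continuous_on_subset by blast
  then obtain q where q: "q \<in> S" "\<And>y. y \<in> S \<Longrightarrow> v q \<le> v y"
    using continuous_attains_inf[OF S] p by blast
  have "v q \<ge> 0"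
  proof (rule ccontr)
    assume neg: "\<not> v q \<ge> 0"
    then have "q \<in> interior S"
      using bdry[of q] q(1) closure_subset[of S] by (auto simp: frontier_def)
    moreover from this obtain r where r: "r > 0" "ball q r \<subseteq> S"
      using mem_interior by blast
    have "l (fst q, snd q) \<ge> 0"
      by (rule has_lap_nonneg_at_min[OF lap r(1)]) (use r(2) q(2) in \<open>auto simp: dist_commute mem_ball subset_iff\<close>)
    ultimately show False using int[of q] neg by auto
  qed
  then show ?thesis using q(2)[OF p] by simp
qed

text \<open>Interior gradient estimate by doubling (Gilbarg--Trudinger, Section 3.4): the odd part of \<open>v\<close> in
  the first variable is compared on the half box with
  \<open>M (y\<^sup>2 + x (2 - x)) + (N + \<eta>) x (1 - x) / 2\<close>.\<close>

lemma gradient_bound_oneside: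
  assumes lap: "has_lap v l"
    and M: "\<And>x y. \<bar>x - a\<bar> \<le> 1 \<Longrightarrow> \<bar>y - b\<bar> \<le> 1 \<Longrightarrow> \<bar>v (x, y)\<bar> \<le> M"
    and N: "\<And>x y. \<bar>x - a\<bar> \<le> 1 \<Longrightarrow> \<bar>y - b\<bar> \<le> 1 \<Longrightarrow> \<bar>l (x, y)\<bar> \<le> N"
    and t: "0 \<le> t" "t \<le> 1"
  shows "v (a + t, b) - v (a - t, b) \<le> t * (4 * M + N)"
proof -
  have M0: "M \<ge> 0" and N0: "N \<ge> 0" using M[of a b] N[of a b] by auto
  have key: "v (a + t, b) - v (a - t, b) \<le> t * (4 * M + N) + \<eta>" if \<eta>: "\<eta> > 0" for \<eta>
  proof -
    let ?S = "{0..1} \<times> {-1..1} :: (real \<times> real) set"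
    \<comment> \<open>The polynomial has Laplacian \<open>- (N + \<eta>)\<close>; the odd part
      contributes at most \<open>N\<close>, and \<eta> makes the inequality strict.\<close>
    let ?w = "\<lambda>p. (0 + (2 * M + (N + \<eta>) / 2) * fst p + 0 * snd p + (- M - (N + \<eta>) / 2) * (fst p)^2
        + M * (snd p)^2)
        + (1/2) * (v (a + (-1) * fst p, b + 1 * snd p) - v (a + 1 * fst p, b + 1 * snd p))"
    let ?l = "\<lambda>p. (2 * (- M - (N + \<eta>) / 2) + 2 * M)
        + (1/2) * (l (a + (-1) * fst p, b + 1 * snd p) - l (a + 1 * fst p, b + 1 * snd p))"
    have lw: "has_lap ?w ?l"
      by (intro has_lap_add has_lap_quadratic has_lap_cmult has_lap_diff has_lap_affine lap) auto
    have "?w (t, 0) \<ge> 0"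
    proof (rule min_principle[OF lw])
      show "compact ?S" by (intro compact_Times compact_Icc)
      show "(t, 0) \<in> ?S" using t by simp
    next
      fix p assume p: "p \<in> interior ?S"
      obtain x y where [simp]: "p = (x, y)" by (cases p)
      have "x \<in> {0<..<1}" "y \<in> {-1<..<1}"
        using p by (auto simp: interior_Times)
      then have "\<bar>l (a - x, b + y)\<bar> \<le> N" "\<bar>l (a + x, b + y)\<bar> \<le> N"
        by (auto intro!: N)
      then show "?l p < 0" using \<eta> by (simp add: field_simps)
    next
      fix p assume p: "p \<in> frontier ?S"
      obtain x y where [simp]: "p = (x, y)" by (cases p)
      have xy: "0 \<le> x" "x \<le> 1" "-1 \<le> y" "y \<le> 1"
        and or: "x = 0 \<or> x = 1 \<or> y = -1 \<or> y = 1"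
        using p by (auto simp: frontier_def interior_Times closure_Times)
      have bd: "\<bar>v (a - x, b + y)\<bar> \<le> M" "\<bar>v (a + x, b + y)\<bar> \<le> M"
        using xy by (auto intro!: M)
      have xx: "x^2 \<le> x" using xy by (simp add: power2_eq_square mult_left_le)
      have n1: "(N + \<eta>) / 2 * (x - x^2) \<ge> 0" using xx N0 \<eta> by simp
      have eq: "?w p = M * (2 * x - x^2 + y^2) + (N + \<eta>) / 2 * (x - x^2)
          + (1/2) * (v (a - x, b + y) - v (a + x, b + y))"
        by (simp add: field_simps)
      show "?w p \<ge> 0"
      \<comment> \<open>On \<open>x = 0\<close> the odd part vanishes; on the other three sides the
        \<open>M\<close> term is at least \<open>M\<close> and absorbs it.\<close>
      proof (cases "x = 0")
        case True
        then show ?thesis using M0 by simp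
      next
        case False
        then have "x = 1 \<or> y^2 = 1" using or by auto
        then have "2 * x - x^2 + y^2 \<ge> 1" using xx xy by (auto)
        then have "M * (2 * x - x^2 + y^2) \<ge> M" using M0 by (simp add: mult_le_cancel_left1)
        moreover have "(1/2) * (v (a - x, b + y) - v (a + x, b + y)) \<ge> - M"
          using bd by (auto simp: abs_le_iff)
        moreover have "0 \<le> P + Q + R" if "M \<le> P" "0 \<le> Q" "- M \<le> R" for P Q R :: real
          using that by linarith
        ultimately show ?thesis unfolding eq using n1 by blast
      qed
    qed
    then have "v (a + t, b) - v (a - t, b) \<le> 2 * ((2 * M + (N + \<eta>) / 2) * t - (M + (N + \<eta>) / 2) * t^2)"
      by (simp add: field_simps)
    also have "\<dots> \<le> 2 * ((2 * M + (N + \<eta>) / 2) * t)"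
      using M0 N0 \<eta> by simp
    also have "\<dots> = t * (4 * M + N) + \<eta> * t" by (simp add: algebra_simps)
    also have "\<dots> \<le> t * (4 * M + N) + \<eta>" using t \<eta> by (simp add: mult_le_cancel_left1)
    finally show ?thesis .
  qed
  show ?thesis by (rule field_le_epsilon) (rule key)
qed

lemma gradient_bound:
  assumes lap: "has_lap v l"
    and M: "\<And>x y. \<bar>x - a\<bar> \<le> 1 \<Longrightarrow> \<bar>y - b\<bar> \<le> 1 \<Longrightarrow> \<bar>v (x, y)\<bar> \<le> M"
    and N: "\<And>x y. \<bar>x - a\<bar> \<le> 1 \<Longrightarrow> \<bar>y - b\<bar> \<le> 1 \<Longrightarrow> \<bar>l (x, y)\<bar> \<le> N"
    and t: "0 \<le> t" "t \<le> 1"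
  shows "\<bar>v (a + t, b) - v (a - t, b)\<bar> \<le> t * (4 * M + N)"
proof -
  have "v (a + t, b) - v (a - t, b) \<le> t * (4 * M + N)"
    by (rule gradient_bound_oneside[OF assms])
  moreover have "- v (a + t, b) - (- v (a - t, b)) \<le> t * (4 * M + N)"
    by (rule gradient_bound_oneside[OF has_lap_minus[OF lap] _ _ t]) (auto intro: M N)
  ultimately show ?thesis by linarith
qed

text \<open>The symmetric difference divided by \<open>h\<close> tends to \<open>2 * D\<close>,
  hence the factor 2.\<close>

lemma derivative_bound_of_symmetric_difference:
  fixes g :: "real \<Rightarrow> real"
  assumes "(g has_real_derivative D) (at a)"
    and "\<And>t. 0 < t \<Longrightarrow> t \<le> 1 \<Longrightarrow> \<bar>g (a + t) - g (a - t)\<bar> \<le> t * B"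
  shows "\<bar>D\<bar> \<le> B / 2"
proof -
  have 1: "((\<lambda>h. (g (a + h) - g a) / h) \<longlongrightarrow> D) (at_right 0)"
    using assms(1) unfolding DERIV_def by (rule tendsto_mono[OF at_le, rotated]) simp
  have "((\<lambda>h. g (a + (-1) * h)) has_real_derivative (-1) * D) (at 0)"
    by (rule DERIV_cong[OF DERIV_chain2[where g="\<lambda>h. a + (-1) * h"]])
      (use assms(1) in \<open>auto intro!: derivative_eq_intros\<close>)
  then have 2: "((\<lambda>h. (g (a - h) - g a) / h) \<longlongrightarrow> - D) (at_right 0)"
    unfolding DERIV_def by (intro tendsto_mono[OF at_le[of "{0<..}" UNIV 0]]) simp_all
  have "((\<lambda>h. \<bar>(g (a + h) - g a) / h - (g (a - h) - g a) / h\<bar>) \<longlongrightarrow> \<bar>D - - D\<bar>) (at_right 0)"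
    by (intro tendsto_intros 1 2)
  moreover have "eventually (\<lambda>h. \<bar>(g (a + h) - g a) / h - (g (a - h) - g a) / h\<bar> \<le> B) (at_right 0)"
    unfolding eventually_at_right_field
  proof (intro exI[of _ 1] conjI allI impI)
    fix h :: real assume h: "0 < h" "h < 1"
    have "\<bar>(g (a + h) - g a) / h - (g (a - h) - g a) / h\<bar> = \<bar>g (a + h) - g (a - h)\<bar> / h"
      using h by (simp add: diff_divide_distrib[symmetric] abs_divide)
    also have "\<dots> \<le> B" using assms(2)[of h] h by (simp add: divide_le_eq mult.commute)
    finally show "\<bar>(g (a + h) - g a) / h - (g (a - h) - g a) / h\<bar> \<le> B" .
  qed auto
  ultimately have "\<bar>D - - D\<bar> \<le> B" by (rule tendsto_upperbound) auto
  then show ?thesis by simp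
qed

lemma gradient_bound_snd:
  assumes lap: "has_lap v l"
    and M: "\<And>x y. \<bar>x - a\<bar> \<le> 1 \<Longrightarrow> \<bar>y - b\<bar> \<le> 1 \<Longrightarrow> \<bar>v (x, y)\<bar> \<le> M"
    and N: "\<And>x y. \<bar>x - a\<bar> \<le> 1 \<Longrightarrow> \<bar>y - b\<bar> \<le> 1 \<Longrightarrow> \<bar>l (x, y)\<bar> \<le> N"
    and t: "0 \<le> t" "t \<le> 1"
  shows "\<bar>v (a, b + t) - v (a, b - t)\<bar> \<le> t * (4 * M + N)"
  using gradient_bound[OF has_lap_swap[OF lap], of b a M N t] M N t by simp

text \<open>\<open>gradient_bound\<close> is applied to the difference quotients \<open>w h\<close>
  of \<open>v\<close> in the first variable, whose Laplacians are bounded by \<open>L * m\<close>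
  because \<open>f\<close> is Lipschitz along \<open>v\<close>; then \<open>h\<close> tends to 0.
  The bound on \<open>v1\<close> reaches to distance 2 because a quotient based at distance 1 looks
  up to 1 further.\<close>

lemma second_derivative_bound:
  assumes lap: "has_lap v (\<lambda>p. - f (v p))"
    and lip: "\<And>p q. \<bar>f (v p) - f (v q)\<bar> \<le> L * \<bar>v p - v q\<bar>"
    and v1: "\<And>x y. ((\<lambda>s. v (s, y)) has_real_derivative v1 (x, y)) (at x)"
    and m: "\<And>x y. \<bar>x - a\<bar> \<le> 2 \<Longrightarrow> \<bar>y - b\<bar> \<le> 1 \<Longrightarrow> \<bar>v1 (x, y)\<bar> \<le> m"
    and L: "L \<ge> 0"
    and t: "0 \<le> t" "t \<le> 1"
  shows "\<bar>v1 (a + t, b) - v1 (a - t, b)\<bar> \<le> t * ((4 + L) * m)" (is ?thesis1)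
    and "\<bar>v1 (a, b + t) - v1 (a, b - t)\<bar> \<le> t * ((4 + L) * m)" (is ?thesis2)
proof -
  define w where "w h p = (1 / h) * (v (h + 1 * fst p, 0 + 1 * snd p) - v p)" for h p
  define k where "k h p = (1 / h) * (- f (v (h + 1 * fst p, 0 + 1 * snd p)) - - f (v p))" for h p
  have lw: "has_lap (w h) (k h)" for h
    unfolding w_def k_def by (intro has_lap_cmult has_lap_diff has_lap_affine lap) auto
  have wb: "\<bar>w h (x, y)\<bar> \<le> m"
    if h: "0 < h" "h \<le> 1" and xy: "\<bar>x - a\<bar> \<le> 1" "\<bar>y - b\<bar> \<le> 1" for h x y
  proof -
    obtain z where z: "x < z" "z < x + h" "v (x + h, y) - v (x, y) = (x + h - x) * v1 (z, y)"
      using MVT2[of x "x + h" "\<lambda>s. v (s, y)" "\<lambda>s. v1 (s, y)"] v1 h by auto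
    have "w h (x, y) = v1 (z, y)" using z(3) h by (simp add: w_def add.commute)
    moreover have "\<bar>v1 (z, y)\<bar> \<le> m" by (rule m) (use z h xy in auto)
    ultimately show ?thesis by simp
  qed
  have kb: "\<bar>k h (x, y)\<bar> \<le> L * m"
    if h: "0 < h" "h \<le> 1" and xy: "\<bar>x - a\<bar> \<le> 1" "\<bar>y - b\<bar> \<le> 1" for h x y
  proof -
    have "\<bar>k h (x, y)\<bar> = (1 / h) * \<bar>f (v (h + x, y)) - f (v (x, y))\<bar>"
      using h by (simp add: k_def abs_mult abs_minus_commute)
    also have "\<dots> \<le> (1 / h) * (L * \<bar>v (h + x, y) - v (x, y)\<bar>)"
      using h lip by (intro mult_left_mono) auto
    also have "\<dots> = L * \<bar>w h (x, y)\<bar>" using h by (simp add: w_def abs_mult)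
    also have "\<dots> \<le> L * m" using wb[OF that] L by (intro mult_left_mono)
    finally show ?thesis .
  qed
  have lim: "((\<lambda>h. w h p) \<longlongrightarrow> v1 p) (at_right 0)" for p
  proof -
    have "((\<lambda>h. (v (fst p + h, snd p) - v (fst p, snd p)) / h) \<longlongrightarrow> v1 (fst p, snd p)) (at_right 0)"
      using v1[of "snd p" "fst p"] unfolding DERIV_def
      by (rule tendsto_mono[OF at_le, rotated]) simp
    then show ?thesis by (simp add: w_def add.commute)
  qed
  have ev: "eventually (\<lambda>h::real. 0 < h \<and> h \<le> 1) (at_right 0)"
    unfolding eventually_at_right_field by (intro exI[of _ 1]) auto
  have eq: "t * (4 * m + L * m) = t * ((4 + L) * m)" by (simp add: algebra_simps)
  show ?thesis1
  proof (rule tendsto_upperbound)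
    show "((\<lambda>h. \<bar>w h (a + t, b) - w h (a - t, b)\<bar>) \<longlongrightarrow> \<bar>v1 (a + t, b) - v1 (a - t, b)\<bar>) (at_right 0)"
      by (intro tendsto_intros lim)
    show "\<forall>\<^sub>F h in at_right 0. \<bar>w h (a + t, b) - w h (a - t, b)\<bar> \<le> t * ((4 + L) * m)"
      using ev by eventually_elim (use gradient_bound[OF lw wb kb t] eq in simp)
  qed simp
  show ?thesis2
  proof (rule tendsto_upperbound)
    show "((\<lambda>h. \<bar>w h (a, b + t) - w h (a, b - t)\<bar>) \<longlongrightarrow> \<bar>v1 (a, b + t) - v1 (a, b - t)\<bar>) (at_right 0)"
      by (intro tendsto_intros lim)
    show "\<forall>\<^sub>F h in at_right 0. \<bar>w h (a, b + t) - w h (a, b - t)\<bar> \<le> t * ((4 + L) * m)"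
      using ev by eventually_elim (use gradient_bound_snd[OF lw wb kb t] eq in simp)
  qed simp
qed

section \<open>Hopf's lemma and maximum principles on half planes\<close>

text \<open>A radial Gaussian is a product of two one-variable Gaussians, so
  \<open>has_lap_separable\<close> applies.\<close>

lemma has_lap_gaussian:
  "has_lap (\<lambda>p. exp (- \<alpha> * (dist p z)^2))
     (\<lambda>p. (4 * \<alpha>^2 * (dist p z)^2 - 4 * \<alpha>) * exp (- \<alpha> * (dist p z)^2))" for z :: "real \<times> real"
proof -
  let ?g = "\<lambda>c x. exp (- \<alpha> * (x - c)^2) :: real"
  let ?g1 = "\<lambda>c x. - 2 * \<alpha> * (x - c) * ?g c x"
  let ?g2 = "\<lambda>c x. (4 * \<alpha>^2 * (x - c)^2 - 2 * \<alpha>) * ?g c x"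
  have 1: "(?g c has_real_derivative ?g1 c x) (at x)" for c x
    by (auto intro!: derivative_eq_intros)
  have 2: "(?g1 c has_real_derivative ?g2 c x) (at x)" for c x
    by (auto intro!: derivative_eq_intros simp: algebra_simps power2_eq_square)
  have d: "(dist p z)^2 = (fst p - fst z)^2 + (snd p - snd z)^2" for p
    by (simp add: dist_prod_def dist_real_def)
  have e: "exp (- \<alpha> * (dist p z)^2) = ?g (fst z) (fst p) * ?g (snd z) (snd p)" for p
    by (simp add: d exp_add[symmetric] algebra_simps)
  have l: "(4 * \<alpha>^2 * (dist p z)^2 - 4 * \<alpha>) * exp (- \<alpha> * (dist p z)^2) =
      ?g2 (fst z) (fst p) * ?g (snd z) (snd p) + ?g (fst z) (fst p) * ?g2 (snd z) (snd p)" for p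
    unfolding e by (simp add: d algebra_simps)
  show ?thesis unfolding l by (simp only: e) (rule has_lap_separable[OF 1 2 1 2])
qed

text \<open>Comparison on an annulus with the Hopf barrier
  \<open>m * (exp (- \<alpha> * r^2) - exp (- \<alpha> * R^2))\<close>. The resulting bound is
  positive inside the ball, which yields the strong maximum principle, and vanishes only linearly at
  its boundary, which yields Hopf's lemma.\<close>

lemma hopf_lower_bound:
  fixes z :: "real \<times> real"
  assumes lap: "has_lap v l" and R: "R > 0" and L: "L \<ge> 0"
    and nn: "\<And>p. p \<in> cball z R \<Longrightarrow> v p \<ge> 0"
    and l: "\<And>p. p \<in> cball z R \<Longrightarrow> l p \<le> L * v p"
    and z: "v z > 0"
  obtains c where "c > 0" "\<And>p. p \<in> cball z R \<Longrightarrow> c * (R^2 - (dist p z)^2) \<le> v p"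
proof -
  obtain r1 where r1: "r1 > 0" "\<And>p. dist p z < r1 \<Longrightarrow> dist (v p) (v z) < v z / 2"
    using has_lap_continuous[OF lap] z unfolding continuous_on_iff by (meson UNIV_I half_gt_zero)
  define m where "m = v z / 2"
  define r0 where "r0 = min r1 R / 2"
  have r0: "0 < r0" "r0 < R" "r0 < r1" using r1 R by (auto simp: r0_def)
  have m: "m > 0" using z by (simp add: m_def)
  have vm: "v p \<ge> m" if "dist p z \<le> r0" for p
    using r1(2)[of p] that r0 by (auto simp: m_def dist_real_def abs_if split: if_splits)
  \<comment> \<open>Makes \<open>4 * \<alpha> * (\<alpha> * r^2 - 1)\<close> at least
    \<open>L + 1\<close> on the annulus: the summand \<open>2 / r0^2\<close> gives
    \<open>\<alpha> * r0^2 \<ge> 2\<close>, the rest gives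
    \<open>\<alpha> \<ge> L + 1\<close>.\<close>
  define \<alpha> where "\<alpha> = 2 / r0^2 + L + 1"
  have al: "\<alpha> \<ge> L + 1" and a0: "\<alpha> > 0" using L by (auto simp: \<alpha>_def add_nonneg_pos)
  have ar: "\<alpha> * r0^2 - 1 \<ge> 1"
  proof -
    have "\<alpha> * r0^2 = 2 + (L + 1) * r0^2" using r0 by (simp add: \<alpha>_def field_simps)
    moreover have "(L + 1) * r0^2 \<ge> 0" using L by simp
    ultimately show ?thesis by linarith
  qed
  define e where "e p = exp (- \<alpha> * (dist p z)^2)" for p
  define w where "w p = (v p + (-m) * e p) + (m * exp (- \<alpha> * R^2) + 0 * fst p + 0 * snd p
      + 0 * (fst p)^2 + 0 * (snd p)^2)" for p
  define k where "k p = (l p + (-m) * ((4 * \<alpha>^2 * (dist p z)^2 - 4 * \<alpha>) * e p)) + (2 * 0 + 2 * 0)" for p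
  have lw: "has_lap w k"
    unfolding w_def k_def e_def
    by (intro has_lap_add has_lap_cmult has_lap_gaussian has_lap_quadratic lap)
  have w_eq: "w p = v p - m * (e p - exp (- \<alpha> * R^2))" for p
    by (simp add: w_def algebra_simps)
  have e1: "e p \<le> 1" for p using a0 by (simp add: e_def)
  have e0: "e p > 0" for p by (simp add: e_def)
  let ?S = "cball z R - ball z r0"
  have w_nn: "w p \<ge> 0" if p: "p \<in> cball z R" for p
  proof (cases "dist p z \<le> r0")
    case True
    have "m * (e p - exp (- \<alpha> * R^2)) \<le> m * 1"
      using m e1[of p] by (intro mult_left_mono) (auto intro: add_increasing2 simp: diff_le_eq)
    then show ?thesis using vm[OF True] by (simp add: w_eq)
  next
    case False
    show ?thesis
    proof (rule min_principle[OF lw, of ?S])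
      show "compact ?S" by (simp add: compact_diff)
      show "p \<in> ?S" using False p by (auto simp: dist_commute)
    next
      fix q assume q: "q \<in> frontier ?S"
      have cl: "closed ?S" by (simp add: closed_Diff)
      then have qS: "q \<in> ?S" using q frontier_subset_closed by blast
      have "dist q z = r0 \<or> dist q z = R"
      proof (rule ccontr)
        assume "\<not> ?thesis"
        then have "q \<in> ball z R - cball z r0" using qS by (auto simp: dist_commute)
        moreover have "ball z R - cball z r0 \<subseteq> interior ?S"
          by (rule interior_maximal) (auto simp: open_Diff)
        ultimately show False using q by (auto simp: frontier_def)
      qed
      then show "w q \<ge> 0"
      proof
        assume d: "dist q z = r0"
        have "m * (e q - exp (- \<alpha> * R^2)) \<le> m * 1"
          using m e1[of q] by (intro mult_left_mono) (auto intro: add_increasing2 simp: diff_le_eq)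
        then show ?thesis using vm[of q] d by (simp add: w_eq)
      next
        assume d: "dist q z = R"
        then show ?thesis using nn[of q] qS by (simp add: w_eq e_def)
      qed
    next
      fix q assume q: "q \<in> interior ?S" and neg: "w q < 0"
      have qS: "q \<in> ?S" using q interior_subset by blast
      then have d: "dist q z \<ge> r0" by (auto simp: dist_commute)
      \<comment> \<open>Where \<open>w\<close> is negative, \<open>v\<close> lies below
        \<open>m * e\<close>, so its zero order term is beaten by the Laplacian of the
        barrier.\<close>
      have "v q < m * e q"
      proof -
        have "v q < m * (e q - exp (- \<alpha> * R^2))" using neg by (simp add: w_eq)
        also have "\<dots> \<le> m * e q" using m by (intro mult_left_mono) auto
        finally show ?thesis .
      qed
      then have "L * v q \<le> L * (m * e q)" using L by (intro mult_left_mono) auto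
      then have 1: "l q \<le> L * (m * e q)" using l[of q] qS by auto
      have "1 \<le> \<alpha> * r0^2 - 1" by (rule ar)
      also have "\<dots> \<le> \<alpha> * (dist q z)^2 - 1" using a0 d r0 by (simp add: power_mono)
      finally have "(L + 1) * 1 \<le> (4 * \<alpha>) * (\<alpha> * (dist q z)^2 - 1)"
        using al a0 L by (intro mult_mono) auto
      then have "(m * e q) * (L + 1) \<le> (m * e q) * (4 * \<alpha>^2 * (dist q z)^2 - 4 * \<alpha>)"
        using m e0[of q] by (intro mult_left_mono) (auto simp: algebra_simps power2_eq_square)
      then have "k q \<le> L * (m * e q) - (m * e q) * (L + 1)"
        using 1 by (simp add: k_def algebra_simps)
      also have "\<dots> = - (m * e q)" by (simp add: algebra_simps)
      also have "\<dots> < 0" using m e0[of q] by simp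
      finally show "k q < 0" .
    qed
  qed
  define c where "c = m * \<alpha> * exp (- \<alpha> * R^2)"
  show ?thesis
  proof (rule that[of c])
    show "c > 0" using m a0 by (simp add: c_def)
    fix p assume p: "p \<in> cball z R"
    have "e p = exp (- \<alpha> * R^2) * exp (\<alpha> * (R^2 - (dist p z)^2))"
      by (simp add: e_def exp_add[symmetric] algebra_simps)
    \<comment> \<open>\<open>exp s \<ge> 1 + s\<close> turns the barrier into the stated
      quadratic.\<close>
    also have "\<dots> \<ge> exp (- \<alpha> * R^2) * (1 + \<alpha> * (R^2 - (dist p z)^2))"
      by (intro mult_left_mono exp_ge_add_one_self) auto
    finally have "m * (exp (- \<alpha> * R^2) * (1 + \<alpha> * (R^2 - (dist p z)^2)) - exp (- \<alpha> * R^2))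
        \<le> m * (e p - exp (- \<alpha> * R^2))"
      using m by (intro mult_left_mono) auto
    also have "\<dots> \<le> v p" using w_nn[OF p] by (simp add: w_eq)
    finally show "c * (R^2 - (dist p z)^2) \<le> v p"
      by (simp add: c_def algebra_simps)
  qed
qed

text \<open>Connectedness of the half plane: the positive set is open, and so is the zero set,
  because a zero inside a ball around a point of positivity contradicts
  \<open>hopf_lower_bound\<close>.\<close>

lemma strong_max_principle_half_plane:
  assumes lap: "has_lap v l" and L: "L \<ge> 0"
    and nn: "\<And>p. snd p \<ge> \<kappa> \<Longrightarrow> v p \<ge> 0"
    and l: "\<And>p. snd p \<ge> \<kappa> \<Longrightarrow> l p \<le> L * v p"
    and z: "snd z > \<kappa>" "v z > 0"
    and p: "snd p > \<kappa>"
  shows "v p > 0"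
proof (rule ccontr)
  assume np: "\<not> v p > 0"
  let ?H = "{q::real \<times> real. snd q > \<kappa>}"
  define A where "A = {q \<in> ?H. v q > 0}"
  define B where "B = {q \<in> ?H. v q = 0}"
  have H: "open ?H" by (intro open_Collect_less continuous_intros)
  have "A = ?H \<inter> {q. 0 < v q}" by (auto simp: A_def)
  moreover have "open {q. 0 < v q}"
    by (intro open_Collect_less continuous_intros has_lap_continuous[OF lap])
  ultimately have "open A" using open_Int[OF H] by simp
  have "open B"
    unfolding open_contains_ball
  proof
    fix q assume q: "q \<in> B"
    \<comment> \<open>Half the distance to the boundary line, so that the ball of this radius around
      any \<open>y\<close> in \<open>ball q R\<close> stays in the half plane.\<close>
    define R where "R = (snd q - \<kappa>) / 2"
    have R: "R > 0" using q by (simp add: R_def B_def)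
    have "y \<in> B" if y: "y \<in> ball q R" for y
    proof (rule ccontr)
      assume "y \<notin> B"
      have "\<bar>snd y - snd q\<bar> < R"
        using y dist_snd_le[of q y] by (simp add: dist_real_def abs_minus_commute)
      then have sy: "snd y - R > \<kappa>" unfolding R_def abs_less_iff by argo
      then have vy: "v y > 0" using \<open>y \<notin> B\<close> nn[of y] R by (auto simp: B_def)
      have in_H: "snd x \<ge> \<kappa>" if "x \<in> cball y R" for x
        using that dist_snd_le[of y x] sy by (auto simp: dist_real_def)
      obtain c where c: "c > 0" "\<And>p. p \<in> cball y R \<Longrightarrow> c * (R^2 - (dist p y)^2) \<le> v p"
        using hopf_lower_bound[OF lap R L _ _ vy] nn l in_H by blast
      have "dist q y < R" using y by simp
      then have "R^2 - (dist q y)^2 > 0" using R by (simp add: power_strict_mono)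
      then have "c * (R^2 - (dist q y)^2) > 0" using c(1) by simp
      then have "v q > 0" using c(2)[of q] y by (auto simp: dist_commute)
      then show False using q by (simp add: B_def)
    qed
    then show "\<exists>e>0. ball q e \<subseteq> B" using R by blast
  qed
  have "convex ?H"
  proof -
    have "?H = {q. inner (0, 1) q > \<kappa>}" by (auto simp: inner_prod_def)
    then show ?thesis using convex_halfspace_gt by metis
  qed
  then have "connected ?H" by (rule convex_connected)
  moreover have "?H \<subseteq> A \<union> B"
    using nn[OF less_imp_le] by (auto simp: A_def B_def order_le_less)
  moreover have "A \<inter> B \<inter> ?H = {}" by (auto simp: A_def B_def)
  ultimately have "A \<inter> ?H = {} \<or> B \<inter> ?H = {}"
    using connectedD[of ?H A B] \<open>open A\<close> \<open>open B\<close> by blast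
  moreover have "z \<in> A \<inter> ?H" using z by (simp add: A_def)
  moreover have "p \<in> B \<inter> ?H" using p np nn[of p] by (simp add: B_def)
  ultimately show False by blast
qed

text \<open>The disc of radius 1 about \<open>(a, \<kappa> + 1)\<close> touches the boundary line at
  \<open>(a, \<kappa>)\<close>; along the normal the bound of \<open>hopf_lower_bound\<close> is at
  least \<open>c * h\<close>.\<close>

lemma hopf_half_plane:
  assumes lap: "has_lap v l" and L: "L \<ge> 0"
    and nn: "\<And>p. snd p \<ge> \<kappa> \<Longrightarrow> v p \<ge> 0"
    and l: "\<And>p. snd p \<ge> \<kappa> \<Longrightarrow> l p \<le> L * v p"
    and z: "snd z > \<kappa>" "v z > 0"
    and D: "((\<lambda>t. v (a, t)) has_real_derivative D) (at \<kappa>)" "v (a, \<kappa>) = 0"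
  shows "D > 0"
proof -
  have v1: "v (a, \<kappa> + 1) > 0"
    by (rule strong_max_principle_half_plane[OF lap L nn l z]) auto
  have in_H: "snd x \<ge> \<kappa>" if "x \<in> cball (a, \<kappa> + 1) 1" for x
    using that dist_snd_le[of "(a, \<kappa> + 1)" x] by (auto simp: dist_real_def)
  obtain c where c: "c > 0"
    "\<And>p. p \<in> cball (a, \<kappa> + 1) 1 \<Longrightarrow> c * (1^2 - (dist p (a, \<kappa> + 1))^2) \<le> v p"
    using hopf_lower_bound[OF lap zero_less_one L _ _ v1] nn l in_H by blast
  have 1: "((\<lambda>h. (v (a, \<kappa> + h) - v (a, \<kappa>)) / h) \<longlongrightarrow> D) (at_right 0)"
    using D(1) unfolding DERIV_def by (rule tendsto_mono[OF at_le, rotated]) simp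
  have "eventually (\<lambda>h. c \<le> (v (a, \<kappa> + h) - v (a, \<kappa>)) / h) (at_right 0)"
    unfolding eventually_at_right_field
  proof (intro exI[of _ 1] conjI allI impI)
    fix h :: real assume h: "0 < h" "h < 1"
    have d: "dist (a, \<kappa> + h) (a, \<kappa> + 1) = 1 - h"
      using h by (simp add: dist_Pair_Pair dist_real_def)
    have "h * h \<le> h * 1" using h by (intro mult_left_mono) auto
    then have "c * h \<le> c * (1^2 - (1 - h)^2)"
      using c(1) by (intro mult_left_mono) (auto simp: power2_eq_square algebra_simps)
    also have "\<dots> \<le> v (a, \<kappa> + h)"
      using c(2)[of "(a, \<kappa> + h)"] d h by (simp add: dist_commute)
    finally show "c \<le> (v (a, \<kappa> + h) - v (a, \<kappa>)) / h"
      using h D(2) by (simp add: le_divide_eq)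
  qed auto
  then have "c \<le> D" using tendsto_lowerbound[OF 1] by simp
  then show ?thesis using c(1) by simp
qed

text \<open>A Phragmen-Lindelof argument: uniform decay cuts the half plane at a height
  \<open>R\<close>, and a small multiple of the barrier \<open>H\<close>, which grows with
  \<open>x\<close>, closes the strip laterally. First \<delta> and then \<eta> tends to 0. The sign
  of \<open>l\<close> is asked for only where \<open>v\<close> is positive, which is what
  monotonicity of \<open>f\<close> can provide.\<close>

lemma weak_max_principle_half_plane:
  assumes lap: "has_lap v l"
    and bd: "\<And>p. snd p \<ge> \<kappa> \<Longrightarrow> v p \<le> B"
    and bdry: "\<And>x. v (x, \<kappa>) \<le> 0"
    and decay: "\<And>\<eta>. \<eta> > 0 \<Longrightarrow> \<exists>R. \<forall>x y. y \<ge> R \<longrightarrow> v (x, y) \<le> \<eta>"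
    and l: "\<And>p. snd p > \<kappa> \<Longrightarrow> v p > 0 \<Longrightarrow> l p \<ge> 0"
    and p: "snd p \<ge> \<kappa>"
  shows "v p \<le> 0"
proof (rule field_le_epsilon)
  fix \<eta> :: real assume \<eta>: "\<eta> > 0"
  obtain R1 where R1: "\<And>x y. y \<ge> R1 \<Longrightarrow> v (x, y) \<le> \<eta>" using decay[OF \<eta>] by blast
  obtain a b where ab: "p = (a, b)" by (cases p)
  define R where "R = max R1 b"
  have R: "R \<ge> R1" "R \<ge> b" "R \<ge> \<kappa>" using p ab by (auto simp: R_def)
  \<comment> \<open>superharmonic, nonnegative on the strip, and unbounded in \<open>x\<close>\<close>
  define H where "H x y = x^2 + 2 * (R - \<kappa>)^2 - 2 * (y - \<kappa>)^2" for x y :: real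
  have Hge: "H x y \<ge> x^2" if "\<kappa> \<le> y" "y \<le> R" for x y
    using that by (simp add: H_def power_mono)
  have key: "v p \<le> \<eta> + \<delta> * H a b" if \<delta>: "\<delta> > 0" for \<delta>
  proof -
    \<comment> \<open>Covers \<open>p\<close> and makes \<open>\<delta> * X^2\<close> at least
      \<open>B\<close>; \<open>X \<ge> 1\<close> gives \<open>X \<le> X^2\<close>.\<close>
    define X where "X = max \<bar>a\<bar> (max 1 (\<bar>B\<bar> / \<delta>))"
    have X: "X \<ge> \<bar>a\<bar>" "X \<ge> 1" "X \<ge> \<bar>B\<bar> / \<delta>" by (auto simp: X_def)
    have "X * 1 \<le> X * X" using X by (intro mult_left_mono) auto
    then have "\<bar>B\<bar> / \<delta> \<le> X^2" using X unfolding power2_eq_square by linarith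
    then have XB: "\<delta> * X^2 \<ge> B" using \<delta> by (simp add: field_simps abs_le_iff)
    \<comment> \<open>This is \<open>\<eta> + \<delta> * H - v\<close>, expanded to match
      \<open>has_lap_quadratic\<close>; the polynomial part has Laplacian
      \<open>- 2 * \<delta>\<close>.\<close>
    let ?w = "\<lambda>q. ((\<eta> + \<delta> * (2 * (R - \<kappa>)^2 - 2 * \<kappa>^2)) + 0 * fst q + (4 * \<kappa> * \<delta>) * snd q
        + \<delta> * (fst q)^2 + (- 2 * \<delta>) * (snd q)^2) - v q"
    let ?k = "\<lambda>q. (2 * \<delta> + 2 * (- 2 * \<delta>)) - l q"
    have lw: "has_lap ?w ?k" by (intro has_lap_diff has_lap_quadratic lap)
    have w: "?w q = \<eta> + \<delta> * H (fst q) (snd q) - v q" for q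
      by (simp add: H_def algebra_simps power2_eq_square)
    let ?S = "{-X..X} \<times> {\<kappa>..R}"
    have "?w p \<ge> 0"
    proof (rule min_principle[OF lw, of ?S])
      show "compact ?S" by (intro compact_Times compact_Icc)
      show "p \<in> ?S" using X R p ab by auto
    next
      fix q assume "q \<in> frontier ?S"
      then have xy: "- X \<le> fst q" "fst q \<le> X" "\<kappa> \<le> snd q" "snd q \<le> R"
        and or: "fst q = - X \<or> fst q = X \<or> snd q = \<kappa> \<or> snd q = R"
        by (auto simp: frontier_def interior_Times closure_Times)
      have H0: "\<delta> * (fst q)^2 \<le> \<delta> * H (fst q) (snd q)" using Hge xy \<delta> by simp
      have H1: "0 \<le> \<delta> * (fst q)^2" using \<delta> by simp
      from or have "v q \<le> \<eta> + \<delta> * (fst q)^2"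
      proof (elim disjE)
        assume "fst q = - X" then show ?thesis using XB bd[of q] xy \<eta> by simp
      next
        assume "fst q = X" then show ?thesis using XB bd[of q] xy \<eta> by simp
      next
        assume "snd q = \<kappa>" then show ?thesis using bdry[of "fst q"] H1 \<eta> by (cases q) auto
      next
        assume "snd q = R" then show ?thesis using R1[of R "fst q"] R H1 by (cases q) auto
      qed
      then show "?w q \<ge> 0" unfolding w using H0 by linarith
    next
      fix q assume q: "q \<in> interior ?S" and neg: "?w q < 0"
      then have xy: "\<kappa> < snd q" "snd q < R" by (auto simp: interior_Times)
      have "0 \<le> \<delta> * H (fst q) (snd q)"
        using Hge[of "snd q" "fst q"] xy \<delta> by (simp add: order_trans[OF zero_le_power2])
      then have "v q > 0" using neg \<eta> unfolding w by linarith
      then show "?k q < 0" using l[of q] xy \<delta> by simp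
    qed
    then show ?thesis unfolding w using ab by simp
  qed
  have H0: "H a b \<ge> 0" using Hge[of b a] R p ab by (auto intro: order_trans[OF zero_le_power2])
  show "v p \<le> 0 + \<eta>"
  proof (rule field_le_epsilon)
    fix e :: real assume e: "e > 0"
    have "v p \<le> \<eta> + (e / (H a b + 1)) * H a b" by (rule key) (use e H0 in auto)
    also have "(e / (H a b + 1)) * H a b \<le> e" using e H0 by (simp add: field_simps)
    finally show "v p \<le> 0 + \<eta> + e" by simp
  qed
qed

section \<open>Calculus on the line\<close>

text \<open>The second difference of \<open>u\<close> over a small square is \<open>h^2\<close>
  times \<open>u12\<close> at one point of the square and \<open>h^2\<close> times
  \<open>u21\<close> at another, by the mean value theorem in either order; continuity does the
  rest. Iterated directional derivatives as in \<open>Ck\<close> do not identify the two by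
  definition.\<close>

lemma mixed_partials_eq:
  fixes u :: "real \<times> real \<Rightarrow> real"
  assumes u1: "\<And>x y. ((\<lambda>s. u (s, y)) has_real_derivative u1 (x, y)) (at x)"
    and u2: "\<And>x y. ((\<lambda>t. u (x, t)) has_real_derivative u2 (x, y)) (at y)"
    and u12: "\<And>x y. ((\<lambda>t. u1 (x, t)) has_real_derivative u12 (x, y)) (at y)"
    and u21: "\<And>x y. ((\<lambda>s. u2 (s, y)) has_real_derivative u21 (x, y)) (at x)"
    and cont: "continuous_on UNIV u12" "continuous_on UNIV u21"
  shows "u12 p = u21 p"
proof (rule ccontr)
  assume ne: "u12 p \<noteq> u21 p"
  define e where "e = \<bar>u12 p - u21 p\<bar> / 2"
  have e: "e > 0" using ne by (simp add: e_def)
  obtain a b where p: "p = (a, b)" by (cases p)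
  obtain d1 where d1: "d1 > 0" "\<And>q. dist q p < d1 \<Longrightarrow> dist (u12 q) (u12 p) < e"
    using cont(1) e unfolding continuous_on_iff by (meson UNIV_I)
  obtain d2 where d2: "d2 > 0" "\<And>q. dist q p < d2 \<Longrightarrow> dist (u21 q) (u21 p) < e"
    using cont(2) e unfolding continuous_on_iff by (meson UNIV_I)
  define h where "h = min d1 d2 / 3"
  have h: "h > 0" "2 * h < d1" "2 * h < d2" using d1 d2 by (auto simp: h_def)
  have near: "dist (x, y) p \<le> 2 * h" if "a < x" "x < a + h" "b < y" "y < b + h" for x y
  proof -
    have "dist (x, y) p \<le> \<bar>x - a\<bar> + \<bar>y - b\<bar>"
      unfolding p dist_Pair_Pair dist_real_def by (rule sqrt_sum_squares_le_sum_abs[THEN order_trans]) auto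
    then show ?thesis using that by simp
  qed
  obtain x where x: "a < x" "x < a + h"
    "(u (a + h, b + h) - u (a + h, b)) - (u (a, b + h) - u (a, b)) = (a + h - a) * (u1 (x, b + h) - u1 (x, b))"
    using MVT2[of a "a + h" "\<lambda>s. u (s, b + h) - u (s, b)" "\<lambda>s. u1 (s, b + h) - u1 (s, b)"]
      h(1) DERIV_diff[OF u1 u1] by auto
  obtain y where y: "b < y" "y < b + h" "u1 (x, b + h) - u1 (x, b) = (b + h - b) * u12 (x, y)"
    using MVT2[of b "b + h" "\<lambda>t. u1 (x, t)" "\<lambda>t. u12 (x, t)"] h(1) u12 by auto
  obtain y' where y': "b < y'" "y' < b + h"
    "(u (a + h, b + h) - u (a, b + h)) - (u (a + h, b) - u (a, b)) = (b + h - b) * (u2 (a + h, y') - u2 (a, y'))"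
    using MVT2[of b "b + h" "\<lambda>t. u (a + h, t) - u (a, t)" "\<lambda>t. u2 (a + h, t) - u2 (a, t)"]
      h(1) DERIV_diff[OF u2 u2] by auto
  obtain x' where x': "a < x'" "x' < a + h" "u2 (a + h, y') - u2 (a, y') = (a + h - a) * u21 (x', y')"
    using MVT2[of a "a + h" "\<lambda>s. u2 (s, y')" "\<lambda>s. u21 (s, y')"] h(1) u21 by auto
  have "h * (h * u12 (x, y)) = (u (a + h, b + h) - u (a + h, b)) - (u (a, b + h) - u (a, b))"
    using x(3) y(3) by simp
  also have "\<dots> = (u (a + h, b + h) - u (a, b + h)) - (u (a + h, b) - u (a, b))" by simp
  also have "\<dots> = h * (h * u21 (x', y'))"
    using y'(3) x'(3) by simp
  finally have "h * (h * u12 (x, y)) = h * (h * u21 (x', y'))" .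
  then have eq: "u12 (x, y) = u21 (x', y')" using h(1) by simp
  have "dist (u12 (x, y)) (u12 p) < e" by (rule d1(2)) (use near[of x y] x y h in auto)
  moreover have "dist (u21 (x', y')) (u21 p) < e" by (rule d2(2)) (use near[of x' y'] x' y' h in auto)
  ultimately show False using eq unfolding e_def dist_real_def by argo
qed

text \<open>For \<open>D = d^2 + d1^2\<close>, estimates of the form
  \<open>2 * a * b \<le> a^2 + b^2\<close> give \<open>D' \<le> (L + 2) * D + \<eta>^2\<close>. The
  additive error \<eta> leaves room for the contribution of \<open>u11\<close>.\<close>

lemma gronwall_second_order_forward:
  fixes d d1 d2 :: "real \<Rightarrow> real"
  assumes d: "\<And>t. (d has_real_derivative d1 t) (at t)" "\<And>t. (d1 has_real_derivative d2 t) (at t)"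
    and b: "\<And>t. a \<le> t \<Longrightarrow> t \<le> b \<Longrightarrow> \<bar>d2 t\<bar> \<le> L * \<bar>d t\<bar> + \<eta>"
    and L: "L \<ge> 0" and ab: "a \<le> b"
  shows "(d b)^2 + (d1 b)^2 \<le> ((d a)^2 + (d1 a)^2 + \<eta>^2 * (b - a)) * exp ((L + 2) * (b - a))"
proof -
  define D where "D t = (d t)^2 + (d1 t)^2" for t
  define c where "c = L + 2"
  \<comment> \<open>Integrating factor. The exponential is at most 1 to the right of
    \<open>a\<close>, so subtracting \<open>\<eta>^2 * (t - a)\<close> absorbs the error and makes
    \<open>G\<close> nonincreasing.\<close>
  define G where "G t = D t * exp (- c * (t - a)) - \<eta>^2 * (t - a)" for t
  have "G b \<le> G a"
  proof (rule DERIV_nonpos_imp_nonincreasing[OF ab])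
    fix t assume t: "a \<le> t" "t \<le> b"
    let ?D' = "2 * d t * d1 t + 2 * d1 t * d2 t"
    have "((\<lambda>t. (d t)^2 + (d1 t)^2) has_real_derivative ?D') (at t)"
      using d by (auto intro!: derivative_eq_intros)
    then have DD: "(D has_real_derivative ?D') (at t)" by (simp add: D_def[abs_def])
    have "?D' \<le> c * D t + \<eta>^2"
    proof -
      have "2 * d1 t * d2 t \<le> 2 * \<bar>d1 t\<bar> * (L * \<bar>d t\<bar> + \<eta>)"
      proof -
        have "2 * d1 t * d2 t \<le> 2 * \<bar>d1 t\<bar> * \<bar>d2 t\<bar>"
          using abs_ge_self[of "d1 t * d2 t"] by (simp add: abs_mult)
        also have "\<dots> \<le> 2 * \<bar>d1 t\<bar> * (L * \<bar>d t\<bar> + \<eta>)"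
          using b[OF t] by (intro mult_left_mono) auto
        finally show ?thesis .
      qed
      moreover have "2 * \<bar>d1 t\<bar> * \<bar>d t\<bar> \<le> D t"
        using sum_squares_bound[of "\<bar>d t\<bar>" "\<bar>d1 t\<bar>"] by (simp add: D_def algebra_simps)
      then have "L * (2 * \<bar>d1 t\<bar> * \<bar>d t\<bar>) \<le> L * D t" using L by (intro mult_left_mono)
      moreover have "2 * \<bar>d1 t\<bar> * \<eta> \<le> (d1 t)^2 + \<eta>^2"
        using sum_squares_bound[of "\<bar>d1 t\<bar>" \<eta>] by simp
      moreover have "2 * d t * d1 t \<le> D t"
        using sum_squares_bound[of "d t" "d1 t"] by (simp add: D_def)
      moreover have "(d1 t)^2 \<le> D t" by (simp add: D_def)
      moreover have "2 * \<bar>d1 t\<bar> * (L * \<bar>d t\<bar> + \<eta>) = L * (2 * \<bar>d1 t\<bar> * \<bar>d t\<bar>) + 2 * \<bar>d1 t\<bar> * \<eta>"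
        by (simp add: algebra_simps)
      moreover have "c * D t = L * D t + D t + D t" by (simp add: c_def algebra_simps)
      ultimately show ?thesis by linarith
    qed
    then have "(?D' - c * D t) * exp (- c * (t - a)) \<le> \<eta>^2 * exp (- c * (t - a))"
      by (intro mult_right_mono) auto
    also have "\<dots> \<le> \<eta>^2 * 1"
      using t L by (intro mult_left_mono) (auto simp: c_def mult_nonpos_nonneg)
    finally have "(?D' - c * D t) * exp (- c * (t - a)) - \<eta>^2 \<le> 0" by simp
    moreover have "(G has_real_derivative (?D' - c * D t) * exp (- c * (t - a)) - \<eta>^2) (at t)"
      unfolding G_def[abs_def] by (auto intro!: derivative_eq_intros DD simp: algebra_simps)
    ultimately show "\<exists>y. (G has_real_derivative y) (at t) \<and> y \<le> 0" by blast
  qed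
  then have "D b * exp (- c * (b - a)) \<le> D a + \<eta>^2 * (b - a)" by (simp add: G_def)
  then have "D b * exp (- c * (b - a)) * exp (c * (b - a)) \<le> (D a + \<eta>^2 * (b - a)) * exp (c * (b - a))"
    by (intro mult_right_mono) auto
  moreover have "D b * exp (- c * (b - a)) * exp (c * (b - a)) = D b"
    unfolding mult.assoc exp_add[symmetric] by simp
  ultimately have "D b \<le> (D a + \<eta>^2 * (b - a)) * exp (c * (b - a))" by metis
  then show ?thesis by (simp only: D_def c_def)
qed

text \<open>Propagation to the left is propagation to the right for \<open>d (- t)\<close>.\<close>

lemma gronwall_second_order:
  fixes d d1 d2 :: "real \<Rightarrow> real"
  assumes d: "\<And>t. (d has_real_derivative d1 t) (at t)" "\<And>t. (d1 has_real_derivative d2 t) (at t)"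
    and b: "\<And>t. \<bar>t\<bar> \<le> B \<Longrightarrow> \<bar>d2 t\<bar> \<le> L * \<bar>d t\<bar> + \<eta>"
    and L: "L \<ge> 0" and ab: "\<bar>a\<bar> \<le> B" "\<bar>b\<bar> \<le> B"
  shows "(d b)^2 + (d1 b)^2 \<le> ((d a)^2 + (d1 a)^2 + \<eta>^2 * \<bar>b - a\<bar>) * exp ((L + 2) * \<bar>b - a\<bar>)"
proof (cases "a \<le> b")
  case True
  then show ?thesis
    using gronwall_second_order_forward[OF d _ L True, of \<eta>] b ab by simp
next
  case False
  have r1: "((\<lambda>t. d (- t)) has_real_derivative - d1 (- t)) (at t)" for t
    using DERIV_chain2[OF d(1)[of "-t"] DERIV_minus[OF DERIV_ident]] by simp
  have r2: "((\<lambda>t. - d1 (- t)) has_real_derivative d2 (- t)) (at t)" for t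
    using DERIV_minus[OF DERIV_chain2[OF d(2)[of "-t"] DERIV_minus[OF DERIV_ident]]] by simp
  show ?thesis
    using gronwall_second_order_forward[OF r1 r2 _ L, of "- a" "- b" \<eta>] b ab False by simp
qed

text \<open>Nonnegativity at distance \<open>s\<close> on either side limits the slope of
  \<open>g\<close>, up to its variation \<open>K * s\<close>. With \<open>s\<close> small this turns
  smallness of \<open>g\<close> into smallness of \<open>g1\<close>.\<close>

lemma derivative_bound_of_nonneg:
  fixes g g1 :: "real \<Rightarrow> real"
  assumes g: "\<And>t. (g has_real_derivative g1 t) (at t)"
    and nn: "\<And>t. \<bar>t - y\<bar> \<le> s \<Longrightarrow> g t \<ge> 0"
    and lip: "\<And>t. \<bar>t - y\<bar> \<le> s \<Longrightarrow> \<bar>g1 t - g1 y\<bar> \<le> K * \<bar>t - y\<bar>"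
    and s: "s > 0" and K: "K \<ge> 0"
  shows "\<bar>g1 y\<bar> \<le> g y / s + K * s"
proof -
  obtain z where z: "y < z" "z < y + s" "g (y + s) - g y = (y + s - y) * g1 z"
    using MVT2[of y "y + s" g g1] g s by auto
  obtain w where w: "y - s < w" "w < y" "g y - g (y - s) = (y - (y - s)) * g1 w"
    using MVT2[of "y - s" y g g1] g s by auto
  have "K * \<bar>z - y\<bar> \<le> K * s" "K * \<bar>w - y\<bar> \<le> K * s" using z w K by (auto intro!: mult_left_mono)
  then have zw: "\<bar>g1 z - g1 y\<bar> \<le> K * s" "\<bar>g1 w - g1 y\<bar> \<le> K * s"
    using lip[of z] lip[of w] z w by auto
  have "s * g1 z \<ge> - g y" "s * g1 w \<le> g y"
    using nn[of "y + s"] nn[of "y - s"] z(3) w(3) s by auto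
  then have "g1 z \<ge> - (g y / s)" "g1 w \<le> g y / s"
    using s by (auto simp: field_simps)
  then show ?thesis using zw by linarith
qed

lemma integral_derivative_eq_0:
  fixes g g' :: "real \<Rightarrow> real"
  assumes "\<And>t. (g has_real_derivative g' t) (at t)" "continuous_on UNIV g'" "integrable lborel g'"
    and "(g \<longlongrightarrow> 0) at_top" "(g \<longlongrightarrow> 0) at_bot"
  shows "integral\<^sup>L lborel g' = 0"
proof -
  have "(LBINT x=-\<infinity>..\<infinity>. g' x) = 0 - 0"
    by (rule interval_integral_FTC_integrable[where F=g])
      (use assms in \<open>auto simp: has_real_derivative_iff_has_vector_derivative[symmetric] set_integrable_def
        continuous_on_eq_continuous_at ereal_tendsto_simps einterval_eq_UNIV\<close>)
  then show ?thesis
    by (simp add: interval_lebesgue_integral_def einterval_eq_UNIV set_lebesgue_integral_def)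
qed

text \<open>A balance law with density \<open>A\<close>, flux \<open>B\<close> and source
  \<open>G\<close>: the flux vanishes at both ends and the source has integral 0, so the total of
  \<open>A\<close> is conserved. The dominating \<open>h\<close>, uniform in \<open>x\<close>,
  justifies differentiation under the integral.\<close>

lemma integral_independent_of_parameter:
  fixes A A1 B B2 G :: "real \<Rightarrow> real \<Rightarrow> real"
  assumes dA: "\<And>x t. ((\<lambda>x. A x t) has_real_derivative A1 x t) (at x)"
    and dB: "\<And>x t. ((\<lambda>t. B x t) has_real_derivative B2 x t) (at t)"
    and eq: "\<And>x t. A1 x t + B2 x t = G x t"
    and h: "integrable lborel h"
    and bA: "\<And>x t. \<bar>A x t\<bar> \<le> h t" "\<And>x t. \<bar>A1 x t\<bar> \<le> h t"
    and bB: "\<And>x t. \<bar>B2 x t\<bar> \<le> h t"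
    and c: "\<And>x. continuous_on UNIV (A x)" "\<And>x. continuous_on UNIV (A1 x)" "\<And>x. continuous_on UNIV (B2 x)"
    and B0: "\<And>x. (B x \<longlongrightarrow> 0) at_top" "\<And>x. (B x \<longlongrightarrow> 0) at_bot"
    and G0: "\<And>x. integral\<^sup>L lborel (G x) = 0"
  shows "integral\<^sup>L lborel (A x) = integral\<^sup>L lborel (A y)"
proof -
  have meas: "A x \<in> borel_measurable lborel" "A1 x \<in> borel_measurable lborel"
    "B2 x \<in> borel_measurable lborel" for x
    using c by (auto intro: borel_measurable_continuous_onI)
  have int: "integrable lborel (A x)" "integrable lborel (A1 x)" "integrable lborel (B2 x)" for x
    by (rule Bochner_Integration.integrable_bound[OF h meas(1)] Bochner_Integration.integrable_bound[OF h meas(2)]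
          Bochner_Integration.integrable_bound[OF h meas(3)];
        use bA bB in \<open>force intro: order_trans[OF _ abs_ge_self]\<close>)+
  have A10: "integral\<^sup>L lborel (A1 x) = 0" for x
  proof -
    have "G x = (\<lambda>t. A1 x t + B2 x t)" by (simp add: eq)
    then have "integral\<^sup>L lborel (A1 x) + integral\<^sup>L lborel (B2 x) = 0"
      using G0[of x] int[of x] by simp
    moreover have "integral\<^sup>L lborel (B2 x) = 0"
      by (rule integral_derivative_eq_0[OF dB c(3) int(3) B0])
    ultimately show ?thesis by simp
  qed
  have "((\<lambda>x. integral\<^sup>L lborel (A x)) has_real_derivative 0) (at x)" for x
    unfolding DERIV_def tendsto_at_iff_sequentially
  proof (intro allI impI)
    fix X :: "nat \<Rightarrow> real" assume X: "\<forall>i. X i \<in> UNIV - {0}" and X0: "X \<longlonglongrightarrow> 0"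
    have "(\<lambda>i. integral\<^sup>L lborel (\<lambda>t. (A (x + X i) t - A x t) / X i)) \<longlonglongrightarrow> integral\<^sup>L lborel (A1 x)"
    proof (rule integral_dominated_convergence[OF meas(2) _ h])
      show "(\<lambda>t. (A (x + X i) t - A x t) / X i) \<in> borel_measurable lborel" for i
        using meas(1) by measurable
      show "AE t in lborel. (\<lambda>i. (A (x + X i) t - A x t) / X i) \<longlonglongrightarrow> A1 x t"
      proof (rule AE_I2)
        fix t
        show "(\<lambda>i. (A (x + X i) t - A x t) / X i) \<longlonglongrightarrow> A1 x t"
          using dA[of t x] X X0 unfolding DERIV_def tendsto_at_iff_sequentially comp_def by blast
      qed
      show "AE t in lborel. norm ((A (x + X i) t - A x t) / X i) \<le> h t" for i
      proof (rule AE_I2)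
        fix t
        \<comment> \<open>The mean value inequality bounds the difference quotients by the same
          \<open>h\<close>.\<close>
        have "norm (A (x + X i) t - A x t) \<le> h t * norm (x + X i - x)"
          by (rule field_differentiable_bound[of UNIV "\<lambda>x. A x t" "\<lambda>x. A1 x t"])
            (use dA bA in auto)
        then show "norm ((A (x + X i) t - A x t) / X i) \<le> h t"
          using X by (simp add: divide_le_eq)
      qed
    qed
    moreover have "integral\<^sup>L lborel (\<lambda>t. (A (x + X i) t - A x t) / X i) =
        (integral\<^sup>L lborel (A (x + X i)) - integral\<^sup>L lborel (A x)) / X i" for i
      using int(1) by simp
    ultimately show "((\<lambda>h. (integral\<^sup>L lborel (A (x + h)) - integral\<^sup>L lborel (A x)) / h) \<circ> X) \<longlonglongrightarrow> 0"
      by (simp only: comp_def A10)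
  qed
  then show ?thesis using DERIV_isconst_all by blast
qed

lemma integrable_one_plus_abs_powr:
  assumes "p < -1"
  shows "integrable lborel (\<lambda>t::real. (1 + \<bar>t\<bar>) powr p)"
proof -
  have "(\<lambda>x::real. x powr p) absolutely_integrable_on {1..}"
    by (rule nonnegative_absolutely_integrable_1)
      (use has_integral_powr_to_inf[OF assms, of 1] in \<open>auto intro: has_integral_integrable\<close>)
  then have "integrable lebesgue (\<lambda>x::real. indicator {1..} x * x powr p)"
    by (simp add: set_integrable_def)
  then have i: "integrable lborel (\<lambda>x::real. indicator {1..} x * x powr p)"
    by (subst (asm) integrable_completion) auto
  \<comment> \<open>Two copies of the half-line integrand, one for each sign of \<open>t\<close>,
    dominate the two-sided one.\<close>
  have "integrable lborel (\<lambda>t. indicator {1..} (1 + 1 * t) * (1 + 1 * t) powr p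
      + indicator {1..} (1 + (-1) * t) * (1 + (-1) * t) powr p)"
    by (intro Bochner_Integration.integrable_add lborel_integrable_real_affine[OF i]) auto
  then show ?thesis
    by (rule Bochner_Integration.integrable_bound) (auto simp: indicator_def)
qed

section \<open>Power weights\<close>

text \<open>With \<open>1 + |t|\<close> in place of \<open>|t|\<close> the decay holds on the whole
  line, and the weights at nearby points are comparable.\<close>

definition weight :: "real \<Rightarrow> real \<Rightarrow> real" where
  "weight \<sigma> t = (1 + \<bar>t\<bar>) powr (- (1 + \<sigma>))"

lemma weight_pos: "weight \<sigma> t > 0"
  by (simp add: weight_def add_pos_nonneg)

lemma weight_le_1: "\<sigma> > 0 \<Longrightarrow> weight \<sigma> t \<le> 1"
  using powr_mono[of "- (1 + \<sigma>)" 0 "1 + \<bar>t\<bar>"] by (simp add: weight_def split: if_splits)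

lemma weight_minus [simp]: "weight \<sigma> (- t) = weight \<sigma> t"
  by (simp add: weight_def)

lemma weight_shift:
  assumes "\<sigma> > 0" "\<bar>y - b\<bar> \<le> 2"
  shows "weight \<sigma> y \<le> 3 powr (1 + \<sigma>) * weight \<sigma> b"
proof -
  have "1 + \<bar>b\<bar> \<le> 3 * (1 + \<bar>y\<bar>)" using assms by (auto simp: abs_if split: if_splits)
  then have "(1 + \<bar>b\<bar>) powr (1 + \<sigma>) \<le> (3 * (1 + \<bar>y\<bar>)) powr (1 + \<sigma>)"
    using assms by (intro powr_mono2) auto
  also have "\<dots> = 3 powr (1 + \<sigma>) * (1 + \<bar>y\<bar>) powr (1 + \<sigma>)" by (rule powr_mult)
  finally have "(1 + \<bar>b\<bar>) powr (1 + \<sigma>) \<le> 3 powr (1 + \<sigma>) * (1 + \<bar>y\<bar>) powr (1 + \<sigma>)" .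
  moreover have "(1 + \<bar>b\<bar>) powr (1 + \<sigma>) > 0" "(1 + \<bar>y\<bar>) powr (1 + \<sigma>) > 0"
    by (auto simp: add_pos_nonneg)
  ultimately show ?thesis
    unfolding weight_def powr_minus by (simp add: field_simps)
qed

lemma weight_tendsto_0:
  assumes "\<sigma> > 0" shows "(weight \<sigma> \<longlongrightarrow> 0) at_top"
proof -
  have "filterlim (\<lambda>t::real. 1 + \<bar>t\<bar>) at_top at_top"
    by (rule filterlim_tendsto_add_at_top[OF tendsto_const])
      (rule filterlim_at_top_mono[OF filterlim_ident], auto intro: always_eventually)
  then have "((\<lambda>t::real. (1 + \<bar>t\<bar>) powr (- (1 + \<sigma>))) \<longlongrightarrow> 0) at_top"
    by (rule tendsto_neg_powr[rotated]) (use assms in auto)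
  then show ?thesis by (simp add: weight_def[abs_def])
qed

lemma weight_small:
  assumes "\<sigma> > 0" "e > 0"
  obtains R where "R > 0" "\<And>t. \<bar>t\<bar> \<ge> R \<Longrightarrow> K * weight \<sigma> t < e"
proof -
  have "((\<lambda>t. K * weight \<sigma> t) \<longlongrightarrow> K * 0) at_top"
    by (intro tendsto_intros weight_tendsto_0 assms)
  then have "eventually (\<lambda>t. K * weight \<sigma> t < e) at_top"
    using order_tendstoD(2)[of _ 0] assms by auto
  then obtain R where R: "\<And>t. t \<ge> R \<Longrightarrow> K * weight \<sigma> t < e"
    unfolding eventually_at_top_linorder by blast
  show ?thesis
  proof (rule that[of "max R 1"])
    fix t :: real assume "\<bar>t\<bar> \<ge> max R 1"
    then have "K * weight \<sigma> \<bar>t\<bar> < e" by (intro R) auto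
    then show "K * weight \<sigma> t < e" by (simp add: weight_def)
  qed auto
qed

section \<open>Decay of the solution and its derivatives\<close>

text \<open>The derivatives are parameters so that the reflected solution can be given explicitly as
  a second instance; \<open>u12\<close> stands for both mixed partials. The Lipschitz condition
  concerns \<open>{0..K}\<close>, an interval containing the range of \<open>u\<close>.\<close>

locale decaying_solution =
  fixes f F :: "real \<Rightarrow> real" and u u1 u2 u11 u12 u22 :: "real \<times> real \<Rightarrow> real" and \<epsilon> K L \<sigma> :: real
  assumes f_lipschitz: "\<And>s t. s \<in> {0..K} \<Longrightarrow> t \<in> {0..K} \<Longrightarrow> \<bar>f s - f t\<bar> \<le> L * \<bar>s - t\<bar>"
    and L_nonneg: "L \<ge> 0"
    and f_0: "f 0 = 0"
    and f_antimono: "\<And>s t. 0 \<le> s \<Longrightarrow> s \<le> t \<Longrightarrow> t < \<epsilon> \<Longrightarrow> f t \<le> f s"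
    and eps: "\<epsilon> > 0" and sigma: "\<sigma> > 0"
    and F: "\<And>s. (F has_real_derivative f s) (at s)"
    and F_0: "F 0 = 0"
    and u_pos: "\<And>p. u p > 0"
    and u_le: "\<And>x y. u (x, y) \<le> K * weight \<sigma> y"
    and du1: "\<And>x y. ((\<lambda>s. u (s, y)) has_real_derivative u1 (x, y)) (at x)"
    and du2: "\<And>x y. ((\<lambda>t. u (x, t)) has_real_derivative u2 (x, y)) (at y)"
    and du11: "\<And>x y. ((\<lambda>s. u1 (s, y)) has_real_derivative u11 (x, y)) (at x)"
    and du12: "\<And>x y. ((\<lambda>t. u1 (x, t)) has_real_derivative u12 (x, y)) (at y)"
    and du21: "\<And>x y. ((\<lambda>s. u2 (s, y)) has_real_derivative u12 (x, y)) (at x)"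
    and du22: "\<And>x y. ((\<lambda>t. u2 (x, t)) has_real_derivative u22 (x, y)) (at y)"
    and cont: "continuous_on UNIV u" "continuous_on UNIV u1" "continuous_on UNIV u2"
      "continuous_on UNIV u11" "continuous_on UNIV u12" "continuous_on UNIV u22"
    and pde: "\<And>p. u11 p + u22 p = - f (u p)"
    and u1_lim: "\<And>y. ((\<lambda>x. u1 (x, y)) \<longlongrightarrow> 0) at_infinity"
begin

lemma K_pos: "K > 0"
proof -
  have "0 < K * weight \<sigma> 0" using u_pos[of "(0, 0)"] u_le[of 0 0] by simp
  then show ?thesis using weight_pos[of \<sigma> 0] by (rule zero_less_mult_pos2)
qed

lemma u_le_K: "u p \<le> K"
proof -
  have "u p \<le> K * weight \<sigma> (snd p)" using u_le[of "fst p" "snd p"] by simp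
  also have "\<dots> \<le> K * 1" using K_pos weight_le_1[OF sigma] by (intro mult_left_mono) auto
  finally show ?thesis by simp
qed

lemma u_range: "u p \<in> {0..K}"
  using u_pos[of p] u_le_K[of p] by simp

lemma f_u_diff: "\<bar>f (u p) - f (u q)\<bar> \<le> L * \<bar>u p - u q\<bar>"
  by (rule f_lipschitz[OF u_range u_range])

lemma f_u_le: "\<bar>f (u p)\<bar> \<le> L * u p"
  using f_lipschitz[OF u_range[of p], of 0] K_pos f_0 u_pos[of p] by simp

text \<open>Quadratic because both \<open>F\<close> and its derivative \<open>f\<close> vanish at 0;
  this gives \<open>F (u p)\<close> the decay of the squared gradient.\<close>

lemma F_u_le: "\<bar>F (u p)\<bar> \<le> L * (u p)^2"
proof -
  obtain z where z: "0 < z" "z < u p" "F (u p) - F 0 = (u p - 0) * f z"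
    using MVT2[of 0 "u p" F f] F u_pos by blast
  have "\<bar>f z\<bar> \<le> L * z"
    using f_lipschitz[of z 0] z u_le_K[of p] f_0 by simp
  also have "\<dots> \<le> L * u p" using z L_nonneg by (intro mult_left_mono) auto
  finally have "u p * \<bar>f z\<bar> \<le> u p * (L * u p)" using u_pos[of p] by (intro mult_left_mono) auto
  then show ?thesis using z F_0 u_pos[of p] by (simp add: abs_mult power2_eq_square algebra_simps)
qed

lemma F_u_diff: "\<bar>F (u p) - F (u q)\<bar> \<le> L * K * \<bar>u p - u q\<bar>"
proof -
  have "norm (F (u p) - F (u q)) \<le> L * K * norm (u p - u q)"
  proof (rule field_differentiable_bound[of "{0..K}" F f])
    show "(F has_field_derivative f z) (at z within {0..K})" for z
      using F by (rule has_field_derivative_at_within)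
    show "norm (f z) \<le> L * K" if "z \<in> {0..K}" for z
    proof -
      have "\<bar>f z\<bar> \<le> L * z" using f_lipschitz[of z 0] that f_0 K_pos by simp
      also have "\<dots> \<le> L * K" using that L_nonneg by (intro mult_left_mono) auto
      finally show ?thesis by simp
    qed
  qed (use u_range in auto)
  then show ?thesis by simp
qed

lemma lap_u: "has_lap u (\<lambda>p. - f (u p))"
  by (rule has_lapI[OF cont(1) du1 du2 du11 du22]) (simp add: pde)

text \<open>The factor lost each time the gradient estimate is applied to a function bounded by the
  weight: \<open>(4 + L) / 2\<close> from the estimate, the power of 3 from
  \<open>weight_shift\<close>.\<close>

definition growth :: real where
  "growth = 3 powr (1 + \<sigma>) * (4 + L) / 2"

text \<open>One constant for \<open>u\<close> and its derivatives up to order 2. Two applications of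
  the estimate give \<open>growth^2\<close>; the summand \<open>L * K\<close> is for
  \<open>u22\<close>, which is recovered from the equation.\<close>

definition bound :: real where
  "bound = K * growth^2 + L * K"

lemma growth_ge_1: "growth \<ge> 1"
proof -
  have "1 \<le> 3 powr (1 + \<sigma>)" using sigma by (intro ge_one_powr_ge_zero) auto
  moreover have "1 \<le> (4 + L) / 2" using L_nonneg by simp
  ultimately have "1 * 1 \<le> 3 powr (1 + \<sigma>) * ((4 + L) / 2)" by (intro mult_mono) auto
  then show ?thesis by (simp add: growth_def)
qed

lemma bound_ge: "K \<le> bound" "K * growth \<le> bound" "K * growth^2 \<le> bound"
  "bound > 0"
proof -
  have g: "growth^2 \<ge> growth" "growth^2 \<ge> 1"
    using growth_ge_1 mult_left_mono[of 1 growth growth] unfolding power2_eq_square by linarith+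
  have LK: "L * K \<ge> 0" using L_nonneg K_pos by simp
  have "K * growth \<le> K * growth^2" "K * 1 \<le> K * growth^2" using g K_pos by (auto intro: mult_left_mono)
  then show "K \<le> bound" "K * growth \<le> bound" "K * growth^2 \<le> bound"
    using LK by (auto simp: bound_def)
  then show "bound > 0" using K_pos by linarith
qed

lemma u_near:
  assumes "\<bar>y - b\<bar> \<le> 1"
  shows "\<bar>u (x, y)\<bar> \<le> K * (3 powr (1 + \<sigma>) * weight \<sigma> b)"
proof -
  have "u (x, y) \<le> K * weight \<sigma> y" by (rule u_le)
  also have "\<dots> \<le> K * (3 powr (1 + \<sigma>) * weight \<sigma> b)"
    using K_pos assms sigma by (intro mult_left_mono weight_shift) auto
  finally show ?thesis using u_pos[of "(x, y)"] by simp
qed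

lemma lap_near:
  assumes "\<bar>y - b\<bar> \<le> 1"
  shows "\<bar>- f (u (x, y))\<bar> \<le> L * (K * (3 powr (1 + \<sigma>) * weight \<sigma> b))"
proof -
  have "\<bar>- f (u (x, y))\<bar> \<le> L * u (x, y)" using f_u_le by simp
  also have "\<dots> \<le> L * (K * (3 powr (1 + \<sigma>) * weight \<sigma> b))"
    using u_near[OF assms] L_nonneg by (intro mult_left_mono) (auto simp: abs_le_iff)
  finally show ?thesis .
qed

lemma gradient_decay:
  "\<bar>u1 (x, y)\<bar> \<le> K * growth * weight \<sigma> y" "\<bar>u2 (x, y)\<bar> \<le> K * growth * weight \<sigma> y"
proof -
  let ?M = "K * (3 powr (1 + \<sigma>) * weight \<sigma> y)"
  have eq: "(4 * ?M + L * ?M) / 2 = K * growth * weight \<sigma> y"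
    by (simp add: growth_def field_simps)
  have "\<bar>u1 (x, y)\<bar> \<le> (4 * ?M + L * ?M) / 2"
    by (rule derivative_bound_of_symmetric_difference[OF du1])
      (rule gradient_bound[OF lap_u u_near lap_near], auto)
  then show "\<bar>u1 (x, y)\<bar> \<le> K * growth * weight \<sigma> y" unfolding eq .
  have "\<bar>u2 (x, y)\<bar> \<le> (4 * ?M + L * ?M) / 2"
    by (rule derivative_bound_of_symmetric_difference[OF du2])
      (rule gradient_bound_snd[OF lap_u u_near lap_near], auto)
  then show "\<bar>u2 (x, y)\<bar> \<le> K * growth * weight \<sigma> y" unfolding eq .
qed

text \<open>Kept local because it is used twice: with \<open>m\<close> decaying in \<open>y\<close>
  for the Hessian, and with \<open>m\<close> small far out for the limit of
  \<open>u11\<close>.\<close>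

lemma derivative_u1_bound:
  assumes "\<And>s t. \<bar>s - x\<bar> \<le> 2 \<Longrightarrow> \<bar>t - y\<bar> \<le> 1 \<Longrightarrow> \<bar>u1 (s, t)\<bar> \<le> m"
  shows "\<bar>u11 (x, y)\<bar> \<le> (4 + L) * m / 2" "\<bar>u12 (x, y)\<bar> \<le> (4 + L) * m / 2"
proof -
  show "\<bar>u11 (x, y)\<bar> \<le> (4 + L) * m / 2"
    by (rule derivative_bound_of_symmetric_difference[OF du11])
      (rule second_derivative_bound(1)[OF lap_u f_u_diff du1 assms L_nonneg], auto)
  show "\<bar>u12 (x, y)\<bar> \<le> (4 + L) * m / 2"
    by (rule derivative_bound_of_symmetric_difference[OF du12])
      (rule second_derivative_bound(2)[OF lap_u f_u_diff du1 assms L_nonneg], auto)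
qed

lemma hessian_decay:
  "\<bar>u11 (x, y)\<bar> \<le> K * growth^2 * weight \<sigma> y" "\<bar>u12 (x, y)\<bar> \<le> K * growth^2 * weight \<sigma> y"
proof -
  let ?m = "K * growth * (3 powr (1 + \<sigma>) * weight \<sigma> y)"
  have m: "\<bar>u1 (s, t)\<bar> \<le> ?m" if "\<bar>t - y\<bar> \<le> 1" for s t
  proof -
    have "\<bar>u1 (s, t)\<bar> \<le> K * growth * weight \<sigma> t" by (rule gradient_decay)
    also have "\<dots> \<le> ?m"
      using K_pos growth_ge_1 that sigma by (intro mult_left_mono weight_shift) auto
    finally show ?thesis .
  qed
  have eq: "(4 + L) * ?m / 2 = K * growth^2 * weight \<sigma> y"
    by (simp add: growth_def power2_eq_square)
  show "\<bar>u11 (x, y)\<bar> \<le> K * growth^2 * weight \<sigma> y"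
    using derivative_u1_bound(1)[of x y ?m] m unfolding eq by blast
  show "\<bar>u12 (x, y)\<bar> \<le> K * growth^2 * weight \<sigma> y"
    using derivative_u1_bound(2)[of x y ?m] m unfolding eq by blast
qed

lemma decay:
  "\<bar>u (x, y)\<bar> \<le> bound * weight \<sigma> y"
  "\<bar>u1 (x, y)\<bar> \<le> bound * weight \<sigma> y"
  "\<bar>u2 (x, y)\<bar> \<le> bound * weight \<sigma> y"
  "\<bar>u11 (x, y)\<bar> \<le> bound * weight \<sigma> y"
  "\<bar>u12 (x, y)\<bar> \<le> bound * weight \<sigma> y"
  "\<bar>u22 (x, y)\<bar> \<le> bound * weight \<sigma> y"
proof -
  have w: "0 \<le> weight \<sigma> y" using weight_pos less_imp_le by blast
  note m = mult_right_mono[OF _ w]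
  show "\<bar>u (x, y)\<bar> \<le> bound * weight \<sigma> y"
    using u_le[of x y] u_pos[of "(x, y)"] m[OF bound_ge(1)] by simp
  show "\<bar>u1 (x, y)\<bar> \<le> bound * weight \<sigma> y" "\<bar>u2 (x, y)\<bar> \<le> bound * weight \<sigma> y"
    using gradient_decay[of x y] m[OF bound_ge(2)] by simp_all
  show "\<bar>u11 (x, y)\<bar> \<le> bound * weight \<sigma> y" "\<bar>u12 (x, y)\<bar> \<le> bound * weight \<sigma> y"
    using hessian_decay[of x y] m[OF bound_ge(3)] by simp_all
  have "\<bar>f (u (x, y))\<bar> \<le> L * (K * weight \<sigma> y)"
    using f_u_le[of "(x, y)"] mult_left_mono[OF u_le[of x y] L_nonneg] by simp
  then have "\<bar>u22 (x, y)\<bar> \<le> L * (K * weight \<sigma> y) + K * growth^2 * weight \<sigma> y"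
    using pde[of "(x, y)"] hessian_decay(1)[of x y] by linarith
  then show "\<bar>u22 (x, y)\<bar> \<le> bound * weight \<sigma> y" by (simp add: bound_def algebra_simps)
qed

lemma bounded:
  "\<bar>u p\<bar> \<le> bound" "\<bar>u1 p\<bar> \<le> bound" "\<bar>u2 p\<bar> \<le> bound"
  "\<bar>u11 p\<bar> \<le> bound" "\<bar>u12 p\<bar> \<le> bound" "\<bar>u22 p\<bar> \<le> bound"
proof -
  have "bound * weight \<sigma> (snd p) \<le> bound"
    using bound_ge(4) weight_le_1[OF sigma] by (simp add: mult_left_le)
  then show "\<bar>u p\<bar> \<le> bound" "\<bar>u1 p\<bar> \<le> bound" "\<bar>u2 p\<bar> \<le> bound"
  "\<bar>u11 p\<bar> \<le> bound" "\<bar>u12 p\<bar> \<le> bound" "\<bar>u22 p\<bar> \<le> bound"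
    using decay[of "fst p" "snd p"] by simp_all
qed

lemma lipschitz_snd:
  "\<bar>u (x, s) - u (x, t)\<bar> \<le> bound * \<bar>s - t\<bar>"
  "\<bar>u1 (x, s) - u1 (x, t)\<bar> \<le> bound * \<bar>s - t\<bar>"
  "\<bar>u2 (x, s) - u2 (x, t)\<bar> \<le> bound * \<bar>s - t\<bar>"
  using field_differentiable_bound[of UNIV "\<lambda>t. u (x, t)" "\<lambda>t. u2 (x, t)" bound s t]
    field_differentiable_bound[of UNIV "\<lambda>t. u1 (x, t)" "\<lambda>t. u12 (x, t)" bound s t]
    field_differentiable_bound[of UNIV "\<lambda>t. u2 (x, t)" "\<lambda>t. u22 (x, t)" bound s t]
    du2 du12 du22 bounded by auto

lemma continuous_sections:
  "continuous_on A (\<lambda>t. u (x, t))" "continuous_on A (\<lambda>t. u1 (x, t))" "continuous_on A (\<lambda>t. u2 (x, t))"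
  "continuous_on A (\<lambda>t. u11 (x, t))" "continuous_on A (\<lambda>t. u12 (x, t))" "continuous_on A (\<lambda>t. u22 (x, t))"
  "continuous_on A (\<lambda>t. f (u (x, t)))" "continuous_on A (\<lambda>t. F (u (x, t)))"
proof -
  have c: "continuous_on A (\<lambda>t. g (x, t))" if "continuous_on UNIV g" for g :: "real \<times> real \<Rightarrow> real"
    by (rule continuous_on_compose2[OF that]) (auto intro!: continuous_intros)
  show cs: "continuous_on A (\<lambda>t. u (x, t))" "continuous_on A (\<lambda>t. u1 (x, t))" "continuous_on A (\<lambda>t. u2 (x, t))"
    "continuous_on A (\<lambda>t. u11 (x, t))" "continuous_on A (\<lambda>t. u12 (x, t))" "continuous_on A (\<lambda>t. u22 (x, t))"
    by (rule c, rule cont)+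
  have "f (u p) = - (u11 p + u22 p)" for p by (simp add: pde)
  then show "continuous_on A (\<lambda>t. f (u (x, t)))" by (simp only:) (intro continuous_intros cs)
  have "continuous_on UNIV F" using F by (meson DERIV_isCont continuous_at_imp_continuous_on)
  then show "continuous_on A (\<lambda>t. F (u (x, t)))"
    by (rule continuous_on_compose2) (auto intro: cs)
qed

section \<open>Uniform limits at infinity\<close>

text \<open>The assumed limit is pointwise in \<open>y\<close>. Otherwise a subsequence of bad
  heights converges to some \<open>l\<close>, and the Lipschitz bound of \<open>u1\<close> in
  \<open>y\<close> carries the violation over to height \<open>l\<close>.\<close>

lemma u1_uniform_limit:
  assumes e: "e > 0"
  shows "\<exists>X. \<forall>x y. \<bar>x\<bar> \<ge> X \<longrightarrow> \<bar>y\<bar> \<le> B \<longrightarrow> \<bar>u1 (x, y)\<bar> \<le> e"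
proof (rule ccontr)
  assume "\<not> ?thesis"
  then have "\<forall>n::nat. \<exists>x y. \<bar>x\<bar> \<ge> real n \<and> \<bar>y\<bar> \<le> B \<and> \<bar>u1 (x, y)\<bar> > e"
    by (meson linorder_not_le)
  then obtain x y where xy: "\<And>n. \<bar>x n\<bar> \<ge> real n" "\<And>n. \<bar>y n\<bar> \<le> B" "\<And>n. \<bar>u1 (x n, y n)\<bar> > e"
    by metis
  have "Bseq y" by (rule BseqI'[of _ B]) (simp add: xy(2))
  then have "bounded (range y)" by (simp add: Bseq_eq_bounded)
  then obtain l r where r: "strict_mono (r :: nat \<Rightarrow> nat)" "(y \<circ> r) \<longlonglongrightarrow> l"
    using bounded_imp_convergent_subsequence by blast
  have "filterlim (\<lambda>n. x (r n)) at_infinity sequentially"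
    unfolding filterlim_at_infinity_conv_norm_at_top
  proof (rule filterlim_at_top_mono[OF filterlim_real_sequentially])
    show "\<forall>\<^sub>F n in sequentially. real n \<le> norm (x (r n))"
      using xy(1) seq_suble[OF r(1)] by (auto intro!: always_eventually intro: order_trans[OF of_nat_mono])
  qed
  then have 1: "(\<lambda>n. u1 (x (r n), l)) \<longlonglongrightarrow> 0"
    by (rule filterlim_compose[OF u1_lim])
  have "(\<lambda>n. \<bar>u1 (x (r n), l)\<bar> + bound * \<bar>y (r n) - l\<bar>) \<longlonglongrightarrow> \<bar>0\<bar> + bound * \<bar>l - l\<bar>"
    using r(2) by (intro tendsto_intros 1) (simp add: comp_def)
  moreover have "e \<le> \<bar>u1 (x (r n), l)\<bar> + bound * \<bar>y (r n) - l\<bar>" for n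
    using xy(3)[of "r n"] lipschitz_snd(2)[of "x (r n)" "y (r n)" l] by linarith
  ultimately have "e \<le> \<bar>0\<bar> + bound * \<bar>l - l\<bar>"
    by (intro tendsto_lowerbound[OF _ always_eventually]) auto
  then show False using e by simp
qed

text \<open>The local estimate passes smallness from \<open>u1\<close> to \<open>u11\<close>, at the
  price of a margin 2 in \<open>x\<close> and 1 in \<open>y\<close>.\<close>

lemma u11_uniform_limit:
  assumes e: "e > 0"
  shows "\<exists>X. \<forall>x y. \<bar>x\<bar> \<ge> X \<longrightarrow> \<bar>y\<bar> \<le> B \<longrightarrow> \<bar>u11 (x, y)\<bar> \<le> e"
proof -
  \<comment> \<open>Solves \<open>(4 + L) * m / 2 = e\<close>.\<close>
  define m where "m = 2 * e / (4 + L)"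
  have m: "m > 0" using e L_nonneg by (simp add: m_def)
  obtain X where X: "\<And>x y. \<bar>x\<bar> \<ge> X \<Longrightarrow> \<bar>y\<bar> \<le> B + 1 \<Longrightarrow> \<bar>u1 (x, y)\<bar> \<le> m"
    using u1_uniform_limit[OF m] by blast
  have "\<bar>u11 (x, y)\<bar> \<le> e" if "\<bar>x\<bar> \<ge> X + 2" "\<bar>y\<bar> \<le> B" for x y
  proof -
    have "\<bar>u11 (x, y)\<bar> \<le> (4 + L) * m / 2"
      by (rule derivative_u1_bound(1), rule X) (use that in linarith)+
    also have "\<dots> = e" using L_nonneg by (simp add: m_def)
    finally show ?thesis .
  qed
  then show ?thesis by blast
qed

lemma sequence_limits:
  assumes "filterlim a at_infinity sequentially"
  shows "(\<lambda>n. u1 (a n, t)) \<longlonglongrightarrow> 0"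
    and "e > 0 \<Longrightarrow> eventually (\<lambda>n. \<forall>t. \<bar>t\<bar> \<le> B \<longrightarrow> \<bar>u11 (a n, t)\<bar> \<le> e) sequentially"
proof -
  show "(\<lambda>n. u1 (a n, t)) \<longlonglongrightarrow> 0" by (rule filterlim_compose[OF u1_lim assms])
  assume "e > 0"
  then obtain X where X: "\<And>x y. \<bar>x\<bar> \<ge> X \<Longrightarrow> \<bar>y\<bar> \<le> B \<Longrightarrow> \<bar>u11 (x, y)\<bar> \<le> e"
    using u11_uniform_limit by blast
  have "eventually (\<lambda>n. X \<le> norm (a n)) sequentially"
    using assms unfolding filterlim_at_infinity_conv_norm_at_top filterlim_at_top by blast
  then show "eventually (\<lambda>n. \<forall>t. \<bar>t\<bar> \<le> B \<longrightarrow> \<bar>u11 (a n, t)\<bar> \<le> e) sequentially"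
    by eventually_elim (use X in auto)
qed

section \<open>Conserved moments\<close>

text \<open>\<open>T\<close> and \<open>u\<^sub>1 u\<^sub>2\<close> form the first row of the stress tensor, which is divergence free for solutions;
  the first moments of \<open>T\<close> are conserved because the flux \<open>\<integral> u\<^sub>1 u\<^sub>2\<close> vanishes.\<close>

definition T :: "real \<Rightarrow> real \<Rightarrow> real" where
  "T x t = (u1 (x, t))^2 / 2 - (u2 (x, t))^2 / 2 + F (u (x, t))"

text \<open>The squared weight times \<open>1 + |t|\<close>, the growth of the factor in a first
  moment. Its exponent is below -1 exactly because \<sigma> is positive.\<close>

definition dominator :: "real \<Rightarrow> real" where
  "dominator t = (1 + \<bar>t\<bar>) powr (- (1 + 2 * \<sigma>))"

lemma dominator_eq: "dominator t = (1 + \<bar>t\<bar>) * (weight \<sigma> t)^2"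
proof -
  have "(weight \<sigma> t)^2 = (1 + \<bar>t\<bar>) powr (- (1 + \<sigma>) + - (1 + \<sigma>))"
    by (simp only: power2_eq_square weight_def powr_add)
  then have "(1 + \<bar>t\<bar>) * (weight \<sigma> t)^2 = (1 + \<bar>t\<bar>) powr 1 * (1 + \<bar>t\<bar>) powr (- (1 + \<sigma>) + - (1 + \<sigma>))"
    by simp
  also have "\<dots> = dominator t" by (simp only: powr_add[symmetric] dominator_def) (simp add: algebra_simps)
  finally show ?thesis by simp
qed

lemma integrable_dominator: "integrable lborel dominator"
  using integrable_one_plus_abs_powr[of "- (1 + 2 * \<sigma>)"] sigma by (simp add: dominator_def[abs_def])

lemma weight_sq_le_dominator: "(weight \<sigma> t)^2 \<le> dominator t"
  unfolding dominator_eq by (simp add: mult_le_cancel_right1)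

lemma weighted_le_dominator:
  assumes "\<bar>g\<bar> \<le> c * (weight \<sigma> t)^2" "c \<ge> 0"
  shows "\<bar>(t - k) * g\<bar> \<le> c * (1 + \<bar>k\<bar>) * dominator t"
proof -
  have "\<bar>t - k\<bar> \<le> (1 + \<bar>k\<bar>) * (1 + \<bar>t\<bar>)"
  proof -
    have "0 \<le> \<bar>k\<bar> * \<bar>t\<bar>" by simp
    moreover have "(1 + \<bar>k\<bar>) * (1 + \<bar>t\<bar>) = 1 + \<bar>k\<bar> + \<bar>t\<bar> + \<bar>k\<bar> * \<bar>t\<bar>"
      by (simp add: algebra_simps)
    ultimately show ?thesis using abs_triangle_ineq4[of t k] by linarith
  qed
  then have "\<bar>t - k\<bar> * \<bar>g\<bar> \<le> ((1 + \<bar>k\<bar>) * (1 + \<bar>t\<bar>)) * (c * (weight \<sigma> t)^2)"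
    using assms by (intro mult_mono) auto
  also have "\<dots> = c * (1 + \<bar>k\<bar>) * dominator t" by (simp add: dominator_eq algebra_simps)
  finally show ?thesis by (simp add: abs_mult)
qed

lemma product_decay:
  assumes "\<bar>g\<bar> \<le> c * weight \<sigma> t" "\<bar>h\<bar> \<le> d * weight \<sigma> t" "c \<ge> 0"
  shows "\<bar>g * h\<bar> \<le> c * d * (weight \<sigma> t)^2"
proof -
  have "\<bar>g\<bar> * \<bar>h\<bar> \<le> (c * weight \<sigma> t) * (d * weight \<sigma> t)"
    using assms weight_pos[of \<sigma> t] by (intro mult_mono) auto
  then show ?thesis by (simp add: abs_mult power2_eq_square algebra_simps)
qed

lemma f_u_decay: "\<bar>f (u (x, t))\<bar> \<le> L * bound * weight \<sigma> t"
proof -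
  have "L * u (x, t) \<le> L * (bound * weight \<sigma> t)"
    using L_nonneg decay(1)[of x t] by (intro mult_left_mono) auto
  then show ?thesis using f_u_le[of "(x, t)"] by simp
qed

lemma T_decay: "\<bar>T x t\<bar> \<le> (1 + L) * bound^2 * (weight \<sigma> t)^2"
proof -
  let ?w = "bound * bound * (weight \<sigma> t)^2"
  note b = less_imp_le[OF bound_ge(4)]
  have "\<bar>u1 (x, t) * u1 (x, t)\<bar> \<le> ?w" "\<bar>u2 (x, t) * u2 (x, t)\<bar> \<le> ?w" "\<bar>u (x, t) * u (x, t)\<bar> \<le> ?w"
    by (intro product_decay decay b)+
  then have "(u1 (x, t))^2 \<le> ?w" "(u2 (x, t))^2 \<le> ?w" "(u (x, t))^2 \<le> ?w"
    by (simp_all add: power2_eq_square abs_le_iff)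
  moreover from this have "\<bar>F (u (x, t))\<bar> \<le> L * ?w"
    using F_u_le[of "(x, t)"] mult_left_mono[OF _ L_nonneg] order_trans by blast
  moreover have "0 \<le> (u1 (x, t))^2" "0 \<le> (u2 (x, t))^2" by simp_all
  ultimately have "\<bar>T x t\<bar> \<le> ?w + L * ?w" unfolding T_def by linarith
  also have "\<dots> = (1 + L) * bound^2 * (weight \<sigma> t)^2" by (simp add: power2_eq_square algebra_simps)
  finally show ?thesis .
qed

lemma T_continuous: "continuous_on A (T x)"
  unfolding T_def[abs_def] by (intro continuous_intros continuous_sections) auto

lemma T_measurable [measurable]: "T x \<in> borel_measurable borel"
  using T_continuous by (rule borel_measurable_continuous_onI)

lemma dF_u:
  "((\<lambda>x. F (u (x, t))) has_real_derivative f (u (x, t)) * u1 (x, t)) (at x)"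
  "((\<lambda>t. F (u (x, t))) has_real_derivative f (u (x, t)) * u2 (x, t)) (at t)"
  by (rule DERIV_chain2[OF F] du1 du2)+

lemma dT: "((\<lambda>x. T x t) has_real_derivative
    u1 (x, t) * u11 (x, t) - u2 (x, t) * u12 (x, t) + f (u (x, t)) * u1 (x, t)) (at x)"
  unfolding T_def by (auto intro!: derivative_eq_intros du11 du21 dF_u)

lemma u1u2_decay: "\<bar>u1 (x, t) * u2 (x, t)\<bar> \<le> bound^2 * (weight \<sigma> t)^2"
  unfolding power2_eq_square[of bound] by (intro product_decay decay less_imp_le[OF bound_ge(4)])

lemma dominator_tendsto_0: "(dominator \<longlongrightarrow> 0) at_top" "(dominator \<longlongrightarrow> 0) at_bot"
proof -
  have "2 * \<sigma> > 0" using sigma by simp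
  then have *: "(dominator \<longlongrightarrow> 0) at_top"
    using weight_tendsto_0[of "2 * \<sigma>"] by (simp add: weight_def[abs_def] dominator_def[abs_def])
  then show "(dominator \<longlongrightarrow> 0) at_top" .
  show "(dominator \<longlongrightarrow> 0) at_bot"
    unfolding at_bot_mirror filterlim_filtermap using * by (simp add: dominator_def[abs_def])
qed

lemma tendsto_0_of_dominator:
  assumes "\<And>t. \<bar>g t\<bar> \<le> c * dominator t"
  shows "(g \<longlongrightarrow> 0) at_top" "(g \<longlongrightarrow> 0) at_bot"
proof -
  have "((\<lambda>t. c * dominator t) \<longlongrightarrow> 0) at_top" "((\<lambda>t. c * dominator t) \<longlongrightarrow> 0) at_bot"
    using tendsto_mult_right_zero dominator_tendsto_0 by blast+
  then show "(g \<longlongrightarrow> 0) at_top" "(g \<longlongrightarrow> 0) at_bot"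
    using assms by (auto intro!: Lim_null_comparison[where g="\<lambda>t. c * dominator t"])
qed

text \<open>The second row of the stress tensor has density \<open>u1 u2\<close> and flux
  \<open>?B\<close>, so the integral does not depend on \<open>x\<close>; letting \<open>x\<close>
  tend to infinity, where \<open>u1\<close> vanishes, identifies it as 0.\<close>

lemma integral_u1u2: "integral\<^sup>L lborel (\<lambda>t. u1 (x, t) * u2 (x, t)) = 0"
proof -
  let ?A = "\<lambda>x t. u1 (x, t) * u2 (x, t)"
  let ?B = "\<lambda>x t. (u2 (x, t))^2 / 2 - (u1 (x, t))^2 / 2 + F (u (x, t))"
  let ?A1 = "\<lambda>x t. u11 (x, t) * u2 (x, t) + u1 (x, t) * u12 (x, t)"
  let ?B2 = "\<lambda>x t. u2 (x, t) * u22 (x, t) - u1 (x, t) * u12 (x, t) + f (u (x, t)) * u2 (x, t)"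
  \<comment> \<open>The largest of the four bounds is that of \<open>?B2\<close>: three products,
    one of them with a factor \<open>L\<close>.\<close>
  define C where "C = (2 + L) * bound^2"
  note b = less_imp_le[OF bound_ge(4)]
  have C: "bound^2 \<le> C" "2 * bound^2 \<le> C" "C \<ge> 0" "(1 + L) * bound^2 \<le> C"
    using L_nonneg by (auto simp: C_def algebra_simps)
  have dom: "\<bar>g\<bar> \<le> C * dominator t" if "\<bar>g\<bar> \<le> c * (weight \<sigma> t)^2" "c \<le> C" for g c t
    using that C(3) weight_sq_le_dominator[of t]
    by (meson mult_right_mono mult_left_mono order_trans zero_le_power2)
  have pd: "\<bar>g * h\<bar> \<le> bound^2 * (weight \<sigma> t)^2"
    if "\<bar>g\<bar> \<le> bound * weight \<sigma> t" "\<bar>h\<bar> \<le> bound * weight \<sigma> t" for g h t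
    using product_decay[OF that b] by (simp add: power2_eq_square)
  have const: "integral\<^sup>L lborel (?A x) = integral\<^sup>L lborel (?A y)" for x y
  proof (rule integral_independent_of_parameter[of ?A ?A1 ?B ?B2 "\<lambda>x t. 0" "\<lambda>t. C * dominator t"])
    show "((\<lambda>x. ?A x t) has_real_derivative ?A1 x t) (at x)" for x t
      by (auto intro!: derivative_eq_intros du11 du21)
    show "((\<lambda>t. ?B x t) has_real_derivative ?B2 x t) (at t)" for x t
      by (auto intro!: derivative_eq_intros du12 du22 dF_u)
    have "u11 p * u2 p + u1 p * u12 p + (u2 p * u22 p - u1 p * u12 p + f (u p) * u2 p) = 0" for p
    proof -
      have "u11 p * u2 p + u1 p * u12 p + (u2 p * u22 p - u1 p * u12 p + f (u p) * u2 p)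
          = u2 p * ((u11 p + u22 p) + f (u p))" by (simp add: algebra_simps)
      then show ?thesis by (simp add: pde)
    qed
    then show "?A1 x t + ?B2 x t = 0" for x t by blast
    show "integrable lborel (\<lambda>t. C * dominator t)" using integrable_dominator by simp
    show "\<bar>?A x t\<bar> \<le> C * dominator t" for x t by (rule dom[OF u1u2_decay C(1)])
    show "\<bar>?A1 x t\<bar> \<le> C * dominator t" for x t
      by (rule dom[of _ "2 * bound^2"])
        (use pd[OF decay(4) decay(3), of x t x] pd[OF decay(2) decay(5), of x t x] C in \<open>auto simp: abs_le_iff\<close>)
    show "\<bar>?B2 x t\<bar> \<le> C * dominator t" for x t
    proof (rule dom[of _ C])
      have "\<bar>f (u (x, t)) * u2 (x, t)\<bar> \<le> L * bound * bound * (weight \<sigma> t)^2"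
        using L_nonneg b by (intro product_decay f_u_decay decay) auto
      then show "\<bar>?B2 x t\<bar> \<le> C * (weight \<sigma> t)^2"
        using pd[OF decay(3) decay(6), of x t x] pd[OF decay(2) decay(5), of x t x]
        by (simp add: C_def power2_eq_square algebra_simps)
    qed simp
    have Bd: "\<bar>?B x t\<bar> \<le> C * dominator t" for x t
    proof (rule dom[OF _ C(4)])
      have "(u1 (x, t))^2 \<le> bound^2 * (weight \<sigma> t)^2" "(u2 (x, t))^2 \<le> bound^2 * (weight \<sigma> t)^2"
        "(u (x, t))^2 \<le> bound^2 * (weight \<sigma> t)^2"
        using pd[OF decay(2) decay(2), of x t x] pd[OF decay(3) decay(3), of x t x] pd[OF decay(1) decay(1), of x t x]
        by (simp_all add: power2_eq_square abs_le_iff)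
      moreover from this have "\<bar>F (u (x, t))\<bar> \<le> L * (bound^2 * (weight \<sigma> t)^2)"
        using F_u_le[of "(x, t)"] mult_left_mono[OF _ L_nonneg] order_trans by blast
      moreover have "0 \<le> (u1 (x, t))^2" "0 \<le> (u2 (x, t))^2" by simp_all
      ultimately have "\<bar>?B x t\<bar> \<le> bound^2 * (weight \<sigma> t)^2 + L * (bound^2 * (weight \<sigma> t)^2)" by linarith
      then show "\<bar>?B x t\<bar> \<le> (1 + L) * bound^2 * (weight \<sigma> t)^2" by (simp add: algebra_simps)
    qed
    show "(?B x \<longlongrightarrow> 0) at_top" "(?B x \<longlongrightarrow> 0) at_bot" for x
      by (rule tendsto_0_of_dominator, rule Bd)+
  qed (auto intro!: continuous_intros continuous_sections)
  have "(\<lambda>n. integral\<^sup>L lborel (?A (real n))) \<longlonglongrightarrow> integral\<^sup>L lborel (\<lambda>t::real. 0 :: real)"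
  proof (rule integral_dominated_convergence[where w="\<lambda>t. C * dominator t"])
    show "?A (real n) \<in> borel_measurable lborel" for n
      by (auto intro!: borel_measurable_continuous_onI continuous_intros continuous_sections)
    show "AE t in lborel. (\<lambda>n. ?A (real n) t) \<longlonglongrightarrow> 0"
    proof (rule AE_I2)
      fix t
      have "filterlim real at_infinity sequentially"
        using filterlim_real_sequentially filterlim_mono[OF _ at_top_le_at_infinity order_refl] by blast
      then have "(\<lambda>n. u1 (real n, t)) \<longlonglongrightarrow> 0" by (rule sequence_limits)
      then have "(\<lambda>n. bound * u1 (real n, t)) \<longlonglongrightarrow> 0" by (rule tendsto_mult_right_zero)
      then show "(\<lambda>n. ?A (real n) t) \<longlonglongrightarrow> 0"
      proof (rule Lim_null_comparison[OF always_eventually, OF allI, rotated, OF tendsto_rabs_zero])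
        show "norm (?A (real n) t) \<le> \<bar>bound * u1 (real n, t)\<bar>" for n
          using mult_left_mono[OF bounded(3)[of "(real n, t)"], of "\<bar>u1 (real n, t)\<bar>"] b
          by (simp add: abs_mult mult.commute)
      qed
    qed
    show "AE t in lborel. norm (?A (real n) t) \<le> C * dominator t" for n
      using dom[OF u1u2_decay C(1)] by (intro AE_I2) auto
  qed (use integrable_dominator in auto)
  moreover have "(\<lambda>n. integral\<^sup>L lborel (?A (real n))) = (\<lambda>n. integral\<^sup>L lborel (?A x))"
    by (intro ext const)
  ultimately show ?thesis by (simp add: LIMSEQ_const_iff)
qed

definition moment :: "real \<Rightarrow> real \<Rightarrow> real" where
  "moment k x = integral\<^sup>L lborel (\<lambda>t. (t - k) * T x t)"

lemma moment_bound: "\<bar>(t - k) * T x t\<bar> \<le> (1 + L) * bound^2 * (1 + \<bar>k\<bar>) * dominator t"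
  using weighted_le_dominator[OF T_decay] L_nonneg by simp

text \<open>The flux of \<open>(t - k) * T\<close> is \<open>(t - k) * u1 * u2\<close>;
  differentiating the factor \<open>t - k\<close> leaves the source \<open>u1 * u2\<close>, which
  integrates to 0 by \<open>integral_u1u2\<close>.\<close>

lemma moment_const: "moment k x = moment k y"
proof -
  let ?A = "\<lambda>x t. (t - k) * T x t"
  let ?A1 = "\<lambda>x t. (t - k) * (u1 (x, t) * u11 (x, t) - u2 (x, t) * u12 (x, t) + f (u (x, t)) * u1 (x, t))"
  let ?B = "\<lambda>x t. (t - k) * (u1 (x, t) * u2 (x, t))"
  let ?B2 = "\<lambda>x t. u1 (x, t) * u2 (x, t) + (t - k) * (u12 (x, t) * u2 (x, t) + u1 (x, t) * u22 (x, t))"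
  define C where "C = (3 + L) * bound^2 * (1 + \<bar>k\<bar>)"
  note b = less_imp_le[OF bound_ge(4)]
  have dn: "dominator t \<ge> 0" for t by (simp add: dominator_def)
  have C: "c * (1 + \<bar>k\<bar>) * dominator t \<le> C * dominator t" if "c \<le> (3 + L) * bound^2" for c t
    unfolding C_def by (intro mult_right_mono that) (auto simp: dn)
  have pd: "\<bar>g * h\<bar> \<le> bound^2 * (weight \<sigma> t)^2"
    if "\<bar>g\<bar> \<le> bound * weight \<sigma> t" "\<bar>h\<bar> \<le> bound * weight \<sigma> t" for g h t
    using product_decay[OF that b] by (simp add: power2_eq_square)
  have "integral\<^sup>L lborel (?A x) = integral\<^sup>L lborel (?A y)"
  proof (rule integral_independent_of_parameter[of ?A ?A1 ?B ?B2
        "\<lambda>x t. u1 (x, t) * u2 (x, t)" "\<lambda>t. C * dominator t"])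
    show "((\<lambda>x. ?A x t) has_real_derivative ?A1 x t) (at x)" for x t
      by (rule DERIV_cmult[OF dT])
    show "((\<lambda>t. ?B x t) has_real_derivative ?B2 x t) (at t)" for x t
      by (auto intro!: derivative_eq_intros du12 du22 simp: algebra_simps)
    show "?A1 x t + ?B2 x t = u1 (x, t) * u2 (x, t)" for x t
    proof -
      have "?A1 x t + ?B2 x t = u1 (x, t) * u2 (x, t) +
          (t - k) * u1 (x, t) * ((u11 (x, t) + u22 (x, t)) + f (u (x, t)))"
        by (simp add: algebra_simps)
      then show ?thesis by (simp add: pde)
    qed
    show "integrable lborel (\<lambda>t. C * dominator t)" using integrable_dominator by simp
    show "\<bar>?A x t\<bar> \<le> C * dominator t" for x t
      using moment_bound[of t k x] C[of "(1 + L) * bound^2" t] by (simp add: mult_right_mono)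
    show "\<bar>?A1 x t\<bar> \<le> C * dominator t" for x t
    proof -
      have "\<bar>f (u (x, t)) * u1 (x, t)\<bar> \<le> L * bound * bound * (weight \<sigma> t)^2"
        using L_nonneg b by (intro product_decay f_u_decay decay) auto
      then have "\<bar>u1 (x, t) * u11 (x, t) - u2 (x, t) * u12 (x, t) + f (u (x, t)) * u1 (x, t)\<bar>
          \<le> (2 + L) * bound^2 * (weight \<sigma> t)^2"
        using pd[OF decay(2) decay(4), of x t x] pd[OF decay(3) decay(5), of x t x]
        by (simp add: power2_eq_square algebra_simps)
      then have "\<bar>?A1 x t\<bar> \<le> (2 + L) * bound^2 * (1 + \<bar>k\<bar>) * dominator t"
        using L_nonneg by (intro weighted_le_dominator) auto
      also have "\<dots> \<le> C * dominator t" by (rule C) (simp add: mult_right_mono)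
      finally show ?thesis .
    qed
    show "\<bar>?B2 x t\<bar> \<le> C * dominator t" for x t
    proof -
      have 1: "\<bar>u12 (x, t) * u2 (x, t) + u1 (x, t) * u22 (x, t)\<bar> \<le> 2 * bound^2 * (weight \<sigma> t)^2"
        using pd[OF decay(5) decay(3), of x t x] pd[OF decay(2) decay(6), of x t x] by simp
      have "\<bar>(t - k) * (u12 (x, t) * u2 (x, t) + u1 (x, t) * u22 (x, t))\<bar> \<le> 2 * bound^2 * (1 + \<bar>k\<bar>) * dominator t"
        by (rule weighted_le_dominator[OF 1]) simp
      moreover have "\<bar>u1 (x, t) * u2 (x, t)\<bar> \<le> bound^2 * (1 + \<bar>k\<bar>) * dominator t"
      proof -
        have "bound^2 * (weight \<sigma> t)^2 \<le> bound^2 * dominator t"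
          using weight_sq_le_dominator by (intro mult_left_mono) auto
        also have "\<dots> \<le> bound^2 * (1 + \<bar>k\<bar>) * dominator t"
          using dn[of t] by (simp add: algebra_simps)
        finally show ?thesis using u1u2_decay[of x t] by simp
      qed
      ultimately have "\<bar>?B2 x t\<bar> \<le> 3 * bound^2 * (1 + \<bar>k\<bar>) * dominator t" by linarith
      also have "\<dots> \<le> C * dominator t" by (rule C) (use L_nonneg in \<open>simp add: mult_right_mono\<close>)
      finally show ?thesis .
    qed
    have "\<bar>?B x t\<bar> \<le> bound^2 * (1 + \<bar>k\<bar>) * dominator t" for x t
      by (rule weighted_le_dominator[OF u1u2_decay]) simp
    then show "(?B x \<longlongrightarrow> 0) at_top" "(?B x \<longlongrightarrow> 0) at_bot" for x
      by (rule tendsto_0_of_dominator)+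
    show "integral\<^sup>L lborel (\<lambda>t. u1 (x, t) * u2 (x, t)) = 0" for x by (rule integral_u1u2)
  qed (auto intro!: continuous_intros continuous_sections T_continuous)
  then show ?thesis by (simp add: moment_def)
qed

lemma integrable_moment: "integrable lborel (\<lambda>t. (t - k) * T x t)"
proof (rule Bochner_Integration.integrable_bound)
  show "integrable lborel (\<lambda>t. (1 + L) * bound^2 * (1 + \<bar>k\<bar>) * dominator t)"
    using integrable_dominator by simp
  show "AE t in lborel. norm ((t - k) * T x t) \<le> norm ((1 + L) * bound^2 * (1 + \<bar>k\<bar>) * dominator t)"
    using moment_bound by (intro AE_I2) (auto intro: order_trans[OF _ abs_ge_self])
qed simp

definition energy :: "real \<Rightarrow> real" where
  "energy x = integral\<^sup>L lborel (T x)"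

lemma moment_diff: "moment k x - moment k' x = (k' - k) * energy x"
proof -
  have "moment k x - moment k' x = integral\<^sup>L lborel (\<lambda>t. (t - k) * T x t - (t - k') * T x t)"
    unfolding moment_def using integrable_moment by simp
  also have "(\<lambda>t. (t - k) * T x t - (t - k') * T x t) = (\<lambda>t. (k' - k) * T x t)"
    by (simp add: algebra_simps)
  finally show ?thesis by (simp add: energy_def)
qed

text \<open>The energy is the difference of the conserved moments about 0 and 1.\<close>

lemma energy_const: "energy x = energy y"
  using moment_diff[of 0 x 1] moment_diff[of 0 y 1] moment_const[of 0 x y] moment_const[of 1 x y] by simp

section \<open>Moving planes\<close>

definition dominates :: "real \<Rightarrow> bool" where
  "dominates k \<longleftrightarrow> (\<forall>x y. y \<ge> k \<longrightarrow> u (x, y) \<le> u (x, 2 * k - y))"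

lemma lap_reflected: "has_lap (\<lambda>p. u (fst p, 2 * k - snd p)) (\<lambda>p. - f (u (fst p, 2 * k - snd p)))"
  using has_lap_affine[OF lap_u, of 1 "-1" 0 "2 * k"] by simp

text \<open>Where \<open>u\<close> exceeds its reflection, both values are below
  \<open>\<epsilon> / 2\<close> by hypothesis, so monotonicity of \<open>f\<close> makes the
  difference subharmonic there and \<open>weak_max_principle_half_plane\<close> applies. Thus only
  points where \<open>u\<close> is large have to be checked.\<close>

lemma dominatesI:
  assumes "\<And>x y. y \<ge> k \<Longrightarrow> u (x, y) \<ge> \<epsilon> / 2 \<Longrightarrow> u (x, y) \<le> u (x, 2 * k - y)"
  shows "dominates k"
proof -
  have "u p - u (fst p, 2 * k - snd p) \<le> 0" if "snd p \<ge> k" for p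
  proof (rule weak_max_principle_half_plane[OF has_lap_diff[OF lap_u lap_reflected] _ _ _ _ that, where B=K])
    show "u p - u (fst p, 2 * k - snd p) \<le> K" for p
      using u_le_K[of p] u_pos[of "(fst p, 2 * k - snd p)"] by linarith
    show "\<exists>R. \<forall>x y. y \<ge> R \<longrightarrow> u (x, y) - u (fst (x, y), 2 * k - snd (x, y)) \<le> \<eta>" if e: "\<eta> > 0" for \<eta>
    proof -
      obtain R where R: "R > 0" "\<And>t. \<bar>t\<bar> \<ge> R \<Longrightarrow> K * weight \<sigma> t < \<eta>"
        using weight_small[OF sigma e] by blast
      have "u (x, y) - u (x, 2 * k - y) \<le> \<eta>" if "y \<ge> R" for x y
      proof -
        have "\<bar>y\<bar> \<ge> R" using that R(1) by simp
        then have "K * weight \<sigma> y < \<eta>" by (rule R(2))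
        then show ?thesis using u_le[of x y] u_pos[of "(x, 2 * k - y)"] by linarith
      qed
      then show ?thesis by auto
    qed
    show "- f (u p) - - f (u (fst p, 2 * k - snd p)) \<ge> 0"
      if p: "snd p > k" "u p - u (fst p, 2 * k - snd p) > 0" for p
    proof -
      have "u p < \<epsilon> / 2" using assms[of "snd p" "fst p"] p by force
      then have "f (u p) \<le> f (u (fst p, 2 * k - snd p))"
        using p u_pos[of "(fst p, 2 * k - snd p)"] eps by (intro f_antimono) auto
      then show ?thesis by simp
    qed
  qed auto
  then show ?thesis by (force simp: dominates_def)
qed

text \<open>Far up \<open>u\<close> never reaches \<open>\<epsilon> / 2\<close>, so the criterion of
  \<open>dominatesI\<close> holds vacuously.\<close>

lemma dominates_large: "\<exists>R. \<forall>k\<ge>R. dominates k"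
proof -
  obtain R where R: "R > 0" "\<And>t. \<bar>t\<bar> \<ge> R \<Longrightarrow> K * weight \<sigma> t < \<epsilon> / 2"
    using weight_small[OF sigma, of "\<epsilon> / 2"] eps by auto
  have "dominates k" if "k \<ge> R" for k
  proof (rule dominatesI)
    fix x y assume y: "y \<ge> k" "u (x, y) \<ge> \<epsilon> / 2"
    have "\<bar>y\<bar> \<ge> R" using that R(1) y by simp
    then have "K * weight \<sigma> y < \<epsilon> / 2" by (rule R(2))
    then show "u (x, y) \<le> u (x, 2 * k - y)" using y u_le[of x y] by linarith
  qed
  then show ?thesis by blast
qed

lemma not_dominates_small: "\<exists>k. \<not> dominates k"
proof -
  obtain R where R: "R > 0" "\<And>t. \<bar>t\<bar> \<ge> R \<Longrightarrow> K * weight \<sigma> t < u (0, 0)"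
    using weight_small[OF sigma u_pos] by blast
  \<comment> \<open>Reflection about \<open>- R\<close> takes height 0 to \<open>- 2 * R\<close>,
    where \<open>u\<close> is below its value at the origin.\<close>
  have "K * weight \<sigma> (2 * (- R) - 0) < u (0, 0)" by (rule R(2)) (use R(1) in simp)
  then have "u (0, 2 * (- R) - 0) < u (0, 0)" using u_le[of 0 "2 * (- R) - 0"] by linarith
  then have "\<not> dominates (- R)" unfolding dominates_def using R(1) by (meson less_le_not_le neg_le_0_iff_le)
  then show ?thesis by blast
qed

text \<open>Take the supremum of the failing positions: everything above it dominates, continuity
  adds the supremum itself, and failures accumulate from below.\<close>

lemma critical_position:
  obtains k where "dominates k" "\<And>\<delta>. \<delta> > 0 \<Longrightarrow> \<exists>k'. k - \<delta> < k' \<and> k' < k \<and> \<not> dominates k'"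
proof -
  define N where "N = {k. \<not> dominates k}"
  define k where "k = Sup N"
  obtain R where R: "\<And>k. k \<ge> R \<Longrightarrow> dominates k" using dominates_large by blast
  have ne: "N \<noteq> {}" using not_dominates_small by (auto simp: N_def)
  have bdd: "bdd_above N"
    by (rule bdd_aboveI[of _ R]) (metis N_def R linorder_le_cases mem_Collect_eq)
  have above: "dominates k'" if "k' > k" for k'
    using that cSup_upper[OF _ bdd] unfolding k_def N_def by fastforce
  have dk: "dominates k"
    unfolding dominates_def
  proof (intro allI impI)
    fix x y assume y: "y \<ge> k"
    show "u (x, y) \<le> u (x, 2 * k - y)"
    proof (cases "y = k")
      case False
      then have yk: "y > k" using y by simp
      have "isCont (\<lambda>k. u (x, 2 * k - y)) k"
        by (rule isCont_o2[where f="\<lambda>k. 2 * k - y" and g="\<lambda>t. u (x, t)"])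
          (auto intro!: DERIV_isCont[OF du2])
      then have "((\<lambda>k. u (x, 2 * k - y)) \<longlongrightarrow> u (x, 2 * k - y)) (at_right k)"
        unfolding isCont_def by (rule tendsto_mono[OF at_le, rotated]) simp
      moreover have "eventually (\<lambda>k'. u (x, y) \<le> u (x, 2 * k' - y)) (at_right k)"
        unfolding eventually_at_right_field
        using yk above by (intro exI[of _ y]) (auto simp: dominates_def)
      ultimately show ?thesis by (rule tendsto_lowerbound) simp
    qed simp
  qed
  have "\<exists>k'. k - \<delta> < k' \<and> k' < k \<and> \<not> dominates k'" if \<delta>: "\<delta> > 0" for \<delta>
  proof -
    obtain k' where k': "k' \<in> N" "k - \<delta> < k'"
      using less_cSup_iff[OF ne bdd, of "k - \<delta>"] \<delta> unfolding k_def by auto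
    then have "k' \<le> k" "k' \<noteq> k" using cSup_upper[OF _ bdd] dk by (auto simp: k_def N_def)
    then show ?thesis using k' by (auto simp: N_def)
  qed
  then show ?thesis using that dk by blast
qed

section \<open>Contact at the critical position\<close>

text \<open>The sign is such that domination makes it nonnegative above \<open>k\<close>; the ODE
  argument uses it on the whole line.\<close>

definition defect :: "real \<Rightarrow> real \<Rightarrow> real \<Rightarrow> real" where
  "defect k x t = u (x, 2 * k - t) - u (x, t)"

definition defect' :: "real \<Rightarrow> real \<Rightarrow> real \<Rightarrow> real" where
  "defect' k x t = - u2 (x, 2 * k - t) - u2 (x, t)"

definition defect'' :: "real \<Rightarrow> real \<Rightarrow> real \<Rightarrow> real" where
  "defect'' k x t = u22 (x, 2 * k - t) - u22 (x, t)"

lemma d_defect: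
  "(defect k x has_real_derivative defect' k x t) (at t)"
  "(defect' k x has_real_derivative defect'' k x t) (at t)"
proof -
  have 1: "((\<lambda>t. 2 * k - t) has_real_derivative - 1) (at t)" by (auto intro!: derivative_eq_intros)
  show "(defect k x has_real_derivative defect' k x t) (at t)"
    unfolding defect_def[abs_def] defect'_def
    by (rule DERIV_cong[OF DERIV_diff[OF DERIV_chain2[OF du2 1] du2]]) simp
  show "(defect' k x has_real_derivative defect'' k x t) (at t)"
    unfolding defect'_def[abs_def] defect''_def
    by (rule DERIV_cong[OF DERIV_diff[OF DERIV_minus[OF DERIV_chain2[OF du22 1]] du22]]) simp
qed

lemma defect_lipschitz:
  "\<bar>defect k x s - defect k x t\<bar> \<le> 2 * bound * \<bar>s - t\<bar>"
  "\<bar>defect' k x s - defect' k x t\<bar> \<le> 2 * bound * \<bar>s - t\<bar>"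
proof -
  have e: "\<bar>(2 * k - s) - (2 * k - t)\<bar> = \<bar>s - t\<bar>" by simp
  show "\<bar>defect k x s - defect k x t\<bar> \<le> 2 * bound * \<bar>s - t\<bar>"
    using lipschitz_snd(1)[of x s t] lipschitz_snd(1)[of x "2 * k - s" "2 * k - t"]
    unfolding e defect_def abs_le_iff by linarith
  show "\<bar>defect' k x s - defect' k x t\<bar> \<le> 2 * bound * \<bar>s - t\<bar>"
    using lipschitz_snd(3)[of x s t] lipschitz_snd(3)[of x "2 * k - s" "2 * k - t"]
    unfolding e defect'_def abs_le_iff by linarith
qed

lemma defect_nonneg: "dominates k \<Longrightarrow> t \<ge> k \<Longrightarrow> defect k x t \<ge> 0"
  by (simp add: dominates_def defect_def)

lemma defect_at_axis: "defect k x k = 0" "defect' k x k = - 2 * u2 (x, k)"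
  by (simp_all add: defect_def defect'_def)

text \<open>At failing positions tending to \<open>k\<close> from below, \<open>dominatesI\<close>
  yields violating points with \<open>u\<close> at least \<open>\<epsilon> / 2\<close>. Decay bounds
  their heights, so a subsequence has heights tending to \<open>y\<close>; nothing is claimed about
  the abscissae \<open>a n\<close>.\<close>

lemma critical_sequence:
  assumes dk: "dominates k"
    and crit: "\<And>\<delta>. \<delta> > 0 \<Longrightarrow> \<exists>k'. k - \<delta> < k' \<and> k' < k \<and> \<not> dominates k'"
  obtains a b y where "y \<ge> k" "b \<longlonglongrightarrow> y" "\<And>n::nat. u (a n, b n) \<ge> \<epsilon> / 2"
    "(\<lambda>n. defect k (a n) y) \<longlonglongrightarrow> 0" "(\<lambda>n. defect' k (a n) y) \<longlonglongrightarrow> 0"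
proof -
  have "\<exists>k' x t. k - 1 / real (Suc n) < k' \<and> k' < k \<and> t \<ge> k' \<and> u (x, t) \<ge> \<epsilon> / 2 \<and>
      u (x, t) > u (x, 2 * k' - t)" for n
  proof -
    obtain k' where k': "k - 1 / real (Suc n) < k'" "k' < k" "\<not> dominates k'"
      using crit[of "1 / real (Suc n)"] by auto
    then show ?thesis using dominatesI[of k'] by (meson linorder_not_le)
  qed
  then obtain k' a' b' where s: "\<And>n. k - 1 / real (Suc n) < k' n" "\<And>n. k' n < k" "\<And>n. b' n \<ge> k' n"
    "\<And>n. u (a' n, b' n) \<ge> \<epsilon> / 2" "\<And>n. u (a' n, b' n) > u (a' n, 2 * k' n - b' n)"
    by metis
  obtain R where R: "R > 0" "\<And>t. \<bar>t\<bar> \<ge> R \<Longrightarrow> K * weight \<sigma> t < \<epsilon> / 2"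
    using weight_small[OF sigma, of "\<epsilon> / 2"] eps by auto
  have bR: "\<bar>b' n\<bar> \<le> R" for n
    using R(2)[of "b' n"] s(4)[of n] u_le[of "a' n" "b' n"] by linarith
  have "Bseq b'" by (rule BseqI'[of _ R]) (simp add: bR)
  then have "bounded (range b')" by (simp add: Bseq_eq_bounded)
  then obtain y r where r: "strict_mono (r :: nat \<Rightarrow> nat)" "(b' \<circ> r) \<longlonglongrightarrow> y"
    using bounded_imp_convergent_subsequence by blast
  have k'_lim: "k' \<longlonglongrightarrow> k"
  proof (rule tendsto_sandwich[of "\<lambda>n. k - 1 / real (Suc n)" _ _ "\<lambda>n. k"])
    have "(\<lambda>n. 1 / real (Suc n)) \<longlonglongrightarrow> 0" using LIMSEQ_Suc[OF lim_1_over_n] by simp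
    then have "(\<lambda>n. k - 1 / real (Suc n)) \<longlonglongrightarrow> k - 0" by (intro tendsto_intros)
    then show "(\<lambda>n. k - 1 / real (Suc n)) \<longlonglongrightarrow> k" by simp
  qed (use s(1,2) in \<open>auto intro!: always_eventually less_imp_le\<close>)
  define a where "a = a' \<circ> r"
  define b where "b = b' \<circ> r"
  define m where "m = k' \<circ> r"
  have m: "m \<longlonglongrightarrow> k" unfolding m_def by (rule LIMSEQ_subseq_LIMSEQ[OF k'_lim r(1)])
  have b: "b \<longlonglongrightarrow> y" using r(2) by (simp add: b_def)
  have s': "\<And>n. b n \<ge> m n" "\<And>n. u (a n, b n) \<ge> \<epsilon> / 2" "\<And>n. u (a n, b n) > u (a n, 2 * m n - b n)"
    "\<And>n. m n < k"
    using s by (auto simp: a_def b_def m_def)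
  have yk: "y \<ge> k" using LIMSEQ_le[OF m b] s'(1) by blast
  \<comment> \<open>Failure at \<open>m n\<close> makes the defect about \<open>m n\<close> negative
    at height \<open>b n\<close>; the Lipschitz bounds transfer this to the defect about
    \<open>k\<close> at height \<open>y\<close>, up to errors tending to 0.\<close>
  have d0: "(\<lambda>n. defect k (a n) y) \<longlonglongrightarrow> 0"
  proof (rule tendsto_sandwich[of "\<lambda>n. 0" _ _ "\<lambda>n. bound * (2 * \<bar>k - m n\<bar>) + 2 * bound * \<bar>y - b n\<bar>"])
    show "\<forall>\<^sub>F n in sequentially. 0 \<le> defect k (a n) y"
      using defect_nonneg[OF dk yk] by (intro always_eventually) auto
    show "\<forall>\<^sub>F n in sequentially. defect k (a n) y \<le> bound * (2 * \<bar>k - m n\<bar>) + 2 * bound * \<bar>y - b n\<bar>"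
    proof (intro always_eventually allI)
      fix n
      have "defect k (a n) (b n) \<le> u (a n, 2 * k - b n) - u (a n, 2 * m n - b n)"
        using s'(3)[of n] by (simp add: defect_def)
      also have "\<dots> \<le> bound * \<bar>(2 * k - b n) - (2 * m n - b n)\<bar>"
        using lipschitz_snd(1) abs_ge_self order_trans by blast
      also have "\<bar>(2 * k - b n) - (2 * m n - b n)\<bar> = 2 * \<bar>k - m n\<bar>" by (simp add: abs_if)
      finally show "defect k (a n) y \<le> bound * (2 * \<bar>k - m n\<bar>) + 2 * bound * \<bar>y - b n\<bar>"
        using defect_lipschitz(1)[of k "a n" y "b n"] by linarith
    qed
    have "(\<lambda>n. bound * (2 * \<bar>k - m n\<bar>) + 2 * bound * \<bar>y - b n\<bar>) \<longlonglongrightarrow>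
        bound * (2 * \<bar>k - k\<bar>) + 2 * bound * \<bar>y - y\<bar>"
      by (intro tendsto_intros m b)
    then show "(\<lambda>n. bound * (2 * \<bar>k - m n\<bar>) + 2 * bound * \<bar>y - b n\<bar>) \<longlonglongrightarrow> 0" by simp
  qed simp
  have d1: "(\<lambda>n. defect' k (a n) y) \<longlonglongrightarrow> 0"
  \<comment> \<open>For \<open>y = k\<close> the slope \<open>- 2 * u2\<close> is squeezed by signs:
    domination at \<open>k\<close> makes \<open>u2\<close> nonpositive on the plane, while failure
    at \<open>m n\<close> makes it positive at a nearby height \<open>z\<close>. For
    \<open>y > k\<close> the defect is nonnegative on a neighbourhood and
    \<open>derivative_bound_of_nonneg\<close> applies.\<close>
  proof (cases "y = k")
    case True
    show ?thesis
    proof (rule Lim_null_comparison)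
      show "\<forall>\<^sub>F n in sequentially. norm (defect' k (a n) y) \<le> 2 * bound * (2 * \<bar>m n - k\<bar> + \<bar>b n - k\<bar>)"
      proof (intro always_eventually allI)
        fix n
        \<comment> \<open>With \<open>m n = b n\<close> both sides of the violated inequality would
          coincide.\<close>
        have "m n < b n" using s'(1)[of n] s'(3)[of n] by (cases "m n = b n") auto
        then obtain z where z: "2 * m n - b n < z" "z < b n"
          "u (a n, b n) - u (a n, 2 * m n - b n) = (b n - (2 * m n - b n)) * u2 (a n, z)"
          using MVT2[of "2 * m n - b n" "b n" "\<lambda>t. u (a n, t)" "\<lambda>t. u2 (a n, t)"] du2 by auto
        have "(b n - (2 * m n - b n)) * u2 (a n, z) > 0" using s'(3)[of n] z(3) by linarith
        then have "u2 (a n, z) > 0" using z by (simp add: zero_less_mult_iff)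
        moreover have "u2 (a n, k) \<le> 0"
        proof (rule ccontr)
          assume pos: "\<not> u2 (a n, k) \<le> 0"
          then have "defect' k (a n) k < 0" by (simp add: defect_at_axis)
          then obtain e where e: "e > 0" "\<And>h. h > 0 \<Longrightarrow> h < e \<Longrightarrow> defect k (a n) (k + h) < defect k (a n) k"
            using DERIV_neg_dec_right[OF d_defect(1)] by blast
          show False
            using e(2)[of "e / 2"] e(1) defect_nonneg[OF dk, of "k + e / 2" "a n"] by (simp add: defect_at_axis)
        qed
        moreover have "\<bar>k - z\<bar> \<le> 2 * \<bar>m n - k\<bar> + \<bar>b n - k\<bar>" using z(1,2) by (auto simp: abs_if)
        then have "bound * \<bar>k - z\<bar> \<le> bound * (2 * \<bar>m n - k\<bar> + \<bar>b n - k\<bar>)"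
          using bound_ge(4) by (intro mult_left_mono) auto
        moreover have "\<bar>u2 (a n, k) - u2 (a n, z)\<bar> \<le> bound * \<bar>k - z\<bar>" by (rule lipschitz_snd)
        ultimately have "\<bar>u2 (a n, k)\<bar> \<le> bound * (2 * \<bar>m n - k\<bar> + \<bar>b n - k\<bar>)" by linarith
        then show "norm (defect' k (a n) y) \<le> 2 * bound * (2 * \<bar>m n - k\<bar> + \<bar>b n - k\<bar>)"
          using True by (simp add: defect_at_axis abs_mult)
      qed
      have "(\<lambda>n. 2 * bound * (2 * \<bar>m n - k\<bar> + \<bar>b n - k\<bar>)) \<longlonglongrightarrow> 2 * bound * (2 * \<bar>k - k\<bar> + \<bar>y - k\<bar>)"
        by (intro tendsto_intros m b)
      then show "(\<lambda>n. 2 * bound * (2 * \<bar>m n - k\<bar> + \<bar>b n - k\<bar>)) \<longlonglongrightarrow> 0" using True by simp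
    qed
  next
    case False
    then have yk': "y > k" using yk by simp
    show ?thesis
    proof (rule LIMSEQ_I)
      fix e :: real assume e: "e > 0"
      \<comment> \<open>The first bound keeps the interval in \<open>t \<ge> k\<close>, the second
        makes the variation of the slope at most \<open>e / 2\<close>.\<close>
      define q where "q = min (y - k) (e / (4 * bound))"
      have q: "q > 0" "q \<le> y - k" "2 * bound * q \<le> e / 2"
      proof -
        show "q > 0" "q \<le> y - k" using yk' e bound_ge(4) by (auto simp: q_def)
        have "q \<le> e / (4 * bound)" by (simp add: q_def)
        then show "2 * bound * q \<le> e / 2" using bound_ge(4) by (simp add: field_simps)
      qed
      have "q * e / 2 > 0" using q e by simp
      then obtain N where N: "\<And>n. n \<ge> N \<Longrightarrow> norm (defect k (a n) y - 0) < q * e / 2"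
        using LIMSEQ_D[OF d0] by blast
      have "norm (defect' k (a n) y - 0) < e" if "n \<ge> N" for n
      proof -
        have "\<bar>defect' k (a n) y\<bar> \<le> defect k (a n) y / q + 2 * bound * q"
        proof (rule derivative_bound_of_nonneg[OF d_defect(1) _ defect_lipschitz(2) q(1)])
          show "0 \<le> defect k (a n) t" if "\<bar>t - y\<bar> \<le> q" for t
            by (rule defect_nonneg[OF dk]) (use that q in \<open>auto simp: abs_if split: if_splits\<close>)
        qed (use bound_ge(4) in simp)
        moreover have "defect k (a n) y / q < e / 2"
          using N[OF that] q by (simp add: divide_less_eq mult.commute abs_if split: if_splits)
        ultimately show ?thesis using q(3) unfolding real_norm_def diff_zero by linarith
      qed
      then show "\<exists>N. \<forall>n\<ge>N. norm (defect' k (a n) y - 0) < e" by blast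
    qed
  qed
  show ?thesis using that[OF yk b s'(2) d0 d1] .
qed

text \<open>Since \<open>f\<close> is Lipschitz and \<open>v\<close> nonnegative,
  \<open>l \<le> L * v\<close>. If \<open>v\<close> were positive anywhere, it would be positive in
  the open half plane with positive normal derivative wherever it vanishes on the boundary, against
  the first touching condition for \<open>y > k\<close> and the second for
  \<open>y = k\<close>.\<close>

lemma symmetric_of_touching:
  assumes dk: "dominates k" and y: "y \<ge> k" and z: "defect k a y = 0" "defect' k a y = 0"
  shows "u (x, 2 * k - t) = u (x, t)"
proof -
  define v where "v p = u (fst p, 2 * k - snd p) - u p" for p
  define l where "l p = - f (u (fst p, 2 * k - snd p)) - - f (u p)" for p
  have lap: "has_lap v l" unfolding v_def l_def by (rule has_lap_diff[OF lap_reflected lap_u])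
  have nn: "v p \<ge> 0" if "snd p \<ge> k" for p
    using dk that unfolding dominates_def v_def by (metis diff_ge_0_iff_ge prod.collapse)
  have lv: "l p \<le> L * v p" if "snd p \<ge> k" for p
    using f_u_diff[of p "(fst p, 2 * k - snd p)"] nn[OF that] unfolding l_def v_def by simp
  have v0: "v p = 0" if p: "snd p \<ge> k" for p
  proof (rule ccontr)
    assume "v p \<noteq> 0"
    then have vp: "v p > 0" using nn[OF p] by simp
    have "snd p \<noteq> k"
    proof
      assume "snd p = k"
      then have "v p = 0" by (cases p) (simp add: v_def)
      then show False using vp by simp
    qed
    then have p': "snd p > k" using p by simp
    show False
    proof (cases "y = k")
      case True
      have "((\<lambda>t. v (a, t)) has_real_derivative defect' k a k) (at k)"
        using d_defect(1)[of k a k] by (simp add: v_def defect_def[abs_def])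
      note hopf = this
      have "2 * k - k = k" by simp
      then have v0: "v (a, k) = 0" unfolding v_def fst_conv snd_conv by simp
      have "defect' k a k > 0"
        by (rule hopf_half_plane[OF lap L_nonneg nn lv p' vp hopf v0])
      then show False using z True by simp
    next
      case False
      have "v (a, y) > 0"
        by (rule strong_max_principle_half_plane[OF lap L_nonneg nn lv p' vp]) (use y False in auto)
      then show False using z by (simp add: v_def defect_def)
    qed
  qed
  show ?thesis
  proof (cases "t \<ge> k")
    case True
    then show ?thesis using v0[of "(x, t)"] by (simp add: v_def)
  next
    case False
    then show ?thesis using v0[of "(x, 2 * k - t)"] by (simp add: v_def)
  qed
qed

text \<open>The equation gives \<open>u22\<close> at both points, so \<open>u11\<close> enters
  twice, hence \<open>2 * e\<close>; the range \<open>B + 2 * |k|\<close> covers the reflected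
  heights as well.\<close>

lemma defect''_bound:
  assumes "\<And>t. \<bar>t\<bar> \<le> B + 2 * \<bar>k\<bar> \<Longrightarrow> \<bar>u11 (x, t)\<bar> \<le> e" "\<bar>t\<bar> \<le> B"
  shows "\<bar>defect'' k x t\<bar> \<le> L * \<bar>defect k x t\<bar> + 2 * e"
proof -
  have "\<bar>u11 (x, t)\<bar> \<le> e" "\<bar>u11 (x, 2 * k - t)\<bar> \<le> e"
    using assms(2) by (auto intro!: assms(1))
  moreover have "u22 (x, t) = - f (u (x, t)) - u11 (x, t)"
    "u22 (x, 2 * k - t) = - f (u (x, 2 * k - t)) - u11 (x, 2 * k - t)"
    using pde[of "(x, t)"] pde[of "(x, 2 * k - t)"] by linarith+
  moreover have "\<bar>f (u (x, t)) - f (u (x, 2 * k - t))\<bar> \<le> L * \<bar>defect k x t\<bar>"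
    using f_u_diff[of "(x, t)" "(x, 2 * k - t)"] by (simp add: defect_def abs_minus_commute)
  ultimately show ?thesis unfolding defect''_def abs_le_iff by linarith
qed

text \<open>Since \<open>u\<^sub>1\<^sub>1\<close> vanishes at infinity, the profiles \<open>u (a n, _)\<close> asymptotically solve the ODE
  \<open>U'' = - f U\<close>, whose solutions depend continuously on the Cauchy data at \<open>y\<close>.\<close>

lemma defect_tendsto_0:
  assumes a: "filterlim a at_infinity sequentially"
    and d: "(\<lambda>n. defect k (a n) y) \<longlonglongrightarrow> 0" "(\<lambda>n. defect' k (a n) y) \<longlonglongrightarrow> 0"
  shows "(\<lambda>n. (defect k (a n) t)^2 + (defect' k (a n) t)^2) \<longlonglongrightarrow> 0"
proof (rule LIMSEQ_I)
  fix e :: real assume e: "e > 0"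
  define B where "B = max \<bar>y\<bar> \<bar>t\<bar>"
  define c where "c = exp ((L + 2) * \<bar>t - y\<bar>)"
  \<comment> \<open>Two errors of size at most \<open>q\<close>, from the Cauchy data and from
    \<open>u11\<close>, are amplified by \<open>c\<close>, which makes \<open>e / 2\<close>.\<close>
  define q where "q = e / (4 * c)"
  have c: "c > 0" by (simp add: c_def)
  have q: "q > 0" using e c by (simp add: q_def)
  \<comment> \<open>The error in the defect equation is \<open>2 * h\<close>, so
    \<open>(2 * h)^2 * |t - y|\<close> has to stay below \<open>q\<close>; the added 1 keeps the
    denominator positive when \<open>t = y\<close>.\<close>
  define h where "h = sqrt (q / (4 * (\<bar>t - y\<bar> + 1)))"
  have h: "h > 0" "(2 * h)^2 * \<bar>t - y\<bar> \<le> q"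
  proof -
    show "h > 0" using q by (auto simp: h_def intro!: divide_pos_pos add_nonneg_pos)
    have h2: "h^2 = q / (4 * (\<bar>t - y\<bar> + 1))" using q by (simp add: h_def)
    have h4: "(2 * h)^2 = 4 * h^2" by (simp add: power_mult_distrib)
    have "4 * (q / (4 * c)) * s = q * (s / c)" for c s :: real by simp
    then have "(2 * h)^2 * \<bar>t - y\<bar> = q * (\<bar>t - y\<bar> / (\<bar>t - y\<bar> + 1))"
      unfolding h4 h2 .
    also have "\<dots> \<le> q * 1" using q by (intro mult_left_mono) auto
    finally show "(2 * h)^2 * \<bar>t - y\<bar> \<le> q" by simp
  qed
  have "(\<lambda>n. (defect k (a n) y)^2 + (defect' k (a n) y)^2) \<longlonglongrightarrow> 0^2 + 0^2"
    by (intro tendsto_intros d)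
  then have "\<forall>\<^sub>F n in sequentially. (defect k (a n) y)^2 + (defect' k (a n) y)^2 < q"
    using order_tendstoD(2)[of _ 0] q by auto
  moreover have "\<forall>\<^sub>F n in sequentially. \<forall>t. \<bar>t\<bar> \<le> B + 2 * \<bar>k\<bar> \<longrightarrow> \<bar>u11 (a n, t)\<bar> \<le> h"
    by (rule sequence_limits(2)[OF a h(1)])
  ultimately have "\<forall>\<^sub>F n in sequentially. norm ((defect k (a n) t)^2 + (defect' k (a n) t)^2 - 0) < e"
  proof eventually_elim
    case (elim n)
    have "(defect k (a n) t)^2 + (defect' k (a n) t)^2 \<le>
        ((defect k (a n) y)^2 + (defect' k (a n) y)^2 + (2 * h)^2 * \<bar>t - y\<bar>) * exp ((L + 2) * \<bar>t - y\<bar>)"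
    proof (rule gronwall_second_order[OF d_defect _ L_nonneg])
      show "\<bar>defect'' k (a n) s\<bar> \<le> L * \<bar>defect k (a n) s\<bar> + 2 * h" if "\<bar>s\<bar> \<le> B" for s
        by (rule defect''_bound[OF _ that]) (use elim in auto)
    qed (auto simp: B_def)
    also have "\<dots> \<le> (q + q) * c"
      unfolding c_def using elim h(2) by (intro mult_right_mono) auto
    also have "\<dots> < e" using e c by (simp add: q_def)
    finally show ?case by simp
  qed
  then show "\<exists>N. \<forall>n\<ge>N. norm ((defect k (a n) t)^2 + (defect' k (a n) t)^2 - 0) < e"
    by (simp add: eventually_sequentially)
qed

text \<open>Averaging the moment with its image under \<open>t \<mapsto> 2 * k - t\<close> cancels
  the part of \<open>T\<close> that is even about \<open>k\<close>. The remaining integrand tends to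
  0 pointwise and is dominated, and by \<open>moment_const\<close> the limit along \<open>a\<close>
  is the value at every \<open>x\<close>.\<close>

lemma moment_eq_0:
  assumes a: "filterlim a at_infinity sequentially"
    and d: "\<And>t. (\<lambda>n. (defect k (a n) t)^2 + (defect' k (a n) t)^2) \<longlonglongrightarrow> 0"
  shows "moment k x = 0"
proof -
  have d0: "(\<lambda>n. defect k (a n) t) \<longlonglongrightarrow> 0" and d1: "(\<lambda>n. defect' k (a n) t) \<longlonglongrightarrow> 0" for t
  proof -
    have "(\<lambda>n. (defect k (a n) t)^2) \<longlonglongrightarrow> 0" "(\<lambda>n. (defect' k (a n) t)^2) \<longlonglongrightarrow> 0"
      by (rule Lim_null_comparison[OF _ d[of t]], simp)+
    then show "(\<lambda>n. defect k (a n) t) \<longlonglongrightarrow> 0" "(\<lambda>n. defect' k (a n) t) \<longlonglongrightarrow> 0"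
      by (simp_all add: tendsto_power_zero power_tendsto_0_iff)
  qed
  define C where "C = (1 + L) * bound^2 * (1 + \<bar>k\<bar>)"
  have mom: "moment k (a n) = integral\<^sup>L lborel (\<lambda>t. - ((t - k) * T (a n) (2 * k - t)))" for n
    unfolding moment_def
    by (subst lborel_integral_real_affine[of "-1" _ "2 * k"]) (auto simp: algebra_simps)
  have i2: "integrable lborel (\<lambda>t. - ((t - k) * T x (2 * k - t)))" for x
    using lborel_integrable_real_affine[OF integrable_moment[of k x], of "-1" "2 * k"]
    by (simp add: algebra_simps)
  have two: "2 * moment k (a n) = integral\<^sup>L lborel (\<lambda>t. (t - k) * (T (a n) t - T (a n) (2 * k - t)))" for n
  proof -
    have "2 * moment k (a n) = integral\<^sup>L lborel (\<lambda>t. (t - k) * T (a n) t + - ((t - k) * T (a n) (2 * k - t)))"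
      using Bochner_Integration.integral_add[OF integrable_moment i2] mom[of n] moment_def by simp
    then show ?thesis by (simp add: algebra_simps)
  qed
  have "(\<lambda>n. integral\<^sup>L lborel (\<lambda>t. (t - k) * (T (a n) t - T (a n) (2 * k - t)))) \<longlonglongrightarrow>
      integral\<^sup>L lborel (\<lambda>t::real. 0 :: real)"
  proof (rule integral_dominated_convergence[where w="\<lambda>t. C * dominator t + C * dominator (2 * k - t)"])
    have "integrable lborel (\<lambda>t. dominator (2 * k + (-1) * t))"
      by (rule lborel_integrable_real_affine[OF integrable_dominator]) simp
    then show "integrable lborel (\<lambda>t. C * dominator t + C * dominator (2 * k - t))"
      using integrable_dominator by simp
    show "AE t in lborel. norm ((t - k) * (T (a n) t - T (a n) (2 * k - t)))
        \<le> C * dominator t + C * dominator (2 * k - t)" for n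
    proof (rule AE_I2)
      fix t
      have "\<bar>(t - k) * T (a n) (2 * k - t)\<bar> = \<bar>((2 * k - t) - k) * T (a n) (2 * k - t)\<bar>"
        by (simp add: abs_mult abs_minus_commute)
      then have "\<bar>(t - k) * T (a n) (2 * k - t)\<bar> \<le> C * dominator (2 * k - t)"
        using moment_bound[of "2 * k - t" k "a n"] by (simp add: C_def)
      moreover have "\<bar>(t - k) * T (a n) t\<bar> \<le> C * dominator t"
        using moment_bound[of t k "a n"] by (simp add: C_def)
      ultimately show "norm ((t - k) * (T (a n) t - T (a n) (2 * k - t)))
        \<le> C * dominator t + C * dominator (2 * k - t)"
        unfolding right_diff_distrib real_norm_def by linarith
    qed
    show "AE t in lborel. (\<lambda>n. (t - k) * (T (a n) t - T (a n) (2 * k - t))) \<longlonglongrightarrow> 0"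
    proof (rule AE_I2)
      fix t
      have 1: "(\<lambda>n. (u1 (a n, t))^2 / 2 - (u1 (a n, 2 * k - t))^2 / 2) \<longlonglongrightarrow> 0^2 / 2 - 0^2 / 2"
        by (intro tendsto_intros sequence_limits(1)[OF a]) auto
      \<comment> \<open>The difference of the terms \<open>- u2^2 / 2\<close>, factored so that
        \<open>defect'\<close> appears.\<close>
      have 2: "(\<lambda>n. defect' k (a n) t * (u2 (a n, t) - u2 (a n, 2 * k - t)) / 2) \<longlonglongrightarrow> 0"
      proof (rule Lim_null_comparison)
        show "\<forall>\<^sub>F n in sequentially. norm (defect' k (a n) t * (u2 (a n, t) - u2 (a n, 2 * k - t)) / 2)
            \<le> \<bar>defect' k (a n) t\<bar> * bound"
        proof (intro always_eventually allI)
          fix n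
          have "\<bar>u2 (a n, t) - u2 (a n, 2 * k - t)\<bar> \<le> 2 * bound"
            using bounded(3)[of "(a n, t)"] bounded(3)[of "(a n, 2 * k - t)"] by linarith
          then have "\<bar>defect' k (a n) t\<bar> * \<bar>u2 (a n, t) - u2 (a n, 2 * k - t)\<bar> \<le> \<bar>defect' k (a n) t\<bar> * (2 * bound)"
            by (intro mult_left_mono) auto
          then show "norm (defect' k (a n) t * (u2 (a n, t) - u2 (a n, 2 * k - t)) / 2)
            \<le> \<bar>defect' k (a n) t\<bar> * bound" by (simp add: abs_mult)
        qed
        show "(\<lambda>n. \<bar>defect' k (a n) t\<bar> * bound) \<longlonglongrightarrow> 0"
          using tendsto_mult_left_zero[OF tendsto_rabs_zero[OF d1]] .
      qed
      have 3: "(\<lambda>n. F (u (a n, t)) - F (u (a n, 2 * k - t))) \<longlonglongrightarrow> 0"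
      proof (rule Lim_null_comparison)
        show "\<forall>\<^sub>F n in sequentially. norm (F (u (a n, t)) - F (u (a n, 2 * k - t))) \<le> L * K * \<bar>defect k (a n) t\<bar>"
          unfolding defect_def
          by (intro always_eventually allI) (use F_u_diff in \<open>simp add: abs_minus_commute\<close>)
        show "(\<lambda>n. L * K * \<bar>defect k (a n) t\<bar>) \<longlonglongrightarrow> 0"
          using tendsto_mult_right_zero[OF tendsto_rabs_zero[OF d0]] .
      qed
      have eq: "T (a n) t - T (a n) (2 * k - t) =
          ((u1 (a n, t))^2 / 2 - (u1 (a n, 2 * k - t))^2 / 2)
          + defect' k (a n) t * (u2 (a n, t) - u2 (a n, 2 * k - t)) / 2
          + (F (u (a n, t)) - F (u (a n, 2 * k - t)))" for n
        by (simp add: T_def defect'_def power2_eq_square field_simps)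
      have "(\<lambda>n. T (a n) t - T (a n) (2 * k - t)) \<longlonglongrightarrow> (0^2 / 2 - 0^2 / 2) + 0 + 0"
        unfolding eq by (intro tendsto_add 1 2 3)
      then show "(\<lambda>n. (t - k) * (T (a n) t - T (a n) (2 * k - t))) \<longlonglongrightarrow> 0"
        by (intro tendsto_mult_right_zero) simp
    qed
    show "(\<lambda>t. (t - k) * (T (a n) t - T (a n) (2 * k - t))) \<in> borel_measurable lborel" for n
      by measurable
  qed auto
  then have "(\<lambda>n. 2 * moment k (a n)) \<longlonglongrightarrow> 0" unfolding two by simp
  moreover have "moment k (a n) = moment k x" for n by (rule moment_const)
  ultimately show ?thesis by (simp add: LIMSEQ_const_iff)
qed

section \<open>Nonvanishing of the energy\<close>

text \<open>This is the Hamiltonian of \<open>U'' = - f U\<close>. Its derivative in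
  \<open>t\<close> is \<open>- u2 * u11\<close>, small far out on bounded intervals, and decay makes
  its value at a large height \<open>B\<close> small, so it is small at each fixed
  \<open>t\<close>.\<close>

lemma hamiltonian_tendsto_0:
  assumes a: "filterlim a at_infinity sequentially"
  shows "(\<lambda>n. (u2 (a n, t))^2 / 2 + F (u (a n, t))) \<longlonglongrightarrow> 0"
proof (rule LIMSEQ_I)
  fix e :: real assume e: "e > 0"
  define H where "H x t = (u2 (x, t))^2 / 2 + F (u (x, t))" for x t
  have bd: "\<bar>H x s\<bar> \<le> (1 + L) * bound^2 * weight \<sigma> s" for x s
  proof -
    let ?w = "bound * bound * (weight \<sigma> s)^2"
    note b = less_imp_le[OF bound_ge(4)]
    have "\<bar>u2 (x, s) * u2 (x, s)\<bar> \<le> ?w" "\<bar>u (x, s) * u (x, s)\<bar> \<le> ?w"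
      by (intro product_decay decay b)+
    then have "(u2 (x, s))^2 \<le> ?w" "(u (x, s))^2 \<le> ?w"
      by (simp_all add: power2_eq_square abs_le_iff)
    moreover from this have "\<bar>F (u (x, s))\<bar> \<le> L * ?w"
      using F_u_le[of "(x, s)"] mult_left_mono[OF _ L_nonneg] order_trans by blast
    moreover have "0 \<le> (u2 (x, s))^2" by simp
    ultimately have "\<bar>H x s\<bar> \<le> ?w + L * ?w" unfolding H_def by linarith
    also have "\<dots> = (1 + L) * bound^2 * (weight \<sigma> s)^2" by (simp add: power2_eq_square algebra_simps)
    also have "\<dots> \<le> (1 + L) * bound^2 * weight \<sigma> s"
      using L_nonneg weight_le_1[OF sigma, of s] weight_pos[of \<sigma> s]
      by (intro mult_left_mono) (auto simp: power2_eq_square mult_left_le)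
    finally show ?thesis .
  qed
  obtain R where R: "R > 0" "\<And>s. \<bar>s\<bar> \<ge> R \<Longrightarrow> (1 + L) * bound^2 * weight \<sigma> s < e / 2"
    using weight_small[OF sigma, of "e / 2"] e by auto
  define B where "B = max R \<bar>t\<bar>"
  \<comment> \<open>Makes the variation over an interval of length \<open>2 * B\<close> less than
    \<open>e / 2\<close>.\<close>
  define h where "h = e / (2 * bound * (2 * B + 1))"
  have B: "B \<ge> R" "\<bar>t\<bar> \<le> B" "B > 0" using R by (auto simp: B_def)
  have h: "h > 0" "bound * h * (2 * B) < e / 2"
  proof -
    show "h > 0" using e bound_ge(4) B by (simp add: h_def)
    then have "bound * h * (2 * B) < bound * h * (2 * B + 1)" using bound_ge(4) by simp
    also have "\<dots> = e / 2"
    proof -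
      have "bound * (e / (2 * bound * c)) * c = e / 2" if "c > 0" for c
        using that bound_ge(4) by simp
      then show ?thesis unfolding h_def using B by simp
    qed
    finally show "bound * h * (2 * B) < e / 2" .
  qed
  have "\<forall>\<^sub>F n in sequentially. \<forall>t. \<bar>t\<bar> \<le> B \<longrightarrow> \<bar>u11 (a n, t)\<bar> \<le> h"
    by (rule sequence_limits(2)[OF a h(1)])
  then have "\<forall>\<^sub>F n in sequentially. norm (H (a n) t - 0) < e"
  proof eventually_elim
    case (elim n)
    have "norm (H (a n) t - H (a n) B) \<le> bound * h * norm (t - B)"
    proof (rule field_differentiable_bound[of "{- B..B}" "H (a n)" "\<lambda>t. - (u2 (a n, t) * u11 (a n, t))"])
      fix s assume s: "s \<in> {- B..B}"
      have "u22 (a n, s) + f (u (a n, s)) = - u11 (a n, s)" using pde[of "(a n, s)"] by linarith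
      then have "u2 (a n, s) * (u22 (a n, s) + f (u (a n, s))) = - (u2 (a n, s) * u11 (a n, s))" by simp
      then have "(H (a n) has_real_derivative - (u2 (a n, s) * u11 (a n, s))) (at s)"
        unfolding H_def[abs_def]
        by (auto intro!: derivative_eq_intros du22 dF_u simp: algebra_simps)
      then show "(H (a n) has_field_derivative - (u2 (a n, s) * u11 (a n, s))) (at s within {- B..B})"
        by (rule has_field_derivative_at_within)
      have "\<bar>u2 (a n, s)\<bar> * \<bar>u11 (a n, s)\<bar> \<le> bound * h"
        using s elim bounded(3) bound_ge(4) by (intro mult_mono) auto
      then show "norm (- (u2 (a n, s) * u11 (a n, s))) \<le> bound * h" by (simp add: abs_mult)
    qed (use B in auto)
    also have "\<dots> \<le> bound * h * (2 * B)"
      using bound_ge(4) h B by (intro mult_left_mono) auto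
    finally have "\<bar>H (a n) t - H (a n) B\<bar> < e / 2" using h by simp
    moreover have "\<bar>H (a n) B\<bar> < e / 2" using bd[of "a n" B] R(2)[of B] B by simp
    ultimately show ?case unfolding real_norm_def diff_zero abs_less_iff by linarith
  qed
  then show "\<exists>N. \<forall>n\<ge>N. norm ((u2 (a n, t))^2 / 2 + F (u (a n, t)) - 0) < e"
    by (simp add: eventually_sequentially H_def)
qed

text \<open>A bound independent of \<open>x\<close>: between heights \<open>t\<close> and
  \<open>R\<close> the profile drops from at least \<open>\<epsilon> / 2\<close> to below
  \<open>\<epsilon> / 4\<close>, and Young's inequality
  \<open>- u2 \<le> s * u2^2 + 1 / (4 * s)\<close> turns the drop into a bound for the integral of
  \<open>u2^2\<close>.\<close>

lemma u2_squared_integral_ge: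
  assumes R: "\<And>t. \<bar>t\<bar> \<ge> R \<Longrightarrow> K * weight \<sigma> t < \<epsilon> / 4" "R > 0"
    and u: "u (x, t) \<ge> \<epsilon> / 2"
  shows "integrable lborel (\<lambda>t. (u2 (x, t))^2)"
    and "integral\<^sup>L lborel (\<lambda>t. (u2 (x, t))^2) \<ge> \<epsilon>^2 / (32 * R)"
proof -
  note b = less_imp_le[OF bound_ge(4)]
  show int: "integrable lborel (\<lambda>t. (u2 (x, t))^2)"
  proof (rule Bochner_Integration.integrable_bound)
    show "integrable lborel (\<lambda>t. bound^2 * dominator t)" using integrable_dominator by simp
    show "(\<lambda>t. (u2 (x, t))^2) \<in> borel_measurable lborel"
      by (auto intro!: borel_measurable_continuous_onI continuous_intros continuous_sections)
    show "AE t in lborel. norm ((u2 (x, t))^2) \<le> norm (bound^2 * dominator t)"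
    proof (rule AE_I2)
      fix t
      have "\<bar>u2 (x, t) * u2 (x, t)\<bar> \<le> bound * bound * (weight \<sigma> t)^2" by (intro product_decay decay b)
      also have "\<dots> \<le> bound * bound * dominator t"
        using weight_sq_le_dominator by (intro mult_left_mono) auto
      finally show "norm ((u2 (x, t))^2) \<le> norm (bound^2 * dominator t)"
        by (simp add: power2_eq_square)
    qed
  qed
  have t: "\<bar>t\<bar> < R"
    using R(1)[of t] u u_le[of x t] eps by (cases "\<bar>t\<bar> < R") auto
  have uR: "u (x, R) < \<epsilon> / 4"
    using R(1)[of R] R(2) u_le[of x R] by simp
  \<comment> \<open>The interval from \<open>t\<close> to \<open>R\<close> has length at most
    \<open>2 * R\<close>, so with this \<open>s\<close> the constant in Young's inequality costs
    \<open>\<epsilon> / 8\<close>, half of the guaranteed drop.\<close>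
  define s where "s = 4 * R / \<epsilon>"
  have s: "s > 0" using R eps by (simp add: s_def)
  have tR: "t \<le> R" using t by simp
  have FTC: "has_bochner_integral lborel (\<lambda>r. u2 (x, r) * indicator {t..R} r) (u (x, R) - u (x, t))"
    by (rule has_bochner_integral_FTC_Icc_real[OF tR])
      (auto intro: du2 DERIV_isCont[OF du22])
  have ind: "integrable lborel (indicator {t..R} :: real \<Rightarrow> real)"
    by (rule integrable_real_indicator) (auto simp: emeasure_lborel_Icc_eq)
  have "integral\<^sup>L lborel (\<lambda>r. - (u2 (x, r) * indicator {t..R} r)) \<le>
      integral\<^sup>L lborel (\<lambda>r. s * (u2 (x, r))^2 + indicator {t..R} r * (1 / (4 * s)))"
  proof (rule integral_mono)
    show "integrable lborel (\<lambda>r. - (u2 (x, r) * indicator {t..R} r))"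
      using FTC by (auto simp: has_bochner_integral_iff)
    show "integrable lborel (\<lambda>r. s * (u2 (x, r))^2 + indicator {t..R} r * (1 / (4 * s)))"
      using int ind by (intro Bochner_Integration.integrable_add integrable_mult_left) auto
    fix r
    have "0 \<le> (2 * s * u2 (x, r) + 1)^2 / (4 * s)" using s by simp
    also have "\<dots> = s * (u2 (x, r))^2 + u2 (x, r) + 1 / (4 * s)"
      using s by (simp add: power2_eq_square field_simps)
    finally show "- (u2 (x, r) * indicator {t..R} r) \<le> s * (u2 (x, r))^2 + indicator {t..R} r * (1 / (4 * s))"
      using s by (auto simp: indicator_def)
  qed
  moreover have "integral\<^sup>L lborel (\<lambda>r. - (u2 (x, r) * indicator {t..R} r)) = u (x, t) - u (x, R)"
    using FTC by (simp add: has_bochner_integral_iff)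
  moreover have "integral\<^sup>L lborel (\<lambda>r. s * (u2 (x, r))^2 + indicator {t..R} r * (1 / (4 * s)))
      = s * integral\<^sup>L lborel (\<lambda>r. (u2 (x, r))^2) + (R - t) * (1 / (4 * s))"
    using int ind tR by (subst Bochner_Integration.integral_add) auto
  ultimately have "\<epsilon> / 4 \<le> s * integral\<^sup>L lborel (\<lambda>r. (u2 (x, r))^2) + (R - t) * (1 / (4 * s))"
    using u uR by linarith
  moreover have "(R - t) * (1 / (4 * s)) \<le> (2 * R) * (1 / (4 * s))"
    using t s by (intro mult_right_mono) auto
  moreover have "(2 * R) * (1 / (4 * s)) = \<epsilon> / 8" using R eps by (simp add: s_def)
  ultimately have "\<epsilon> / 8 \<le> s * integral\<^sup>L lborel (\<lambda>r. (u2 (x, r))^2)" by linarith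
  then show "integral\<^sup>L lborel (\<lambda>t. (u2 (x, t))^2) \<ge> \<epsilon>^2 / (32 * R)"
    using R(2) eps by (simp add: s_def field_simps power2_eq_square)
qed

text \<open>\<open>T + u2^2\<close> is \<open>u1^2 / 2\<close> plus the Hamiltonian, so its integral
  tends to 0 along \<open>a\<close>. With zero energy the integral of \<open>u2^2\<close> would tend
  to 0, against \<open>u2_squared_integral_ge\<close>.\<close>

lemma energy_neq_0:
  assumes a: "filterlim a at_infinity sequentially" and u: "\<And>n. u (a n, b n) \<ge> \<epsilon> / 2"
  shows "energy x \<noteq> 0"
proof
  assume E0: "energy x = 0"
  obtain R where R: "R > 0" "\<And>t. \<bar>t\<bar> \<ge> R \<Longrightarrow> K * weight \<sigma> t < \<epsilon> / 4"
    using weight_small[OF sigma, of "\<epsilon> / 4"] eps by auto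
  have int: "integrable lborel (T x)" for x
  proof -
    have "integrable lborel (\<lambda>t. (t - 0) * T x t - (t - 1) * T x t)"
      by (intro Bochner_Integration.integrable_diff integrable_moment)
    then show ?thesis by (simp add: algebra_simps)
  qed
  define C where "C = (2 + L) * bound^2"
  note b = less_imp_le[OF bound_ge(4)]
  note sq = u2_squared_integral_ge[OF R(2,1) u]
  have "(\<lambda>n. integral\<^sup>L lborel (\<lambda>t. T (a n) t + (u2 (a n, t))^2)) \<longlonglongrightarrow> integral\<^sup>L lborel (\<lambda>t::real. 0 :: real)"
  proof (rule integral_dominated_convergence[where w="\<lambda>t. C * dominator t"])
    show "(\<lambda>t. T (a n) t + (u2 (a n, t))^2) \<in> borel_measurable lborel" for n
      by (auto intro!: borel_measurable_continuous_onI continuous_intros continuous_sections T_continuous)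
    show "AE t in lborel. (\<lambda>n. T (a n) t + (u2 (a n, t))^2) \<longlonglongrightarrow> 0"
    proof (rule AE_I2)
      fix t
      have "(\<lambda>n. (u1 (a n, t))^2 / 2 + ((u2 (a n, t))^2 / 2 + F (u (a n, t)))) \<longlonglongrightarrow> 0^2 / 2 + 0"
        by (intro tendsto_intros sequence_limits(1)[OF a] hamiltonian_tendsto_0[OF a]) auto
      then show "(\<lambda>n. T (a n) t + (u2 (a n, t))^2) \<longlonglongrightarrow> 0"
        by (simp add: T_def algebra_simps)
    qed
    show "AE t in lborel. norm (T (a n) t + (u2 (a n, t))^2) \<le> C * dominator t" for n
    proof (rule AE_I2)
      fix t
      have "\<bar>u2 (a n, t) * u2 (a n, t)\<bar> \<le> bound * bound * (weight \<sigma> t)^2" by (intro product_decay decay b)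
      then have "\<bar>(u2 (a n, t))^2\<bar> \<le> bound^2 * (weight \<sigma> t)^2" by (simp add: power2_eq_square)
      then have "\<bar>T (a n) t + (u2 (a n, t))^2\<bar> \<le> (1 + L) * bound^2 * (weight \<sigma> t)^2 + bound^2 * (weight \<sigma> t)^2"
        using T_decay[of "a n" t] by linarith
      also have "\<dots> = C * (weight \<sigma> t)^2" by (simp add: C_def algebra_simps)
      also have "\<dots> \<le> C * dominator t"
        using weight_sq_le_dominator L_nonneg by (intro mult_left_mono) (auto simp: C_def)
      finally show "norm (T (a n) t + (u2 (a n, t))^2) \<le> C * dominator t" by simp
    qed
  qed (use integrable_dominator in auto)
  moreover have "integral\<^sup>L lborel (\<lambda>t. T (a n) t + (u2 (a n, t))^2) \<ge> \<epsilon>^2 / (32 * R)" for n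
  proof -
    have "integral\<^sup>L lborel (T (a n)) = 0" using E0 energy_const[of x "a n"] by (simp add: energy_def)
    then show ?thesis using int[of "a n"] sq[of n] by simp
  qed
  ultimately have "\<epsilon>^2 / (32 * R) \<le> integral\<^sup>L lborel (\<lambda>t::real. 0 :: real)"
    by (intro tendsto_lowerbound[OF _ always_eventually]) auto
  then show False using eps R by (simp add: divide_le_0_iff)
qed

text \<open>A nonzero energy and a vanishing moment determine \<open>k\<close>, which makes the
  positions found from above and from below comparable.\<close>

theorem moving_plane:
  "\<exists>k. dominates k \<and> ((\<forall>x t. u (x, 2 * k - t) = u (x, t)) \<or> (energy 0 \<noteq> 0 \<and> moment k 0 = 0))"
proof -
  obtain k where k: "dominates k" "\<And>\<delta>. \<delta> > 0 \<Longrightarrow> \<exists>k'. k - \<delta> < k' \<and> k' < k \<and> \<not> dominates k'"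
    using critical_position by blast
  obtain a b y where s: "y \<ge> k" "b \<longlonglongrightarrow> y" "\<And>n::nat. u (a n, b n) \<ge> \<epsilon> / 2"
    "(\<lambda>n. defect k (a n) y) \<longlonglongrightarrow> 0" "(\<lambda>n. defect' k (a n) y) \<longlonglongrightarrow> 0"
    by (rule critical_sequence[OF k(1)], erule k(2), rule that)
  show ?thesis
  proof (cases "filterlim a at_infinity sequentially")
    case True
    have "moment k 0 = 0"
      by (rule moment_eq_0[OF True defect_tendsto_0[OF True s(4,5)]])
    then show ?thesis using energy_neq_0[OF True s(3)] k(1) by blast
  next
    \<comment> \<open>Then \<open>a\<close> is bounded along a subsequence, a further one converges
      to some \<open>l\<close>, and by continuity contact takes place at the point
      \<open>(l, y)\<close>.\<close>
    case False
    then obtain B where "\<not> (\<forall>\<^sub>F n in sequentially. B \<le> norm (a n))"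
      unfolding filterlim_at_infinity_conv_norm_at_top filterlim_at_top by blast
    then have "\<exists>\<^sub>F n in sequentially. \<bar>a n\<bar> < B"
      by (simp add: frequently_def not_less)
    then obtain r where r: "strict_mono (r :: nat \<Rightarrow> nat)" "\<And>n. \<bar>a (r n)\<bar> < B"
      using infinite_enumerate[of "{n. \<bar>a n\<bar> < B}"] by (auto simp: cofinite_eq_sequentially[symmetric] frequently_cofinite)
    have "Bseq (a \<circ> r)" by (rule BseqI'[of _ B]) (simp add: less_imp_le[OF r(2)])
    then have "bounded (range (a \<circ> r))" by (simp add: Bseq_eq_bounded)
    then obtain l q where q: "strict_mono (q :: nat \<Rightarrow> nat)" "((a \<circ> r) \<circ> q) \<longlonglongrightarrow> l"
      using bounded_imp_convergent_subsequence by blast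
    let ?c = "\<lambda>n. a (r (q n))"
    have c: "?c \<longlonglongrightarrow> l" using q(2) by (simp add: comp_def)
    have lims: "(\<lambda>n. defect k (?c n) y) \<longlonglongrightarrow> 0" "(\<lambda>n. defect' k (?c n) y) \<longlonglongrightarrow> 0"
      using LIMSEQ_subseq_LIMSEQ[OF LIMSEQ_subseq_LIMSEQ[OF s(4) r(1)] q(1)]
        LIMSEQ_subseq_LIMSEQ[OF LIMSEQ_subseq_LIMSEQ[OF s(5) r(1)] q(1)] by (simp_all add: comp_def)
    have cu: "(\<lambda>n. g (?c n, t)) \<longlonglongrightarrow> g (l, t)" if "continuous_on UNIV g" for g :: "real \<times> real \<Rightarrow> real" and t
      by (rule continuous_on_tendsto_compose[OF that]) (auto intro!: tendsto_intros c)
    have "(\<lambda>n. defect k (?c n) y) \<longlonglongrightarrow> defect k l y" "(\<lambda>n. defect' k (?c n) y) \<longlonglongrightarrow> defect' k l y"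
      unfolding defect_def defect'_def by (intro tendsto_intros cu cont)+
    then have "defect k l y = 0" "defect' k l y = 0"
      using lims LIMSEQ_unique by blast+
    then show ?thesis using symmetric_of_touching[OF k(1) s(1)] k(1) by blast
  qed
qed

end

section \<open>Planes from below and conclusion\<close>

text \<open>Moving planes from below are moving planes from above for the reflected solution;
  exactly the derivatives of odd order in the second variable change sign.\<close>

lemma (in decaying_solution) reflection:
  "decaying_solution f F (\<lambda>p. u (fst p, - snd p)) (\<lambda>p. u1 (fst p, - snd p)) (\<lambda>p. - u2 (fst p, - snd p))
     (\<lambda>p. u11 (fst p, - snd p)) (\<lambda>p. - u12 (fst p, - snd p)) (\<lambda>p. u22 (fst p, - snd p)) \<epsilon> K L \<sigma>"
proof -
  have ch: "((\<lambda>t. g (x, - t)) has_real_derivative - g' (x, - y)) (at y)"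
    if "\<And>x y. ((\<lambda>t. g (x, t)) has_real_derivative g' (x, y)) (at y)" for g g' :: "real \<times> real \<Rightarrow> real" and x y
    using DERIV_chain2[OF that[of x "- y"] DERIV_minus[OF DERIV_ident]] by simp
  have c: "continuous_on UNIV (\<lambda>p. g (fst p, - snd p))" if "continuous_on UNIV g" for g :: "real \<times> real \<Rightarrow> real"
    by (rule continuous_on_compose2[OF that]) (auto intro!: continuous_intros)
  have u_le': "u (x, - y) \<le> K * weight \<sigma> y" for x y using u_le[of x "- y"] by simp
  show ?thesis
    by unfold_locales
      (auto intro!: f_lipschitz L_nonneg f_0 f_antimono eps sigma F F_0 u_pos u_le' du1 du11 ch[OF du2] ch[OF du12]
        DERIV_minus du21 c cont continuous_intros pde u1_lim
        simp: ch[OF du22, THEN DERIV_minus, simplified])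
qed

theorem (in decaying_solution) symmetric:
  "\<exists>k. \<forall>x t. u (x, 2 * k - t) = u (x, t)"
proof -
  interpret r: decaying_solution f F "\<lambda>p. u (fst p, - snd p)" "\<lambda>p. u1 (fst p, - snd p)"
    "\<lambda>p. - u2 (fst p, - snd p)" "\<lambda>p. u11 (fst p, - snd p)" "\<lambda>p. - u12 (fst p, - snd p)"
    "\<lambda>p. u22 (fst p, - snd p)" \<epsilon> K L \<sigma>
    by (rule reflection)
  obtain k where k: "dominates k"
    "(\<forall>x t. u (x, 2 * k - t) = u (x, t)) \<or> (energy 0 \<noteq> 0 \<and> moment k 0 = 0)"
    using moving_plane by blast
  obtain k' where k': "r.dominates k'"
    "(\<forall>x t. u (x, - (2 * k' - t)) = u (x, - t)) \<or> r.moment k' 0 = 0"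
    using r.moving_plane by auto
  consider "\<forall>x t. u (x, 2 * k - t) = u (x, t)" | "\<forall>x t. u (x, - (2 * k' - t)) = u (x, - t)"
    | "energy 0 \<noteq> 0" "moment k 0 = 0" "r.moment k' 0 = 0"
    using k(2) k'(2) by blast
  then show ?thesis
  proof cases
    case 1
    then show ?thesis by blast
  next
    case 2
    have "u (x, 2 * (- k') - t) = u (x, t)" for x t
      using spec[OF spec[OF 2, of x], of "- t"] by simp
    then show ?thesis by blast
  next
    case 3
    \<comment> \<open>The square hides the sign change of \<open>u2\<close>, so \<open>T\<close> is
      merely reflected.\<close>
    have T: "r.T x t = T x (- t)" for x t by (simp add: r.T_def T_def)
    have "r.moment k' 0 = integral\<^sup>L lborel (\<lambda>t. (t - k') * T 0 (- t))"
      by (simp add: r.moment_def T)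
    also have "\<dots> = integral\<^sup>L lborel (\<lambda>t. - ((t - - k') * T 0 t))"
      by (subst lborel_integral_real_affine[of "-1" _ 0]) (auto simp: algebra_simps)
    also have "\<dots> = - moment (- k') 0" unfolding moment_def by simp
    finally have "moment (- k') 0 = 0" using 3 by simp
    \<comment> \<open>Both \<open>k\<close> and \<open>- k'\<close> are zeros of the moment, an
      affine function of the position with slope \<open>- energy 0\<close>.\<close>
    then have "(- k' - k) * energy 0 = 0" using moment_diff[of k 0 "- k'"] 3 by simp
    then have kk: "k' = - k" using 3 by simp
    have left: "u (x, t) \<le> u (x, 2 * k - t)" if "t \<le> k" for x t
    proof -
      have "- t \<ge> k'" using that kk by simp
      then have "u (x, - (- t)) \<le> u (x, - (2 * k' - - t))"
        using k'(1) unfolding r.dominates_def by fastforce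
      then show ?thesis by (simp add: kk algebra_simps)
    qed
    have right: "u (x, t) \<le> u (x, 2 * k - t)" if "t \<ge> k" for x t
      using k(1) that by (simp add: dominates_def)
    have "u (x, 2 * k - t) = u (x, t)" for x t
    proof (rule antisym)
      show "u (x, t) \<le> u (x, 2 * k - t)" using left right by (cases "t \<ge> k") auto
      \<comment> \<open>The comparison at the reflected point is the reverse inequality.\<close>
      have "u (x, 2 * k - t) \<le> u (x, 2 * k - (2 * k - t))"
        using left[of "2 * k - t" x] right[of "2 * k - t" x] by (cases "t \<ge> k") auto
      then show "u (x, 2 * k - t) \<le> u (x, t)" by simp
    qed
    then show ?thesis by blast
  qed
qed

section \<open>From the C^2 hypotheses to the abstract setting\<close>

lemma dir_deriv_partial:
  fixes g :: "real \<times> real \<Rightarrow> real"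
  assumes "g differentiable (at (x, y))"
  shows "((\<lambda>s. g (s, y)) has_real_derivative dir_deriv (1, 0) g (x, y)) (at x)"
    and "((\<lambda>t. g (x, t)) has_real_derivative dir_deriv (0, 1) g (x, y)) (at y)"
proof -
  let ?D = "frechet_derivative g (at (x, y))"
  have D: "(g has_derivative ?D) (at (x, y))" using assms frechet_derivative_works by blast
  then have lin: "linear ?D" using has_derivative_linear by blast
  have "((\<lambda>s. g (s, y)) has_derivative (\<lambda>h. ?D (h, 0))) (at x)"
    by (rule has_derivative_compose[of "\<lambda>s. (s, y)" "\<lambda>h. (h, 0)" x UNIV g ?D])
      (use D in \<open>auto intro!: derivative_eq_intros\<close>)
  moreover have "?D (h, 0) = dir_deriv (1, 0) g (x, y) * h" for h
    using linear_scale[OF lin, of h "(1, 0)"] by (simp add: dir_deriv_def mult.commute)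
  ultimately show "((\<lambda>s. g (s, y)) has_real_derivative dir_deriv (1, 0) g (x, y)) (at x)"
    by (simp add: has_field_derivative_def)
  have "((\<lambda>t. g (x, t)) has_derivative (\<lambda>h. ?D (0, h))) (at y)"
    by (rule has_derivative_compose[of "\<lambda>t. (x, t)" "\<lambda>h. (0, h)" y UNIV g ?D])
      (use D in \<open>auto intro!: derivative_eq_intros\<close>)
  moreover have "?D (0, h) = dir_deriv (0, 1) g (x, y) * h" for h
    using linear_scale[OF lin, of h "(0, 1)"] by (simp add: dir_deriv_def mult.commute)
  ultimately show "((\<lambda>t. g (x, t)) has_real_derivative dir_deriv (0, 1) g (x, y)) (at y)"
    by (simp add: has_field_derivative_def)
qed

lemma weight_bound_of_powr_decay:
  fixes u :: "real \<times> real \<Rightarrow> real"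
  assumes bd: "\<And>p. u p \<le> U" and U: "U \<ge> 0" and pos: "C > 0" "M > 0" "\<sigma> > 0"
    and dec: "\<And>x y. \<bar>y\<bar> > M \<Longrightarrow> u (x, y) \<le> C * \<bar>y\<bar> powr (- (1 + \<sigma>))"
  obtains K where "\<And>x y. u (x, y) \<le> K * weight \<sigma> y"
proof -
  \<comment> \<open>Beyond \<open>N\<close>, which is at least 1, \<open>1 + |y|\<close> is at most
    \<open>2 * |y|\<close>, hence the power of 2 in \<open>K\<close>; up to \<open>N\<close> the
    global bound \<open>U\<close> serves.\<close>
  define N where "N = max M 1"
  define p where "p = 1 + \<sigma>"
  have p: "p > 0" using pos by (simp add: p_def)
  define K where "K = C * 2 powr p + U * (1 + N) powr p"
  have "u (x, y) \<le> K * weight \<sigma> y" for x y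
  proof -
    let ?w = "(1 + \<bar>y\<bar>) powr (- p)"
    have w: "?w > 0" by (simp add: add_pos_nonneg)
    have w1: "(1 + \<bar>y\<bar>) powr p * ?w = 1" by (simp add: powr_add[symmetric] add_pos_nonneg)
    have "u (x, y) \<le> C * 2 powr p * ?w + U * (1 + N) powr p * ?w"
    proof (cases "\<bar>y\<bar> > N")
      case True
      then have y: "\<bar>y\<bar> > M" "\<bar>y\<bar> > 1" by (auto simp: N_def)
      have "(1 + \<bar>y\<bar>) powr p \<le> (2 * \<bar>y\<bar>) powr p" using y p by (intro powr_mono2) auto
      also have "\<dots> = 2 powr p * \<bar>y\<bar> powr p" by (rule powr_mult)
      finally have "(1 + \<bar>y\<bar>) powr p * (\<bar>y\<bar> powr (- p) * ?w) \<le> 2 powr p * \<bar>y\<bar> powr p * (\<bar>y\<bar> powr (- p) * ?w)"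
        by (intro mult_right_mono) auto
      moreover have "(1 + \<bar>y\<bar>) powr p * (\<bar>y\<bar> powr (- p) * ?w) = \<bar>y\<bar> powr (- p)"
        using w1 by (metis mult.left_commute mult.right_neutral)
      moreover have "\<bar>y\<bar> powr p * \<bar>y\<bar> powr (- p) = 1" using y by (simp add: powr_add[symmetric])
      then have "2 powr p * \<bar>y\<bar> powr p * (\<bar>y\<bar> powr (- p) * ?w) = 2 powr p * ?w"
        by (metis mult.assoc mult_1)
      ultimately have "\<bar>y\<bar> powr (- p) \<le> 2 powr p * ?w" by simp
      then have "C * \<bar>y\<bar> powr (- p) \<le> C * (2 powr p * ?w)" using pos by (intro mult_left_mono) auto
      moreover have "u (x, y) \<le> C * \<bar>y\<bar> powr (- p)" using dec[OF y(1)] by (simp add: p_def)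
      moreover have "0 \<le> U * (1 + N) powr p * ?w" using U by simp
      ultimately show ?thesis by simp
    next
      case False
      have "(1 + \<bar>y\<bar>) powr p \<le> (1 + N) powr p" using False p by (intro powr_mono2) auto
      then have "1 \<le> (1 + N) powr p * ?w"
        using mult_right_mono[of "(1 + \<bar>y\<bar>) powr p" "(1 + N) powr p" ?w] w w1 by simp
      then have "U * 1 \<le> U * ((1 + N) powr p * ?w)" using U by (intro mult_left_mono)
      moreover have "0 \<le> C * 2 powr p * ?w" using pos by simp
      ultimately show ?thesis using bd[of "(x, y)"] by simp
    qed
    then show ?thesis by (simp add: weight_def K_def p_def algebra_simps)
  qed
  then show ?thesis by (rule that)
qed

theorem theorem7:
  fixes f :: "real \<Rightarrow> real" and u :: "real \<times> real \<Rightarrow> real" and \<epsilon> C M \<sigma> :: real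
  assumes f_C2: "Ck 2 f"
    and f_0: "f 0 = 0"
    and eps: "\<epsilon> > 0"
    and f'_nonpos: "\<And>s. s \<in> {0<..<\<epsilon>} \<Longrightarrow> deriv f s \<le> 0"
    and u_C2: "Ck 2 u"
    and u_pos: "\<And>x. u x > 0"
    and u_bdd: "bounded (range u)"
    and u_eq: "\<And>x. - laplacian u x = f (u x)"
    and C_M_sigma_pos: "C > 0" "M > 0" "\<sigma> > 0"
    and u_decay: "\<And>x1 x2. \<bar>x2\<bar> > M \<Longrightarrow> u (x1, x2) \<le> C * \<bar>x2\<bar> powr (- (1 + \<sigma>))"
    and u_x1: "\<And>x2. ((\<lambda>x1. dir_deriv (1, 0) u (x1, x2)) \<longlongrightarrow> 0) at_infinity"
  shows "\<exists>l :: real. \<exists>g :: real \<Rightarrow> real \<Rightarrow> real. \<forall>x1 x2. u (x1, x2) = g x1 \<bar>x2 - l\<bar>"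
proof -
  have f_diff: "f differentiable (at s)" and f'_diff: "deriv f differentiable (at s)" for s
    using f_C2 by (simp_all add: numeral_2_eq_2 Ck_Suc_real del: Ck.simps(2))
  have df: "(f has_real_derivative deriv f s) (at s)" for s
    using f_diff DERIV_deriv_iff_real_differentiable by blast
  have cf': "continuous_on A (deriv f)" for A
    using f'_diff by (intro continuous_at_imp_continuous_on ballI differentiable_imp_continuous_within)
  have B: "(1, 0) \<in> (Basis :: (real \<times> real) set)" "(0, 1) \<in> (Basis :: (real \<times> real) set)"
    by (auto simp: Basis_prod_def)
  have u_diff: "u differentiable (at p)" for p
    using u_C2 unfolding numeral_2_eq_2 Ck.simps by blast
  define u1 where "u1 = dir_deriv (1, 0) u"
  define u2 where "u2 = dir_deriv (0, 1) u"
  have u12_diff: "u1 differentiable (at p)" "u2 differentiable (at p)" for p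
    using u_C2 B unfolding numeral_2_eq_2 Ck.simps u1_def u2_def by blast+
  have c2: "continuous_on UNIV (dir_deriv (1, 0) u1)" "continuous_on UNIV (dir_deriv (0, 1) u1)"
    "continuous_on UNIV (dir_deriv (1, 0) u2)" "continuous_on UNIV (dir_deriv (0, 1) u2)"
    using u_C2 B unfolding numeral_2_eq_2 Ck.simps u1_def u2_def by blast+
  have c1: "continuous_on UNIV u" "continuous_on UNIV u1" "continuous_on UNIV u2"
    using u_diff u12_diff
    by (auto intro!: continuous_at_imp_continuous_on differentiable_imp_continuous_within)
  note d = dir_deriv_partial[OF u_diff, folded u1_def u2_def]
  note d1 = dir_deriv_partial[OF u12_diff(1)]
  note d2 = dir_deriv_partial[OF u12_diff(2)]
  have sym: "dir_deriv (1, 0) u2 p = dir_deriv (0, 1) u1 p" for p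
    by (rule mixed_partials_eq[OF d d1(2) d2(1) c2(2,3), symmetric])
  obtain U where U: "\<And>p. \<bar>u p\<bar> \<le> U" using u_bdd unfolding bounded_iff by auto
  obtain K where K: "\<And>x y. u (x, y) \<le> K * weight \<sigma> y"
    by (rule weight_bound_of_powr_decay[of u U C M \<sigma>])
      (use U[THEN abs_le_D1] order_trans[OF abs_ge_zero U] C_M_sigma_pos u_decay in auto)
  obtain L where L: "\<And>s. s \<in> {0..K} \<Longrightarrow> \<bar>deriv f s\<bar> \<le> L"
  proof -
    have "bounded (deriv f ` {0..K})"
      by (intro compact_imp_bounded compact_continuous_image cf') simp
    then obtain a where "\<forall>s\<in>{0..K}. \<bar>deriv f s\<bar> \<le> a" unfolding bounded_iff by auto
    then show ?thesis using that by blast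
  qed
  \<comment> \<open>A global antiderivative of the continuous \<open>f\<close>;
    \<open>G s - G 0\<close> is the one vanishing at 0.\<close>
  have "\<exists>G. \<forall>x. -\<infinity> < ereal x \<longrightarrow> ereal x < \<infinity> \<longrightarrow> (G has_vector_derivative f x) (at x)"
    by (rule einterval_antiderivative) (auto intro: DERIV_isCont[OF df])
  then obtain G where G: "\<And>x. (G has_real_derivative f x) (at x)"
    by (auto simp: has_real_derivative_iff_has_vector_derivative)
  \<comment> \<open>The sign of \<open>K\<close> is not yet known here, so \<open>{0..K}\<close>
    could be empty and \<open>L\<close> negative; the maximum makes the Lipschitz constant
    nonnegative.\<close>
  interpret decaying_solution f "\<lambda>s. G s - G 0" u u1 u2 "dir_deriv (1, 0) u1" "dir_deriv (0, 1) u1"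
    "dir_deriv (0, 1) u2" \<epsilon> K "max L 0" \<sigma>
  proof
    show "\<bar>f s - f t\<bar> \<le> max L 0 * \<bar>s - t\<bar>" if "s \<in> {0..K}" "t \<in> {0..K}" for s t
    proof -
      have "norm (f s - f t) \<le> max L 0 * norm (s - t)"
        by (rule field_differentiable_bound[of "{0..K}" f "deriv f"])
          (use that L in \<open>auto intro!: has_field_derivative_at_within df simp: le_max_iff_disj\<close>)
      then show ?thesis by simp
    qed
    \<comment> \<open>The mean value point lies strictly between \<open>s\<close> and
      \<open>t\<close>, hence in the open interval where \<open>f'\<close> is controlled, even for
      \<open>s = 0\<close>.\<close>
    show "f t \<le> f s" if "0 \<le> s" "s \<le> t" "t < \<epsilon>" for s t
    proof (cases "s = t")
      case False
      then have st: "s < t" using that by simp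
      then obtain z where z: "s < z" "z < t" "f t - f s = (t - s) * deriv f z"
        using MVT2[OF st df] by blast
      have "deriv f z \<le> 0" using f'_nonpos[of z] z that by simp
      then have "(t - s) * deriv f z \<le> 0" using st by (simp add: mult_nonneg_nonpos)
      then show ?thesis using z by simp
    qed simp
    show "((\<lambda>s. G s - G 0) has_real_derivative f s) (at s)" for s
      by (auto intro!: derivative_eq_intros G)
    show "((\<lambda>s. u2 (s, y)) has_real_derivative dir_deriv (0, 1) u1 (x, y)) (at x)" for x y
      using d2(1) sym by simp
    show "dir_deriv (1, 0) u1 p + dir_deriv (0, 1) u2 p = - f (u p)" for p
      using u_eq[of p] by (simp add: laplacian_plane u1_def u2_def)
    show "((\<lambda>x. u1 (x, y)) \<longlongrightarrow> 0) at_infinity" for y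
      using u_x1 by (simp add: u1_def)
  qed (use f_0 eps u_pos K C_M_sigma_pos d d1 d2 c1 c2 in auto)
  obtain k where k: "\<And>x t. u (x, 2 * k - t) = u (x, t)" using symmetric by blast
  \<comment> \<open>\<open>k + |x2 - k|\<close> is \<open>x2\<close> or its mirror image about
    \<open>k\<close>, so \<open>u (x, k + s)\<close> is the required function of \<open>x\<close>
    and the distance \<open>s\<close>.\<close>
  have "u (x1, x2) = u (x1, k + \<bar>x2 - k\<bar>)" for x1 x2
    using k[of x1 x2] by (cases "x2 \<ge> k") auto
  then show ?thesis
    by (intro exI[of _ k] exI[of _ "\<lambda>x s. u (x, k + s)"] allI)
qed

end
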